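(* Let $0<\kappa<1/2$. There exist a time-dependent divergence-free velocity field $u$ on $\mathbb{R}^+\times\mathbb{T}^2$, which for every $1\le p\le\infty$ is bounded in $\dot W^{1,p}(\mathbb{T}^2)$ uniformly in time (so that the Lipschitz case $p=\infty$ is included), and a solution $\rho$, with values in $\{+1,-1\}$ and with $\int_{\mathbb{T}^2}\rho(0,x)\,dx=0$, of the continuity equation $\partial_t\rho+\mathrm{div}(u\rho)=0$ on $\mathbb{R}^+\times\mathbb{T}^2$, such that both the functional mixing scale and the geometric mixing scale (with parameter $\kappa$) of $\rho(t,\cdot)$ decay exponentially in time, that is, there are constants $C,c>0$ such that for all $t\ge 0$ $$\|\rho(t,\cdot)\|_{\dot H^{-1}(\mathbb{T}^2)}\le C e^{-ct}\qquad\text{and}\qquad \varepsilon(t)\le Ce^{-ct}.$$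
   Context: $\mathbb{T}^2$ is the two-dimensional flat torus and $\dot W^{s,p}$, $\dot H^{s}$ denote homogeneous Sobolev (semi)norms. Solutions of the continuity equation are understood in the sense of distributions. "Bounded in $\dot W^{1,p}(\mathbb{T}^2)$ uniformly in time" means that $\sup_{t}\|u(t,\cdot)\|_{\dot W^{1,p}(\mathbb{T}^2)}<\infty$. The functional mixing scale of $\rho(t,\cdot)$ is $\|\rho(t,\cdot)\|_{\dot H^{-1}(\mathbb{T}^2)}$. Given $0<\kappa<1/2$ and a solution $\rho$ with values $\pm1$, the geometric mixing scale of $\rho(t,\cdot)$ is the infimum $\varepsilon(t)$ of all $\varepsilon>0$ such that for every $x\in\mathbb{T}^2$ $$\kappa\le\frac{\mathcal{L}^2\big(\{\rho(t,\cdot)=1\}\cap B_\varepsilon(x)\big)}{\mathcal{L}^2(B_\varepsilon(x))}\le 1-\kappa,$$ where $\mathcal{L}^2$ is the two-dimensional Lebesgue measure and $B_\varepsilon(x)$ is the ball of radius $\varepsilon$ centered at $x$. *)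

theory Defs
  imports "HOL-Probability.Essential_Supremum"
begin

section \<open>The flat torus\<close>

text \<open>
  The torus is the quotient of the plane by the integer lattice. Functions on it are represented
  by lattice-periodic functions on the plane; integrals over it are integrals over the half-open
  unit cell.
\<close>

definition lattice_point :: "int ^ 2 \<Rightarrow> real ^ 2" where
  "lattice_point k = (\<chi> i. of_int (k $ i))"

definition periodic :: "(real ^ 2 \<Rightarrow> 'a) \<Rightarrow> bool" where
  "periodic f \<longleftrightarrow> (\<forall>x k. f (x + lattice_point k) = f x)"

definition unit_cell :: "(real ^ 2) set" where
  "unit_cell = {x. \<forall>i. 0 \<le> x $ i \<and> x $ i < 1}"

abbreviation torus_measure :: "(real ^ 2) measure" where
  "torus_measure \<equiv> lebesgue_on unit_cell"

text \<open>The preimage in the plane of the ball for the quotient metric.\<close>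

definition torus_ball :: "real ^ 2 \<Rightarrow> real \<Rightarrow> (real ^ 2) set" where
  "torus_ball x r = {y. \<exists>k. dist x (y + lattice_point k) < r}"

section \<open>Test functions\<close>

primrec C_k :: "nat \<Rightarrow> ('a::euclidean_space \<Rightarrow> real) \<Rightarrow> bool" where
  "C_k 0 f \<longleftrightarrow> continuous_on UNIV f"
| "C_k (Suc n) f \<longleftrightarrow>
     (\<forall>x. f differentiable (at x)) \<and> (\<forall>b\<in>Basis. C_k n (\<lambda>x. frechet_derivative f (at x) b))"

definition C_infinity :: "('a::euclidean_space \<Rightarrow> real) \<Rightarrow> bool" where
  "C_infinity f \<longleftrightarrow> (\<forall>n. C_k n f)"

definition test_function :: "(real ^ 2 \<Rightarrow> real) \<Rightarrow> bool" where
  "test_function \<psi> \<longleftrightarrow> C_infinity \<psi> \<and> periodic \<psi>"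

text \<open>Smooth functions with compact support in the product of the open half-line and the torus,
  extended by zero to nonpositive times.\<close>

definition spacetime_test_function :: "(real \<times> (real ^ 2) \<Rightarrow> real) \<Rightarrow> bool" where
  "spacetime_test_function \<phi> \<longleftrightarrow>
     C_infinity \<phi> \<and> (\<forall>t. periodic (\<lambda>x. \<phi> (t, x))) \<and>
     (\<exists>a b. 0 < a \<and> (\<forall>t x. t \<notin> {a..b} \<longrightarrow> \<phi> (t, x) = 0))"

section \<open>Norms\<close>

definition ennreal_powr :: "ennreal \<Rightarrow> real \<Rightarrow> ennreal" where
  "ennreal_powr a r = (if a = \<infinity> then \<infinity> else ennreal (enn2real a powr r))"

definition Lp_norm :: "ennreal \<Rightarrow> (real ^ 2 \<Rightarrow> 'a::real_normed_vector) \<Rightarrow> ennreal" where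
  "Lp_norm p f =
     (if p = \<infinity> then esssup torus_measure (\<lambda>x. ennreal (norm (f x)))
      else ennreal_powr (\<integral>\<^sup>+ x. ennreal (norm (f x) powr enn2real p) \<partial>torus_measure)
             (1 / enn2real p))"

text \<open>\<open>G\<close> is the distributional Jacobian of \<open>v\<close>: the entry \<open>G $ i $ j\<close> is the derivative of
  the \<open>i\<close>-th component of \<open>v\<close> in direction \<open>j\<close>.\<close>

definition weak_gradient :: "(real ^ 2 \<Rightarrow> real ^ 2) \<Rightarrow> (real ^ 2 \<Rightarrow> real ^ 2 ^ 2) \<Rightarrow> bool" where
  "weak_gradient v G \<longleftrightarrow>
     integrable torus_measure v \<and> integrable torus_measure G \<and>
     (\<forall>\<psi> i j. test_function \<psi> \<longrightarrow>
        (LINT x|torus_measure. v x $ i * frechet_derivative \<psi> (at x) (axis j 1)) =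
        - (LINT x|torus_measure. G x $ i $ j * \<psi> x))"

text \<open>The homogeneous seminorm of order one. The weak gradient is unique almost everywhere, so
  the infimum only serves to give the value \<open>\<infinity>\<close> when there is no weak gradient.\<close>

definition W1p_seminorm :: "ennreal \<Rightarrow> (real ^ 2 \<Rightarrow> real ^ 2) \<Rightarrow> ennreal" where
  "W1p_seminorm p v = (INF G\<in>{G. weak_gradient v G}. Lp_norm p G)"

definition fourier_coeff :: "(real ^ 2 \<Rightarrow> real) \<Rightarrow> int ^ 2 \<Rightarrow> complex" where
  "fourier_coeff f k =
     (LINT x|torus_measure. complex_of_real (f x) * cis (- 2 * pi * (lattice_point k \<bullet> x)))"

text \<open>The homogeneous Sobolev seminorm of real order \<open>s\<close>, by Fourier series; the zero mode is
  omitted.\<close>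

definition Hs_seminorm :: "real \<Rightarrow> (real ^ 2 \<Rightarrow> real) \<Rightarrow> ennreal" where
  "Hs_seminorm s f =
     ennreal_powr
       (\<Sum>\<^sub>\<infinity>k\<in>UNIV - {0}.
          ennreal ((2 * pi * norm (lattice_point k)) powr (2 * s) * (cmod (fourier_coeff f k))\<^sup>2))
       (1 / 2)"

section \<open>The continuity equation\<close>

text \<open>Minimal regularity for the distributional formulation: a locally integrable field on
  the product of the closed half-line and the torus.\<close>

definition velocity_field :: "(real \<Rightarrow> real ^ 2 \<Rightarrow> real ^ 2) \<Rightarrow> bool" where
  "velocity_field u \<longleftrightarrow>
     (\<forall>t\<ge>0. periodic (u t)) \<and>
     (\<forall>T>0. integrable (lebesgue_on ({0..T} \<times> unit_cell)) (\<lambda>(t, x). u t x))"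

definition divergence_free :: "(real ^ 2 \<Rightarrow> real ^ 2) \<Rightarrow> bool" where
  "divergence_free v \<longleftrightarrow>
     integrable torus_measure v \<and>
     (\<forall>\<psi>. test_function \<psi> \<longrightarrow>
        (LINT x|torus_measure. frechet_derivative \<psi> (at x) (v x)) = 0)"

text \<open>Bounded distributional solutions of the continuity equation. The derivative of \<open>\<phi>\<close> in
  direction \<open>(1, 0)\<close> is its time derivative, the one in direction \<open>(0, u t x)\<close> is the scalar
  product of \<open>u t x\<close> and the spatial gradient of \<open>\<phi>\<close>. As usual, \<open>\<rho>\<close> is the representative that
  is weakly continuous in time, which gives a meaning to \<open>\<rho> t\<close> at every single time, in
  particular at time \<open>0\<close>.\<close>

definition continuity_equation_solution ::
    "(real \<Rightarrow> real ^ 2 \<Rightarrow> real ^ 2) \<Rightarrow> (real \<Rightarrow> real ^ 2 \<Rightarrow> real) \<Rightarrow> bool" where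
  "continuity_equation_solution u \<rho> \<longleftrightarrow>
     (\<forall>t\<ge>0. periodic (\<rho> t) \<and> \<rho> t \<in> borel_measurable torus_measure) \<and>
     (\<exists>B. \<forall>t\<ge>0. \<forall>x. \<bar>\<rho> t x\<bar> \<le> B) \<and>
     (\<lambda>(t, x). \<rho> t x) \<in> borel_measurable (lebesgue_on ({0..} \<times> unit_cell)) \<and>
     (\<forall>\<psi>. test_function \<psi> \<longrightarrow>
        continuous_on {0..} (\<lambda>t. LINT x|torus_measure. \<rho> t x * \<psi> x)) \<and>
     (\<forall>\<phi>. spacetime_test_function \<phi> \<longrightarrow>
        (LINT (t, x)|lebesgue_on ({0..} \<times> unit_cell).
           \<rho> t x * (frechet_derivative \<phi> (at (t, x)) (1, 0) +
                    frechet_derivative \<phi> (at (t, x)) (0, u t x))) = 0)"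

section \<open>Mixing scales\<close>

abbreviation functional_mixing_scale :: "(real ^ 2 \<Rightarrow> real) \<Rightarrow> ennreal" where
  "functional_mixing_scale f \<equiv> Hs_seminorm (- 1) f"

definition geometric_mixing_scale :: "real \<Rightarrow> (real ^ 2 \<Rightarrow> real) \<Rightarrow> ennreal" where
  "geometric_mixing_scale \<kappa> f =
     (INF \<epsilon>\<in>{\<epsilon>. \<epsilon> > 0 \<and>
        (\<forall>x. measure torus_measure ({y \<in> unit_cell. f y = 1} \<inter> torus_ball x \<epsilon>) /
               measure torus_measure (unit_cell \<inter> torus_ball x \<epsilon>) \<in> {\<kappa>..1 - \<kappa>})}. ennreal \<epsilon>)"

end

theory Submission
  imports Defs "HOL-Probability.Probability"
begin

text \<open>
  The velocity field alternates, on unit time intervals, between shears along the two axes with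
  one fixed Lipschitz profile and a phase to be chosen at each step. Averaging over the phase
  decouples the Fourier modes: the expected energy of the mode \<open>(a, b)\<close> after a shear along the
  first axis is at most the sum over \<open>m\<close> of \<open>p a m\<close> times the energy of the mode \<open>(a, b - m)\<close>,
  where \<open>p a\<close> is a subprobability on the integers which, by van der Corput's second derivative
  test, is at most a small multiple of \<open>1 / \<bar>a\<bar>\<close> at every point. Hence the expectation of a
  negative Sobolev energy with weights of order \<open>- 1 / 2\<close> is contracted by a fixed factor, and
  some phase does at least as well as the average; choosing the phases greedily yields a
  deterministic field.

  Decay of the Fourier coefficients gives, by Fejer means, exponential decay of the integrals of
  \<open>\<rho>\<close> against Lipschitz functions. That is stable under the bi-Lipschitz partial shears at
  non-integer times. Testing with exponentials bounds the functional mixing scale, testing with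
  Lipschitz cutoffs of balls bounds the geometric one.
\<close>

section \<open>Fourier analysis on the circle\<close>

text \<open>A velocity with a Lipschitz bound uniform in time stretches frequencies by a bounded
  factor per unit time, so the decay must come from a gain repeated at every step, whatever state
  has been reached. As a function of the phase, a Fourier coefficient of the sheared density is a
  cross-correlation, and Parseval in the phase removes the interference between modes.

  The weight sees only the first frequency as long as it is nonzero: coordinates are exchanged after
  each shear, so this is the frequency that the shear has just spread. Let M be the amplitude of the
  profile. A unit mass of height at most of order 1 / (M |a|) has a mean of |b|^(-s) of order (M
  |a|)^(-s). Here s < 1 gives summability near b = 0 and s > 0 gives a gain; s = 1/2 keeps the
  constants simple. With M = 10000 the factor is about 13 / sqrt M, below the 1/4 that the unmoved
  row a = 0 reaches through the weight ratio 4. Passing from the mean to one phase relaxes 1/4 to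
  1/2. All later losses are powers of the frequency cut-off, which an exponentially small energy
  absorbs.\<close>

definition int_periodic :: "(real \<Rightarrow> 'a) \<Rightarrow> bool" where
  "int_periodic f \<longleftrightarrow> (\<forall>x (n::int). f (x + of_int n) = f x)"

lemma int_periodicD: "int_periodic f \<Longrightarrow> f (x + of_int n) = f x"
  by (simp add: int_periodic_def)

lemma int_periodic_frac: "int_periodic f \<Longrightarrow> f (frac x) = f x"
  using int_periodicD[of f "frac x" "\<lfloor>x\<rfloor>"] by (simp add: frac_def)

lemma frac_add_int: "frac (x + of_int n) = frac (x::real)"
  by (simp add: frac_def)

lemma borel_measurable_frac [measurable]: "(frac :: real \<Rightarrow> real) \<in> borel_measurable borel"
  unfolding frac_def by measurable

lemma borel_measurable_cnj_compose [measurable (raw)]: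
  "f \<in> borel_measurable M \<Longrightarrow> (\<lambda>x. cnj (f x)) \<in> borel_measurable M"
  by (rule measurable_compose[OF _ borel_measurable_continuous_onI])
     (auto intro: continuous_intros)

section \<open>Normalized Lebesgue measure on the unit interval and rotation invariance\<close>

definition circle :: "real measure" where
  "circle = density lborel (indicator {0..<1})"

lemma space_circle [simp]: "space circle = UNIV"
  by (simp add: circle_def)

lemma sets_circle [measurable_cong, simp]: "sets circle = sets borel"
  by (simp add: circle_def)

interpretation circle: prob_space circle
  by standard (simp add: circle_def emeasure_density)

text \<open>A rotation exchanges two intervals: with \<open>d = frac c\<close>, the piece
  \<open>{0..<1-d}\<close> is translated by \<open>d\<close> and the piece \<open>{1-d..<1}\<close>
  by \<open>d - 1\<close>. Lebesgue measure is preserved on each.\<close>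

lemma distr_circle_frac: "distr circle borel (\<lambda>x. frac (x + c)) = circle"
proof (rule measure_eqI)
  fix A assume "A \<in> sets (distr circle borel (\<lambda>x. frac (x + c)))"
  then have [measurable]: "A \<in> sets borel" by simp
  define d where "d = frac c"
  have d: "0 \<le> d" "d < 1" by (auto simp: d_def frac_lt_1)
  have split: "indicator {0..<1} x * indicator A (frac (x + c)) =
     (indicator {0..<1-d} x * indicator A (d + x) + indicator {1-d..<1} x * indicator A (d - 1 + x) :: ennreal)" for x
  proof -
    have "frac (x + c) = frac (x + d)"
      using frac_add_int[of "x + d" "\<lfloor>c\<rfloor>"] by (simp add: d_def frac_def)
    moreover have "frac (x + d) = x + d" if "0 \<le> x" "x < 1 - d"
      using that d by (simp add: frac_eq)
    moreover have "frac (x + d) = d - 1 + x" if "1 - d \<le> x" "x < 1"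
      using that d frac_add_int[of "x + d" "-1"] by (simp add: frac_eq algebra_simps)
    ultimately show ?thesis
      using d by (auto simp: indicator_def add_ac)
  qed
  have "emeasure (distr circle borel (\<lambda>x. frac (x + c))) A
      = (\<integral>\<^sup>+x. indicator A (frac (x + c)) \<partial>circle)"
    by (subst nn_integral_indicator[symmetric], simp, subst nn_integral_distr) auto
  also have "\<dots> = (\<integral>\<^sup>+x. indicator {0..<1} x * indicator A (frac (x + c)) \<partial>lborel)"
    unfolding circle_def by (subst nn_integral_density) auto
  also have "\<dots> = (\<integral>\<^sup>+x. indicator {0..<1-d} x * indicator A (d + x) \<partial>lborel)
       + (\<integral>\<^sup>+x. indicator {1-d..<1} x * indicator A (d - 1 + x) \<partial>lborel)"
    unfolding split by (rule nn_integral_add) auto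
  also have "(\<integral>\<^sup>+x. indicator {0..<1-d} x * indicator A (d + x) \<partial>lborel)
     = (\<integral>\<^sup>+x. indicator {d..<1} x * indicator A x \<partial>lborel)"
    by (subst nn_integral_real_affine[where c=1 and t=d and f="\<lambda>x. indicator {d..<1} x * indicator A x"])
       (auto intro!: nn_integral_cong simp: indicator_def)
  also have "(\<integral>\<^sup>+x. indicator {1-d..<1} x * indicator A (d - 1 + x) \<partial>lborel)
     = (\<integral>\<^sup>+x. indicator {0..<d} x * indicator A x \<partial>lborel)"
    by (subst nn_integral_real_affine[where c=1 and t="d-1" and f="\<lambda>x. indicator {0..<d} x * indicator A x"])
       (auto intro!: nn_integral_cong simp: indicator_def)
  also have "(\<integral>\<^sup>+x. indicator {d..<1} x * indicator A x \<partial>lborel) +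
      (\<integral>\<^sup>+x. indicator {0..<d} x * indicator A x \<partial>lborel)
     = (\<integral>\<^sup>+x. indicator {d..<1} x * indicator A x + indicator {0..<d} x * indicator A x \<partial>lborel)"
    by (rule nn_integral_add[symmetric]) auto
  also have "\<dots> = (\<integral>\<^sup>+x. indicator {0..<1} x * indicator A x \<partial>lborel)"
    using d by (intro nn_integral_cong) (auto simp: indicator_def)
  also have "\<dots> = emeasure circle A"
    by (simp add: circle_def emeasure_density)
  finally show "emeasure (distr circle borel (\<lambda>x. frac (x + c))) A = emeasure circle A" .
qed simp

lemma circle_integral_shift:
  fixes f :: "real \<Rightarrow> 'a::{banach, second_countable_topology}"
  assumes [measurable]: "f \<in> borel_measurable borel" and "int_periodic f"
  shows "(LINT x|circle. f (x + c)) = (LINT x|circle. f x)"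
proof -
  have "(LINT x|circle. f (x + c)) = (LINT x|circle. f (frac (x + c)))"
    using int_periodic_frac[OF assms(2)] by simp
  also have "\<dots> = (LINT x|distr circle borel (\<lambda>x. frac (x + c)). f x)"
    by (rule integral_distr[symmetric]) auto
  finally show ?thesis by (simp add: distr_circle_frac)
qed

lemma circle_integrable_bounded:
  fixes f :: "real \<Rightarrow> 'a::{banach, second_countable_topology}"
  assumes "f \<in> borel_measurable borel" "\<And>x. norm (f x) \<le> B"
  shows "integrable circle f"
  by (rule circle.integrable_const_bound[where B=B]) (use assms in \<open>auto\<close>)

section \<open>Characters of the circle, orthogonality and Bessel's inequality\<close>

definition mode :: "int \<Rightarrow> real \<Rightarrow> complex" where
  "mode m t = cis (2 * pi * of_int m * t)"

lemma norm_mode [simp]: "cmod (mode m t) = 1"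
  by (simp add: mode_def)

lemma mode_0 [simp]: "mode 0 t = 1"
  by (simp add: mode_def)

lemma continuous_mode [continuous_intros]:
  "continuous_on S f \<Longrightarrow> continuous_on S (\<lambda>x. mode m (f x))"
  unfolding mode_def by (intro continuous_intros)

lemma borel_measurable_mode [measurable]: "mode m \<in> borel_measurable borel"
  by (intro borel_measurable_continuous_onI continuous_mode continuous_on_id)

lemma mode_mult: "mode m t * mode n t = mode (m + n) t"
  by (simp add: mode_def cis_mult algebra_simps)

lemma mode_add: "mode m (s + t) = mode m s * mode m t"
  by (simp add: mode_def cis_mult algebra_simps)

lemma cnj_mode: "cnj (mode m t) = mode (- m) t"
  by (simp add: mode_def cis_cnj)

lemma mode_of_int [simp]: "mode m (of_int n) = 1"
proof -
  have "2 * pi * of_int m * of_int n = 2 * pi * of_int (m * n)" by simp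
  then show ?thesis unfolding mode_def using cis_multiple_2pi[of "of_int (m * n)"] by (simp add: mult_ac)
qed

lemma int_periodic_mode: "int_periodic (mode m)"
  by (simp add: int_periodic_def mode_add)

lemma integrable_circle_mode: "integrable circle (mode m)"
  by (rule circle_integrable_bounded[where B=1]) auto

text \<open>Translation by half a period, \<open>1 / (2 * m)\<close>, changes the sign of
  \<open>mode m\<close>, so by rotation invariance the integral equals its own negative.\<close>

lemma integral_mode: "(LINT t|circle. mode m t) = (if m = 0 then 1 else 0)"
proof (cases "m = 0")
  case False
  define s where "s = 1 / (2 * real_of_int m)"
  have "(LINT t|circle. mode m t) = (LINT t|circle. mode m (t + s))"
    by (rule circle_integral_shift[symmetric]) (auto intro: int_periodic_mode)
  also have "\<dots> = (LINT t|circle. mode m t) * mode m s"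
    by (simp add: mode_add)
  also have "mode m s = -1"
    using False by (simp add: mode_def s_def)
  finally show ?thesis using False by simp
qed (use circle.prob_space in simp)

lemma integral_mode_mult_cnj:
  "(LINT t|circle. mode m t * cnj (mode n t)) = (if m = n then 1 else 0)"
  using integral_mode[of "m - n"] by (simp add: cnj_mode mode_mult)

text \<open>The squared distance from \<open>f\<close> to its projection \<open>s\<close> is the
  squared norm of \<open>f\<close> minus the sum of the squared coefficients, and it is nonnegative.
  An arbitrary probability space is allowed because the inequality serves on the circle, on the
  product of two circles and on the torus.\<close>

lemma (in prob_space) bessel_inequality:
  fixes f :: "'a \<Rightarrow> complex" and \<phi> :: "'i \<Rightarrow> 'a \<Rightarrow> complex"
  assumes "finite I"
    and [measurable]: "f \<in> borel_measurable M" and fB: "\<And>x. cmod (f x) \<le> B"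
    and [measurable]: "\<And>i. \<phi> i \<in> borel_measurable M" and \<phi>B: "\<And>i x. cmod (\<phi> i x) \<le> 1"
    and orth: "\<And>i j. i \<in> I \<Longrightarrow> j \<in> I \<Longrightarrow>
        (LINT x|M. \<phi> i x * cnj (\<phi> j x)) = (if i = j then 1 else 0)"
  shows "(\<Sum>i\<in>I. (cmod (LINT x|M. f x * cnj (\<phi> i x)))\<^sup>2) \<le> (LINT x|M. (cmod (f x))\<^sup>2)"
proof -
  define c where "c i = (LINT x|M. f x * cnj (\<phi> i x))" for i
  define s where "s x = (\<Sum>i\<in>I. c i * \<phi> i x)" for x
  have B0: "0 \<le> B" using fB[of undefined] norm_ge_zero order_trans by blast
  have int1: "integrable M (\<lambda>x. f x * cnj (\<phi> i x))" for i
  proof (rule integrable_const_bound[where B="B*1"])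
    show "AE x in M. cmod (f x * cnj (\<phi> i x)) \<le> B * 1"
      unfolding norm_mult complex_mod_cnj by (intro AE_I2 mult_mono fB \<phi>B B0 norm_ge_zero)
  qed simp
  have int2: "integrable M (\<lambda>x. \<phi> i x * cnj (\<phi> j x))" for i j
    by (rule integrable_const_bound[where B=1])
       (auto simp: norm_mult intro!: AE_I2 mult_le_one \<phi>B)
  have int0: "integrable M (\<lambda>x. f x * cnj (f x))"
    by (rule integrable_const_bound[where B="B*B"])
       (auto simp: norm_mult intro!: AE_I2 mult_mono fB B0)
  have fs: "f x * cnj (s x) = (\<Sum>i\<in>I. cnj (c i) * (f x * cnj (\<phi> i x)))" for x
    by (simp add: s_def sum_distrib_left mult_ac)
  have ss: "s x * cnj (s x) = (\<Sum>i\<in>I. \<Sum>j\<in>I. c i * cnj (c j) * (\<phi> i x * cnj (\<phi> j x)))" for x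
    by (simp add: s_def sum_product mult_ac)
  have ifs: "integrable M (\<lambda>x. f x * cnj (s x))"
    unfolding fs by (intro Bochner_Integration.integrable_sum integrable_mult_right int1)
  have iss: "integrable M (\<lambda>x. s x * cnj (s x))"
    unfolding ss by (intro Bochner_Integration.integrable_sum integrable_mult_right int2)
  have isf: "integrable M (\<lambda>x. cnj (f x * cnj (s x)))"
    by (rule integrable_cnj[OF ifs])
  define S where "S = (\<Sum>i\<in>I. c i * cnj (c i))"
  have Lfs: "(LINT x|M. f x * cnj (s x)) = S"
    unfolding fs S_def
    by (subst Bochner_Integration.integral_sum)
       (auto intro!: int1 integrable_mult_right sum.cong simp only: integral_mult_right_zero c_def[symmetric] mult.commute)
  have Lss: "(LINT x|M. s x * cnj (s x)) = S"
  proof -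
    have "(LINT x|M. s x * cnj (s x)) = (\<Sum>i\<in>I. \<Sum>j\<in>I. c i * cnj (c j) * (if i = j then 1 else 0))"
    proof -
      have "(LINT x|M. (\<Sum>j\<in>I. c i * cnj (c j) * (\<phi> i x * cnj (\<phi> j x)))) =
          (\<Sum>j\<in>I. c i * cnj (c j) * (if i = j then 1 else 0))" if "i \<in> I" for i
        by (subst Bochner_Integration.integral_sum)
           (use that in \<open>auto intro!: int2 integrable_mult_right sum.cong
              simp only: integral_mult_right_zero orth\<close>)
      then show ?thesis
        unfolding ss
        by (subst Bochner_Integration.integral_sum)
           (auto intro!: int2 Bochner_Integration.integrable_sum integrable_mult_right sum.cong)
    qed
    also have "\<dots> = S"
      unfolding S_def by (intro sum.cong) (auto simp: \<open>finite I\<close> if_distrib cong: if_cong)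
    finally show ?thesis .
  qed
  \<comment> \<open>The cross terms contribute \<open>- S\<close> and \<open>- cnj S\<close>, the
    square of \<open>s\<close> contributes \<open>S\<close>; since \<open>S\<close> is real, a
    single \<open>- S\<close> remains.\<close>
  have cS: "cnj S = S" by (simp add: S_def mult.commute)
  have eq: "(f x - s x) * cnj (f x - s x) =
      f x * cnj (f x) - f x * cnj (s x) - cnj (f x * cnj (s x)) + s x * cnj (s x)" for x
    by (simp add: algebra_simps)
  have "(LINT x|M. (f x - s x) * cnj (f x - s x)) = (LINT x|M. f x * cnj (f x)) - S - cnj S + S"
    unfolding eq using int0 ifs isf iss
    by (simp only: Bochner_Integration.integral_add Bochner_Integration.integral_diff
        Bochner_Integration.integrable_diff Bochner_Integration.integral_cnj Lfs Lss)
  also have "\<dots> = (LINT x|M. f x * cnj (f x)) - S" by (simp add: cS)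
  finally have main: "(LINT x|M. (f x - s x) * cnj (f x - s x)) = (LINT x|M. f x * cnj (f x)) - S" .
  have "(LINT x|M. complex_of_real ((cmod (f x - s x))\<^sup>2)) =
     (LINT x|M. complex_of_real ((cmod (f x))\<^sup>2)) - S"
    using main by (simp only: complex_norm_square)
  then have "complex_of_real (LINT x|M. (cmod (f x - s x))\<^sup>2) =
     complex_of_real (LINT x|M. (cmod (f x))\<^sup>2) - S"
    by (simp only: integral_complex_of_real)
  moreover have "S = complex_of_real (\<Sum>i\<in>I. (cmod (c i))\<^sup>2)"
    by (simp add: S_def complex_norm_square[symmetric] flip: of_real_power)
  ultimately have "complex_of_real (LINT x|M. (cmod (f x - s x))\<^sup>2) =
     complex_of_real ((LINT x|M. (cmod (f x))\<^sup>2) - (\<Sum>i\<in>I. (cmod (c i))\<^sup>2))"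
    by simp
  then have "(LINT x|M. (cmod (f x - s x))\<^sup>2) = (LINT x|M. (cmod (f x))\<^sup>2) - (\<Sum>i\<in>I. (cmod (c i))\<^sup>2)"
    by (simp only: of_real_eq_iff)
  moreover have "0 \<le> (LINT x|M. (cmod (f x - s x))\<^sup>2)" by simp
  ultimately show ?thesis by (simp add: c_def)
qed

subsection \<open>Fejer kernels\<close>

definition fejer :: "nat \<Rightarrow> real \<Rightarrow> real" where
  "fejer N t = (cmod (\<Sum>j<N. mode (int j) t))\<^sup>2 / real N"

text \<open>For \<open>N > 0\<close> this is the triangular weight
  \<open>max 0 (1 - \<bar>m\<bar> / N)\<close>. The count of pairs is the form in which the double
  sum of \<open>fejer_expand\<close> produces it.\<close>

definition fejer_weight :: "nat \<Rightarrow> int \<Rightarrow> real" where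
  "fejer_weight N m = real (card {(j, l). j < N \<and> l < N \<and> int j - int l = m}) / real N"

lemma fejer_weight_nonneg: "0 \<le> fejer_weight N m"
  by (simp add: fejer_weight_def)

lemma fejer_weight_le_1: "fejer_weight N m \<le> 1"
proof -
  have "card {(j, l). j < N \<and> l < N \<and> int j - int l = m} \<le> card {..<N}"
    by (rule card_inj_on_le[where f=fst]) (auto simp: inj_on_def)
  then show ?thesis by (auto simp: fejer_weight_def divide_le_eq)
qed

lemma fejer_nonneg: "0 \<le> fejer N t"
  by (simp add: fejer_def)

lemma fejer_expand:
  "complex_of_real (fejer N t) = (\<Sum>m\<in>{- int N..int N}. complex_of_real (fejer_weight N m) * mode m t)"
proof -
  let ?A = "{..<N} \<times> {..<N}" and ?d = "\<lambda>(j, l). int j - int l"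
  have "complex_of_real (fejer N t) =
      (\<Sum>j<N. mode (int j) t) * cnj (\<Sum>j<N. mode (int j) t) / of_nat N"
    by (simp only: fejer_def of_real_divide complex_norm_square of_real_of_nat_eq)
  also have "(\<Sum>j<N. mode (int j) t) * cnj (\<Sum>j<N. mode (int j) t) = (\<Sum>p\<in>?A. mode (?d p) t)"
    by (simp add: sum_product sum.cartesian_product cnj_mode mode_mult case_prod_beta)
  also have "\<dots> = (\<Sum>m\<in>{- int N..int N}. \<Sum>p | p \<in> ?A \<and> ?d p = m. mode (?d p) t)"
    by (rule sum.group[symmetric]) auto
  also have "\<dots> = (\<Sum>m\<in>{- int N..int N}. of_nat (card {p. p \<in> ?A \<and> ?d p = m}) * mode m t)"
    by (intro sum.cong) auto
  also have "\<dots> / of_nat N = (\<Sum>m\<in>{- int N..int N}. complex_of_real (fejer_weight N m) * mode m t)"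
    unfolding sum_divide_distrib
  proof (intro sum.cong refl)
    fix m
    have "{p. p \<in> ?A \<and> ?d p = m} = {(j, l). j < N \<and> l < N \<and> int j - int l = m}" by auto
    then show "of_nat (card {p. p \<in> ?A \<and> ?d p = m}) * mode m t / of_nat N
        = complex_of_real (fejer_weight N m) * mode m t"
      by (simp add: fejer_weight_def)
  qed
  finally show ?thesis .
qed

lemma borel_measurable_fejer [measurable]: "fejer N \<in> borel_measurable borel"
  unfolding fejer_def by measurable

lemma fejer_bound: "fejer N t \<le> real N"
proof (cases "N = 0")
  case False
  have "cmod (\<Sum>j<N. mode (int j) t) \<le> real N"
    using sum_norm_le[of "{..<N}" "\<lambda>j. mode (int j) t" "\<lambda>_. 1"] by simp
  then have "(cmod (\<Sum>j<N. mode (int j) t))\<^sup>2 \<le> (real N)\<^sup>2"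
    by (intro power_mono) auto
  with False show ?thesis
    by (simp add: fejer_def divide_le_eq power2_eq_square)
qed (simp add: fejer_def)

lemma integrable_fejer: "integrable circle (fejer N)"
  by (rule circle_integrable_bounded[where B="real N"]) (auto simp: fejer_nonneg fejer_bound)

lemma integral_fejer:
  assumes "N > 0"
  shows "(LINT t|circle. fejer N t) = 1"
proof -
  have "{(j, l). j < N \<and> l < N \<and> int j - int l = 0} = (\<lambda>j. (j, j)) ` {..<N}" by auto
  then have w: "fejer_weight N 0 = 1"
    using assms by (simp add: fejer_weight_def card_image inj_on_def)
  have "complex_of_real (LINT t|circle. fejer N t) = (LINT t|circle. complex_of_real (fejer N t))"
    by simp
  also have "\<dots> = (\<Sum>m\<in>{- int N..int N}. complex_of_real (fejer_weight N m) * (LINT t|circle. mode m t))"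
    unfolding fejer_expand
    by (subst Bochner_Integration.integral_sum) (auto intro: integrable_circle_mode)
  also have "\<dots> = (\<Sum>m\<in>{- int N..int N}. if m = 0 then 1 else 0)"
    by (intro sum.cong) (auto simp: integral_mode w)
  also have "\<dots> = 1" by simp
  finally show ?thesis by (simp only: of_real_eq_1_iff)
qed

text \<open>The kernel is a squared geometric sum with denominator \<open>mode 1 t - 1\<close>, of
  modulus \<open>2 * \<bar>sin (pi * t)\<bar>\<close>. Clearing the denominator leaves a numerator
  of modulus at most 2.\<close>

lemma sin_fejer_bound:
  assumes "N > 0"
  shows "(sin (pi * t))\<^sup>2 * fejer N t \<le> 1 / real N"
proof -
  have "mode 1 t - 1 = cis (pi * t) * (cis (pi * t) - cis (- (pi * t)))"
    by (simp add: mode_def cis_mult algebra_simps)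
  also have "cis (pi * t) - cis (- (pi * t)) = 2 * \<i> * of_real (sin (pi * t))"
    by (simp add: complex_eq_iff)
  finally have m: "cmod (mode 1 t - 1) = 2 * \<bar>sin (pi * t)\<bar>"
    by (simp add: norm_mult)
  have p: "mode (int j) t = mode 1 t ^ j" for j
    by (simp add: mode_def Complex.DeMoivre algebra_simps)
  have "cmod ((mode 1 t - 1) * (\<Sum>j<N. mode (int j) t)) = cmod (mode 1 t ^ N - 1)"
    unfolding p by (simp add: power_diff_1_eq)
  also have "\<dots> \<le> 2"
    using norm_triangle_ineq4[of "mode 1 t ^ N" 1] by (simp add: norm_power)
  finally have "2 * \<bar>sin (pi * t)\<bar> * cmod (\<Sum>j<N. mode (int j) t) \<le> 2"
    by (simp add: norm_mult m)
  then have "(\<bar>sin (pi * t)\<bar> * cmod (\<Sum>j<N. mode (int j) t))\<^sup>2 \<le> 1"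
    by (intro power_le_one) auto
  then show ?thesis
    using assms by (simp add: fejer_def power_mult_distrib divide_simps)
qed

lemma abs_sin_fejer_bound: "norm (\<bar>sin (pi * t)\<bar> * fejer N t) \<le> 1 * real N"
  unfolding norm_mult
  by (intro mult_mono) (auto simp: fejer_nonneg fejer_bound)

text \<open>Interpolation between the total mass 1 and \<open>sin_fejer_bound\<close>: the
  inequality between arithmetic and geometric means with parameter \<open>\<eta> = sqrt N\<close>
  bounds this first moment of the kernel by half the sum of two terms
  \<open>1 / \<eta>\<close>.\<close>

lemma integral_abs_sin_fejer:
  assumes "N > 0"
  shows "(LINT t|circle. \<bar>sin (pi * t)\<bar> * fejer N t) \<le> 1 / sqrt (real N)"
proof -
  define \<eta> where "\<eta> = sqrt (real N)"
  have \<eta>: "\<eta> > 0" "\<eta> * \<eta> = real N" using assms by (auto simp: \<eta>_def)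
  have le: "\<bar>sin (pi * t)\<bar> * fejer N t \<le> (1 / \<eta> + fejer N t / \<eta>) / 2" for t
  proof -
    have "0 \<le> (\<eta> * \<bar>sin (pi * t)\<bar> - 1)\<^sup>2" by simp
    then have "2 * \<eta> * \<bar>sin (pi * t)\<bar> \<le> \<eta> * \<eta> * (sin (pi * t))\<^sup>2 + 1"
      by (simp add: power2_eq_square algebra_simps)
    then have "2 * \<eta> * \<bar>sin (pi * t)\<bar> * fejer N t \<le> (\<eta> * \<eta> * (sin (pi * t))\<^sup>2 + 1) * fejer N t"
      by (intro mult_right_mono fejer_nonneg)
    also have "\<dots> = \<eta> * \<eta> * ((sin (pi * t))\<^sup>2 * fejer N t) + fejer N t"
      by (simp add: algebra_simps)
    also have "\<dots> \<le> 1 + fejer N t"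
      using mult_left_mono[OF sin_fejer_bound[OF assms, of t], of "\<eta> * \<eta>"] \<eta> assms by simp
    finally show ?thesis using \<eta>(1) by (simp add: field_simps)
  qed
  have "(LINT t|circle. \<bar>sin (pi * t)\<bar> * fejer N t) \<le> (LINT t|circle. (1 / \<eta> + fejer N t / \<eta>) / 2)"
  proof (rule integral_mono)
    show "integrable circle (\<lambda>t. \<bar>sin (pi * t)\<bar> * fejer N t)"
      by (rule circle_integrable_bounded[OF _ abs_sin_fejer_bound]) simp
  qed (auto intro!: integrable_fejer le Bochner_Integration.integrable_divide
        Bochner_Integration.integrable_add simp del: divide_le_eq_numeral1 le_divide_eq_numeral1)
  also have "\<dots> = 1 / \<eta>"
    using circle.prob_space integral_fejer[OF assms] integrable_fejer[of N]
    by (simp add: Bochner_Integration.integral_add)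
  finally show ?thesis by (simp add: \<eta>_def)
qed

text \<open>Concavity of \<open>sin\<close> on \<open>{0..pi}\<close> puts the graph above the chord
  from 0 to \<open>pi / 2\<close>, which even yields \<open>2 * t\<close>.\<close>

lemma le_abs_sin:
  assumes "0 \<le> t" "t \<le> 1 / 2"
  shows "t \<le> \<bar>sin (pi * t)\<bar>"
proof -
  have c: "concave_on {0..pi} sin"
    by (rule f''_le0_imp_concave[where f'=cos and f''="\<lambda>x. - sin x"])
       (auto intro!: derivative_eq_intros sin_ge_zero)
  have "2 * t = (1 - 2 * t) * sin 0 + 2 * t * sin (pi / 2)" by simp
  also have "\<dots> \<le> sin ((1 - 2 * t) *\<^sub>R 0 + (2 * t) *\<^sub>R (pi / 2))"
    using concave_onD[OF c, of "2 * t" 0 "pi / 2"] assms by simp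
  finally have "2 * t \<le> sin (pi * t)" by (simp add: mult_ac)
  then show ?thesis using assms by linarith
qed

text \<open>By periodicity a shift by \<open>t\<close> is also a shift by \<open>t - 1\<close>, so
  the distance of \<open>t\<close> to the nearest integer controls the difference. In this form a
  Lipschitz bound can be integrated against the Fejer kernel.\<close>

lemma lipschitz_periodic_sin:
  fixes f :: "real \<Rightarrow> 'a::real_normed_vector"
  assumes per: "int_periodic f" and lip: "\<And>x y. norm (f x - f y) \<le> L * \<bar>x - y\<bar>" and t: "t \<in> {0..<1}"
  shows "norm (f (x + t) - f x) \<le> L * \<bar>sin (pi * t)\<bar>"
proof -
  have L: "0 \<le> L" using order_trans[OF norm_ge_zero lip[of 1 0]] by simp
  show ?thesis
  proof (cases "t \<le> 1 / 2")
    case True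
    then have "t \<le> \<bar>sin (pi * t)\<bar>" using t le_abs_sin by simp
    with L lip[of "x + t" x] t show ?thesis
      by (smt (verit) mult_left_mono atLeastLessThan_iff)
  next
    case False
    have "f x = f (x + 1)" using int_periodicD[OF per, of x 1] by simp
    then have "norm (f (x + t) - f x) \<le> L * (1 - t)"
      using lip[of "x + t" "x + 1"] t by simp
    moreover have "1 - t \<le> \<bar>sin (pi * (1 - t))\<bar>" using t False by (intro le_abs_sin) auto
    moreover have "sin (pi * (1 - t)) = sin (pi * t)" by (simp add: right_diff_distrib sin_diff)
    ultimately show ?thesis
      using mult_left_mono[of "1 - t" "\<bar>sin (pi * t)\<bar>" L] L by simp
  qed
qed

lemma AE_circle: "AE t in circle. t \<in> {0..<1}"
  unfolding circle_def by (subst AE_density) (auto simp: indicator_def)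

lemma norm_circle_integral_le:
  fixes f :: "real \<Rightarrow> 'a::{banach, second_countable_topology}"
  assumes "f \<in> borel_measurable borel" "\<And>x. norm (f x) \<le> B"
  shows "norm (LINT x|circle. f x) \<le> B"
proof -
  have "norm (LINT x|circle. f x) \<le> (LINT x|circle. norm (f x))" by (rule integral_norm_bound)
  also have "\<dots> \<le> (LINT x|circle. B)"
    using assms circle_integrable_bounded[OF assms]
    by (intro integral_mono integrable_norm) auto
  finally show ?thesis using circle.prob_space by simp
qed

text \<open>The sum is the average of \<open>f (y + t)\<close> against the Fejer kernel, so its
  distance to \<open>f y\<close> is at most \<open>L\<close> times the first moment of the kernel.
  Expanding the kernel in \<open>mode m t\<close> pairs the integral against \<open>mode m\<close>
  with the character \<open>mode (- m) y\<close>.\<close>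

lemma fejer_approximation:
  fixes f :: "real \<Rightarrow> complex"
  assumes [measurable]: "f \<in> borel_measurable borel" and B: "\<And>x. cmod (f x) \<le> B" and "int_periodic f"
    and lip: "\<And>x y. cmod (f x - f y) \<le> L * \<bar>x - y\<bar>" and N: "N > 0"
  shows "cmod ((\<Sum>m\<in>{- int N..int N}. complex_of_real (fejer_weight N m) *
       (LINT t|circle. f t * mode m t) * mode (- m) y) - f y) \<le> L / sqrt (real N)"
proof -
  have L: "0 \<le> L" using order_trans[OF norm_ge_zero lip[of 1 0]] by simp
  have B0: "0 \<le> B" using order_trans[OF norm_ge_zero B[of 0]] .
  have coeff: "(LINT t|circle. f (y + t) * mode m t) = (LINT t|circle. f t * mode m t) * mode (- m) y" for m
  proof -
    have "(LINT t|circle. f (y + t) * mode m t) = (LINT t|circle. f (t + y) * mode m (t + y) * mode (- m) y)"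
      by (intro Bochner_Integration.integral_cong) (auto simp: mode_add mode_mult add.commute)
    also have "\<dots> = (LINT t|circle. f (t + y) * mode m (t + y)) * mode (- m) y" by simp
    also have "(LINT t|circle. f (t + y) * mode m (t + y)) = (LINT t|circle. f t * mode m t)"
      by (rule circle_integral_shift[of "\<lambda>t. f t * mode m t"])
         (use assms(3) int_periodic_mode[of m] in \<open>auto simp: int_periodic_def\<close>)
    finally show ?thesis .
  qed
  have int: "integrable circle (\<lambda>t. f (y + t) * mode m t)" for m
    by (rule circle_integrable_bounded[where B=B]) (auto simp: norm_mult B)
  have bd: "cmod (f (y + t) * complex_of_real (fejer N t)) \<le> B * real N" for t
    unfolding norm_mult by (intro mult_mono B) (auto simp: fejer_nonneg fejer_bound B0)
  have int2: "integrable circle (\<lambda>t. f (y + t) * complex_of_real (fejer N t))"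
    by (rule circle_integrable_bounded[OF _ bd]) simp
  have "(LINT t|circle. f (y + t) * complex_of_real (fejer N t)) =
     (LINT t|circle. (\<Sum>m\<in>{- int N..int N}. complex_of_real (fejer_weight N m) * (f (y + t) * mode m t)))"
    unfolding fejer_expand by (simp add: sum_distrib_left mult_ac)
  also have "\<dots> = (\<Sum>m\<in>{- int N..int N}. complex_of_real (fejer_weight N m) *
       (LINT t|circle. f t * mode m t) * mode (- m) y)"
    by (subst Bochner_Integration.integral_sum) (auto intro!: integrable_mult_right int simp: coeff mult.assoc)
  finally have 1: "(\<Sum>m\<in>{- int N..int N}. complex_of_real (fejer_weight N m) *
       (LINT t|circle. f t * mode m t) * mode (- m) y) = (LINT t|circle. f (y + t) * complex_of_real (fejer N t))" ..
  have 2: "f y = (LINT t|circle. f y * complex_of_real (fejer N t))"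
    using integral_fejer[OF N] by simp
  have int3: "integrable circle (\<lambda>t. f y * complex_of_real (fejer N t))"
    using integrable_mult_right[OF integrable_of_real[OF integrable_fejer]] .
  have "cmod ((LINT t|circle. f (y + t) * complex_of_real (fejer N t)) - f y) =
      cmod (LINT t|circle. (f (y + t) - f y) * complex_of_real (fejer N t))"
    using int2 int3 by (subst 2) (simp add: Bochner_Integration.integral_diff left_diff_distrib)
  also have "\<dots> \<le> (LINT t|circle. cmod ((f (y + t) - f y) * complex_of_real (fejer N t)))"
    by (rule integral_norm_bound)
  also have "\<dots> \<le> (LINT t|circle. L * (\<bar>sin (pi * t)\<bar> * fejer N t))"
  proof (rule integral_mono_AE)
    show "integrable circle (\<lambda>t. cmod ((f (y + t) - f y) * complex_of_real (fejer N t)))"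
      using int2 int3 by (intro integrable_norm) (simp add: left_diff_distrib)
    show "integrable circle (\<lambda>t. L * (\<bar>sin (pi * t)\<bar> * fejer N t))"
      by (intro integrable_mult_right circle_integrable_bounded[OF _ abs_sin_fejer_bound]) simp
    show "AE t in circle. cmod ((f (y + t) - f y) * complex_of_real (fejer N t)) \<le> L * (\<bar>sin (pi * t)\<bar> * fejer N t)"
      using AE_circle
    proof eventually_elim
      case (elim t)
      have "cmod (f (y + t) - f y) * fejer N t \<le> (L * \<bar>sin (pi * t)\<bar>) * fejer N t"
        by (intro mult_right_mono fejer_nonneg lipschitz_periodic_sin[OF assms(3) lip elim])
      then show ?case by (simp add: norm_mult fejer_nonneg mult_ac)
    qed
  qed
  also have "\<dots> \<le> L * (1 / sqrt (real N))"
    using mult_left_mono[OF integral_abs_sin_fejer[OF N] L] by simp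
  finally show ?thesis unfolding 1 by simp
qed

lemma integrable_correlation:
  fixes G F :: "real \<Rightarrow> complex"
  assumes [measurable]: "G \<in> borel_measurable borel" "F \<in> borel_measurable borel"
    and G: "\<And>x. cmod (G x) \<le> 1" and F: "\<And>x. cmod (F x) \<le> 1"
  shows "integrable circle (\<lambda>y. G y * F (y + w))"
  by (rule circle_integrable_bounded[where B=1]) (auto simp: norm_mult intro!: mult_le_one G F)

text \<open>Only the upper bound of Parseval's identity for the cross-correlation of \<open>G\<close> and \<open>F\<close> is
  needed, so the Fejer means of \<open>F\<close> suffice and no completeness of the modes is used.\<close>

lemma parseval_correlation_le:
  fixes G F :: "real \<Rightarrow> complex"
  assumes G_meas [measurable]: "G \<in> borel_measurable borel" and F_meas [measurable]: "F \<in> borel_measurable borel"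
    and G: "\<And>x. cmod (G x) \<le> 1" and F: "\<And>x. cmod (F x) \<le> 1"
    and per: "int_periodic F" and lip: "\<And>x y. cmod (F x - F y) \<le> L * \<bar>x - y\<bar>"
    and S: "\<And>J. finite J \<Longrightarrow> (\<Sum>m\<in>J. (cmod (LINT t|circle. F t * mode m t))\<^sup>2 *
        (cmod (LINT t|circle. G t * mode (- m) t))\<^sup>2) \<le> S"
  shows "(LINT w|circle. (cmod (LINT y|circle. G y * F (y + w)))\<^sup>2) \<le> S"
proof -
  define h where "h w = (LINT y|circle. G y * F (y + w))" for w
  define Fh where "Fh m = (LINT t|circle. F t * mode m t)" for m
  define Gh where "Gh m = (LINT t|circle. G t * mode (- m) t)" for m
  \<comment> \<open>\<open>P N\<close> is the Fejer mean of \<open>F\<close>, and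
    \<open>hN N\<close> is the correlation of \<open>G\<close> with it: a trigonometric polynomial,
    for which Parseval is a finite computation.\<close>
  define P where "P N y = (\<Sum>m\<in>{- int N..int N}. complex_of_real (fejer_weight N m) * Fh m * mode (- m) y)" for N y
  define hN where "hN N w = (\<Sum>m\<in>{- int N..int N}. complex_of_real (fejer_weight N m) * Fh m * Gh m * mode (- m) w)" for N w
  have L: "0 \<le> L" using order_trans[OF norm_ge_zero lip[of 1 0]] by simp
  have h1: "cmod (h w) \<le> 1" for w
    unfolding h_def by (rule norm_circle_integral_le) (auto simp: norm_mult intro!: mult_le_one G F)
  have h_meas [measurable]: "h \<in> borel_measurable borel"
    unfolding h_def by measurable
  have hN_meas [measurable]: "hN N \<in> borel_measurable borel" for N
    unfolding hN_def by measurable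
  have intGm: "integrable circle (\<lambda>y. G y * mode m (y + w))" for m w
    by (rule circle_integrable_bounded[where B=1]) (auto simp: norm_mult G)
  have hN_eq: "hN N w = (LINT y|circle. G y * P N (y + w))" for N w
  proof -
    have "(LINT y|circle. G y * P N (y + w)) = (LINT y|circle. (\<Sum>m\<in>{- int N..int N}.
        complex_of_real (fejer_weight N m) * Fh m * (G y * mode (- m) (y + w))))"
      by (simp add: P_def sum_distrib_left mult_ac)
    also have "\<dots> = (\<Sum>m\<in>{- int N..int N}.
        complex_of_real (fejer_weight N m) * Fh m * (LINT y|circle. G y * mode (- m) (y + w)))"
      by (subst Bochner_Integration.integral_sum) (auto intro!: intGm integrable_mult_right)
    also have "\<dots> = hN N w"
      unfolding hN_def by (intro sum.cong refl) (simp add: mode_add Gh_def flip: mult.assoc)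
    finally show ?thesis ..
  qed
  have close: "cmod (h w - hN N w) \<le> L / sqrt (real N)" if "N > 0" for N w
  proof -
    have "integrable circle (\<lambda>y. G y * P N (y + w))"
      unfolding P_def by (simp add: sum_distrib_left mult.left_commute[of "G _"])
         (intro Bochner_Integration.integrable_sum integrable_mult_right intGm)
    then have "h w - hN N w = (LINT y|circle. G y * (F (y + w) - P N (y + w)))"
      unfolding h_def hN_eq
      by (simp add: right_diff_distrib Bochner_Integration.integral_diff
          integrable_correlation G F)
    also have "cmod \<dots> \<le> L / sqrt (real N)"
    proof (rule norm_circle_integral_le)
      show "(\<lambda>y. G y * (F (y + w) - P N (y + w))) \<in> borel_measurable borel"
        unfolding P_def by measurable
      have "cmod (F x - P N x) \<le> L / sqrt (real N)" for x
        using fejer_approximation[OF F_meas F per lip that, of x] unfolding P_def Fh_def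
        by (simp only: norm_minus_commute)
      then show "cmod (G y * (F (y + w) - P N (y + w))) \<le> L / sqrt (real N)" for y
        unfolding norm_mult using mult_mono[OF G] by fastforce
    qed
    finally show ?thesis .
  qed
  have hN_int: "(LINT w|circle. (cmod (hN N w))\<^sup>2) \<le> S" for N
  proof -
    define a where "a m = complex_of_real (fejer_weight N m) * Fh m * Gh m" for m
    have "complex_of_real (LINT w|circle. (cmod (hN N w))\<^sup>2) = (LINT w|circle. hN N w * cnj (hN N w))"
      by (simp only: complex_norm_square flip: integral_complex_of_real)
    also have "\<dots> = (LINT w|circle. (\<Sum>m\<in>{- int N..int N}. (\<Sum>n\<in>{- int N..int N}.
        a m * cnj (a n) * (mode (- m) w * cnj (mode (- n) w)))))"
      by (simp add: hN_def a_def sum_product mult_ac)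
    also have "\<dots> = (\<Sum>m\<in>{- int N..int N}. (\<Sum>n\<in>{- int N..int N}.
        a m * cnj (a n) * (LINT w|circle. mode (- m) w * cnj (mode (- n) w))))"
    proof -
      have i: "integrable circle (\<lambda>w. mode (- m) w * cnj (mode (- n) w))" for m n
        by (simp add: cnj_mode mode_mult integrable_circle_mode)
      show ?thesis
        by (subst Bochner_Integration.integral_sum)
           (auto intro!: Bochner_Integration.integrable_sum integrable_mult_right i sum.cong
             simp only: Bochner_Integration.integral_sum[OF integrable_mult_right[OF i]] integral_mult_right_zero)
    qed
    also have "\<dots> = (\<Sum>m\<in>{- int N..int N}. (\<Sum>n\<in>{- int N..int N}. if m = n then a m * cnj (a m) else 0))"
      by (intro sum.cong) (auto simp: integral_mode_mult_cnj)
    also have "\<dots> = (\<Sum>m\<in>{- int N..int N}. a m * cnj (a m))"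
      by (intro sum.cong) auto
    also have "\<dots> = complex_of_real (\<Sum>m\<in>{- int N..int N}. (cmod (a m))\<^sup>2)"
      by (simp add: complex_norm_square[symmetric] flip: of_real_power)
    finally have "(LINT w|circle. (cmod (hN N w))\<^sup>2) = (\<Sum>m\<in>{- int N..int N}. (cmod (a m))\<^sup>2)"
      by (simp only: of_real_eq_iff)
    also have "\<dots> \<le> (\<Sum>m\<in>{- int N..int N}. (cmod (Fh m))\<^sup>2 * (cmod (Gh m))\<^sup>2)"
    proof (rule sum_mono)
      fix m
      have "cmod (a m) \<le> 1 * (cmod (Fh m) * cmod (Gh m))"
        unfolding a_def norm_mult mult.assoc
        by (intro mult_right_mono) (auto simp: fejer_weight_nonneg fejer_weight_le_1)
      then show "(cmod (a m))\<^sup>2 \<le> (cmod (Fh m))\<^sup>2 * (cmod (Gh m))\<^sup>2"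
        using power_mono[of "cmod (a m)" "cmod (Fh m) * cmod (Gh m)" 2] by (simp add: power_mult_distrib)
    qed
    also have "\<dots> \<le> S" unfolding Fh_def Gh_def by (rule S) simp
    finally show ?thesis .
  qed
  \<comment> \<open>Since \<open>cmod (h w) \<le> 1\<close>, the uniform error
    \<open>\<epsilon>\<close> of \<open>hN N\<close> costs at most
    \<open>\<epsilon> * (2 + \<epsilon>)\<close> in the squares, and this vanishes as
    \<open>N\<close> grows.\<close>
  have step: "(LINT w|circle. (cmod (h w))\<^sup>2) \<le> S + \<epsilon> * (2 + \<epsilon>)" if N: "N > 0" and \<epsilon>: "\<epsilon> = L / sqrt (real N)" for N \<epsilon>
  proof -
    have \<epsilon>0: "0 \<le> \<epsilon>" using L by (simp add: \<epsilon>)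
    have pt: "(cmod (h w))\<^sup>2 \<le> (cmod (hN N w))\<^sup>2 + \<epsilon> * (2 + \<epsilon>)" for w
    proof -
      have c: "cmod (h w) \<le> cmod (hN N w) + \<epsilon>" "cmod (hN N w) \<le> cmod (h w) + \<epsilon>"
        using close[OF N, of w] norm_triangle_ineq2[of "h w" "hN N w"] norm_triangle_ineq3[of "h w" "hN N w"] \<epsilon> by auto
      have "(cmod (h w))\<^sup>2 \<le> (cmod (hN N w) + \<epsilon>) * cmod (h w)"
        using c by (simp add: power2_eq_square mult_right_mono)
      also have "\<dots> \<le> cmod (hN N w) * (cmod (hN N w) + \<epsilon>) + \<epsilon> * 1"
        unfolding distrib_right using c h1[of w] \<epsilon>0
        by (intro add_mono mult_left_mono) auto
      also have "\<dots> = (cmod (hN N w))\<^sup>2 + \<epsilon> * cmod (hN N w) + \<epsilon>"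
        by (simp add: power2_eq_square algebra_simps)
      also have "\<epsilon> * cmod (hN N w) \<le> \<epsilon> * (1 + \<epsilon>)"
        using c h1[of w] \<epsilon>0 by (intro mult_left_mono) auto
      finally show ?thesis by (simp add: algebra_simps)
    qed
    have b: "cmod (hN N w) \<le> 1 + \<epsilon>" for w
      using close[OF N, of w] norm_triangle_ineq3[of "h w" "hN N w"] \<epsilon> h1[of w] by auto
    have i1: "integrable circle (\<lambda>w. (cmod (h w))\<^sup>2)"
      by (rule circle_integrable_bounded[where B=1]) (auto intro!: power_le_one h1)
    have i2: "integrable circle (\<lambda>w. (cmod (hN N w))\<^sup>2)"
      by (rule circle_integrable_bounded[where B="(1 + \<epsilon>)\<^sup>2"]) (auto intro!: power_mono b)
    have "(LINT w|circle. (cmod (h w))\<^sup>2) \<le> (LINT w|circle. (cmod (hN N w))\<^sup>2 + \<epsilon> * (2 + \<epsilon>))"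
      by (intro integral_mono i1 Bochner_Integration.integrable_add i2 pt) auto
    also have "\<dots> = (LINT w|circle. (cmod (hN N w))\<^sup>2) + \<epsilon> * (2 + \<epsilon>)"
      using i2 circle.prob_space by (subst Bochner_Integration.integral_add) auto
    finally show ?thesis using hN_int[of N] by linarith
  qed
  have "(\<lambda>n. S + (L / sqrt (real (Suc n))) * (2 + L / sqrt (real (Suc n)))) \<longlonglongrightarrow> S + 0 * (2 + 0)"
    by (intro tendsto_intros tendsto_divide_0[OF tendsto_const] filterlim_at_top_imp_at_infinity
        filterlim_compose[OF sqrt_at_top] filterlim_compose[OF filterlim_real_sequentially filterlim_Suc])
  then have "(LINT w|circle. (cmod (h w))\<^sup>2) \<le> S + 0 * (2 + 0)"
    by (rule LIMSEQ_le_const) (use step in blast)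
  then show ?thesis by (simp add: h_def)
qed

subsection \<open>Oscillatory integrals\<close>

text \<open>Integration by parts: \<open>f\<close> is the oscillating factor divided by the
  derivative of its phase (and by the imaginary unit), and its derivative differs from the integrand
  by \<open>g\<close>, of modulus \<open>1 / (2 * \<Lambda> * v\<^sup>2)\<close>. The boundary term
  at \<open>\<beta>\<close> cancels against the integral of that modulus, so the bound is
  independent of \<open>\<beta>\<close>.\<close>

lemma fresnel_tail_bound:
  assumes \<Lambda>: "\<Lambda> > 0" and "0 < \<alpha>" "\<alpha> \<le> \<beta>"
  shows "cmod (integral {\<alpha>..\<beta>} (\<lambda>v. cis (\<Lambda> * v\<^sup>2))) \<le> 1 / (\<Lambda> * \<alpha>)"
proof -
  define f where "f v = cis (\<Lambda> * v\<^sup>2) / (2 * \<i> * of_real (\<Lambda> * v))" for v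
  define g where "g v = cis (\<Lambda> * v\<^sup>2) / (2 * \<i> * of_real (\<Lambda> * v\<^sup>2))" for v
  have "((\<lambda>v. cis (\<Lambda> * v\<^sup>2) - g v) has_integral (f \<beta> - f \<alpha>)) {\<alpha>..\<beta>}"
  proof (rule fundamental_theorem_of_calculus)
    fix v assume v: "v \<in> {\<alpha>..\<beta>}"
    \<comment> \<open>The extension of \<open>f\<close> to complex arguments, so that the rules for
      field derivatives apply before restriction to the real line.\<close>
    define F where "F z = exp (\<i> * of_real \<Lambda> * z\<^sup>2) / (2 * \<i> * of_real \<Lambda> * z)" for z
    have "(F has_field_derivative exp (\<i> * of_real \<Lambda> * (of_real v)\<^sup>2)
        - exp (\<i> * of_real \<Lambda> * (of_real v)\<^sup>2) / (2 * \<i> * of_real \<Lambda> * (of_real v)\<^sup>2)) (at (of_real v))"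
      unfolding F_def using v assms
      by (auto intro!: derivative_eq_intros simp: power2_eq_square field_simps)
    from has_vector_derivative_real_field[OF this, of "{\<alpha>..\<beta>}"]
    show "(f has_vector_derivative cis (\<Lambda> * v\<^sup>2) - g v) (at v within {\<alpha>..\<beta>})"
      by (simp add: f_def[abs_def] g_def F_def cis_conv_exp mult.assoc)
  qed (use assms in auto)
  moreover have g_int: "g integrable_on {\<alpha>..\<beta>}"
    unfolding g_def by (intro integrable_continuous_real continuous_intros) (use assms in auto)
  ultimately have "integral {\<alpha>..\<beta>} (\<lambda>v. cis (\<Lambda> * v\<^sup>2)) = f \<beta> - f \<alpha> + integral {\<alpha>..\<beta>} g"
    using has_integral_add[of "\<lambda>v. cis (\<Lambda> * v\<^sup>2) - g v" "f \<beta> - f \<alpha>" _ g "integral {\<alpha>..\<beta>} g"]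
    by (auto dest!: integrable_integral intro!: integral_unique)
  moreover have "cmod (integral {\<alpha>..\<beta>} g) \<le> 1 / (2 * \<Lambda>) * (1 / \<alpha> - 1 / \<beta>)"
  proof -
    have "((\<lambda>v. 1 / (2 * \<Lambda>) * (1 / v\<^sup>2)) has_integral (- (1 / (2 * \<Lambda>)) * (1 / \<beta>) - (- (1 / (2 * \<Lambda>)) * (1 / \<alpha>)))) {\<alpha>..\<beta>}"
      by (rule fundamental_theorem_of_calculus)
         (use assms in \<open>auto intro!: derivative_eq_intros simp: power2_eq_square divide_simps
            simp flip: has_real_derivative_iff_has_vector_derivative\<close>)
    then have i: "integral {\<alpha>..\<beta>} (\<lambda>v. 1 / (2 * \<Lambda>) * (1 / v\<^sup>2)) = 1 / (2 * \<Lambda>) * (1 / \<alpha> - 1 / \<beta>)"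
       "(\<lambda>v. 1 / (2 * \<Lambda>) * (1 / v\<^sup>2)) integrable_on {\<alpha>..\<beta>}"
      by (auto simp: integral_unique has_integral_integrable)
         (auto dest!: integral_unique simp: diff_divide_distrib mult_ac)
    have "cmod (integral {\<alpha>..\<beta>} g) \<le> integral {\<alpha>..\<beta>} (\<lambda>v. 1 / (2 * \<Lambda>) * (1 / v\<^sup>2))"
      by (rule integral_norm_bound_integral[OF g_int i(2)])
         (use \<Lambda> in \<open>auto simp: g_def norm_divide norm_mult norm_power mult.assoc\<close>)
    with i show ?thesis by simp
  qed
  moreover have "cmod (f \<beta>) = 1 / (2 * \<Lambda>) * (1 / \<beta>)" "cmod (f \<alpha>) = 1 / (2 * \<Lambda>) * (1 / \<alpha>)"
    using assms by (auto simp: f_def norm_divide norm_mult)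
  ultimately have "cmod (integral {\<alpha>..\<beta>} (\<lambda>v. cis (\<Lambda> * v\<^sup>2))) \<le>
     1 / (2 * \<Lambda>) * (1 / \<beta>) + 1 / (2 * \<Lambda>) * (1 / \<alpha>) + 1 / (2 * \<Lambda>) * (1 / \<alpha> - 1 / \<beta>)"
    using norm_triangle_ineq[of "f \<beta> - f \<alpha>" "integral {\<alpha>..\<beta>} g"] norm_triangle_ineq4[of "f \<beta>" "f \<alpha>"] by simp
  also have "\<dots> = 1 / (\<Lambda> * \<alpha>)" using assms by (simp add: field_simps)
  finally show ?thesis .
qed

lemma fresnel_integrable: "(\<lambda>v. cis (\<Lambda> * v\<^sup>2)) integrable_on {\<alpha>..\<beta>}"
  by (intro integrable_continuous_real continuous_intros)

lemma fresnel_bound_trivial: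
  assumes "\<alpha> \<le> \<beta>"
  shows "cmod (integral {\<alpha>..\<beta>} (\<lambda>v. cis (\<Lambda> * v\<^sup>2))) \<le> \<beta> - \<alpha>"
  using integral_norm_bound_integral[OF fresnel_integrable, of "\<lambda>_. 1" \<alpha> \<beta> \<Lambda>] assms
  by (simp add: integrable_const_ivl)

text \<open>The cut is at \<open>\<delta> = 1 / sqrt \<Lambda>\<close>, the scale on which
  oscillation sets in. Up to \<open>\<delta>\<close> the length bounds the integral by
  \<open>\<delta>\<close>; beyond it, \<open>fresnel_tail_bound\<close> gives
  \<open>1 / (\<Lambda> * \<delta>) = \<delta>\<close>.\<close>

lemma fresnel_bound_nonneg:
  assumes \<Lambda>: "\<Lambda> > 0" and "0 \<le> \<alpha>" "\<alpha> \<le> \<beta>"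
  shows "cmod (integral {\<alpha>..\<beta>} (\<lambda>v. cis (\<Lambda> * v\<^sup>2))) \<le> 2 / sqrt \<Lambda>"
proof -
  define \<delta> where "\<delta> = 1 / sqrt \<Lambda>"
  have \<delta>: "\<delta> > 0" "\<Lambda> * \<delta> = sqrt \<Lambda>" using \<Lambda> by (auto simp: \<delta>_def real_div_sqrt)
  have tail: "cmod (integral {a..\<beta>} (\<lambda>v. cis (\<Lambda> * v\<^sup>2))) \<le> \<delta>" if "\<delta> \<le> a" "a \<le> \<beta>" for a
  proof -
    have "cmod (integral {a..\<beta>} (\<lambda>v. cis (\<Lambda> * v\<^sup>2))) \<le> 1 / (\<Lambda> * a)"
      using fresnel_tail_bound[OF \<Lambda>, of a \<beta>] that \<delta> by simp
    also have "\<dots> \<le> 1 / (\<Lambda> * \<delta>)" using that \<delta> \<Lambda> by (intro divide_left_mono mult_left_mono) auto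
    finally show ?thesis by (simp add: \<delta>(2)) (simp add: \<delta>_def)
  qed
  consider "\<beta> \<le> \<delta>" | "\<delta> \<le> \<alpha>" | "\<alpha> < \<delta>" "\<delta> < \<beta>" by linarith
  then have "cmod (integral {\<alpha>..\<beta>} (\<lambda>v. cis (\<Lambda> * v\<^sup>2))) \<le> 2 * \<delta>"
  proof cases
    case 1
    then show ?thesis using fresnel_bound_trivial[OF assms(3), of \<Lambda>] assms \<delta> by linarith
  next
    case 2
    then show ?thesis using tail[OF 2 assms(3)] \<delta> by linarith
  next
    case 3
    have "integral {\<alpha>..\<beta>} (\<lambda>v. cis (\<Lambda> * v\<^sup>2)) =
        integral {\<alpha>..\<delta>} (\<lambda>v. cis (\<Lambda> * v\<^sup>2)) + integral {\<delta>..\<beta>} (\<lambda>v. cis (\<Lambda> * v\<^sup>2))"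
      using 3 by (intro Henstock_Kurzweil_Integration.integral_combine[symmetric] fresnel_integrable) auto
    then show ?thesis
      using tail[of \<delta>] fresnel_bound_trivial[of \<alpha> \<delta> \<Lambda>] 3 assms(2)
        norm_triangle_ineq[of "integral {\<alpha>..\<delta>} (\<lambda>v. cis (\<Lambda> * v\<^sup>2))" "integral {\<delta>..\<beta>} (\<lambda>v. cis (\<Lambda> * v\<^sup>2))"]
      by auto
  qed
  then show ?thesis by (simp add: \<delta>_def)
qed

lemma fresnel_bound:
  assumes \<Lambda>: "\<Lambda> > 0" and "\<alpha> \<le> \<beta>"
  shows "cmod (integral {\<alpha>..\<beta>} (\<lambda>v. cis (\<Lambda> * v\<^sup>2))) \<le> 4 / sqrt \<Lambda>"
proof -
  have neg: "cmod (integral {a..b} (\<lambda>v. cis (\<Lambda> * v\<^sup>2))) \<le> 2 / sqrt \<Lambda>" if "a \<le> b" "b \<le> 0" for a b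
    using fresnel_bound_nonneg[OF \<Lambda>, of "- b" "- a"] that
      Henstock_Kurzweil_Integration.integral_reflect_real[of b a "\<lambda>v. cis (\<Lambda> * v\<^sup>2)"] by simp
  have p: "2 / sqrt \<Lambda> \<le> 4 / sqrt \<Lambda>" using \<Lambda> by (simp add: divide_right_mono)
  consider "0 \<le> \<alpha>" | "\<beta> \<le> 0" | "\<alpha> < 0" "0 < \<beta>" by linarith
  then show ?thesis
  proof cases
    case 1
    then show ?thesis using fresnel_bound_nonneg[OF \<Lambda> 1 assms(2)] p by linarith
  next
    case 2
    then show ?thesis using neg[OF assms(2) 2] p by linarith
  next
    case 3
    have "integral {\<alpha>..\<beta>} (\<lambda>v. cis (\<Lambda> * v\<^sup>2)) =
        integral {\<alpha>..0} (\<lambda>v. cis (\<Lambda> * v\<^sup>2)) + integral {0..\<beta>} (\<lambda>v. cis (\<Lambda> * v\<^sup>2))"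
      using 3 by (intro Henstock_Kurzweil_Integration.integral_combine[symmetric] fresnel_integrable) auto
    then show ?thesis
      using neg[of \<alpha> 0] fresnel_bound_nonneg[OF \<Lambda>, of 0 \<beta>] 3
        norm_triangle_ineq[of "integral {\<alpha>..0} (\<lambda>v. cis (\<Lambda> * v\<^sup>2))" "integral {0..\<beta>} (\<lambda>v. cis (\<Lambda> * v\<^sup>2))"]
      by auto
  qed
qed

text \<open>Completing the square leaves a pure quadratic on a translated interval, and conjugation
  reverses the sign of \<open>\<Lambda>\<close>. The bound is uniform in \<open>\<beta>\<close>,
  hence in the Fourier frequency.\<close>

lemma quadratic_phase_bound:
  assumes "\<Lambda> \<noteq> 0"
  shows "cmod (integral {0..1} (\<lambda>y. cis (\<Lambda> * y\<^sup>2 + \<beta> * y))) \<le> 4 / sqrt \<bar>\<Lambda>\<bar>"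
proof -
  have pos: "cmod (integral {0..1} (\<lambda>y. cis (\<Lambda> * y\<^sup>2 + \<beta> * y))) \<le> 4 / sqrt \<Lambda>" if \<Lambda>: "\<Lambda> > 0" for \<Lambda> \<beta>
  proof -
    define c where "c = \<beta> / (2 * \<Lambda>)"
    have "\<Lambda> * y\<^sup>2 + \<beta> * y = - (\<Lambda> * c\<^sup>2) + \<Lambda> * (c + y)\<^sup>2" for y
      using \<Lambda> by (simp add: c_def power2_eq_square field_simps)
    then have "cis (\<Lambda> * y\<^sup>2 + \<beta> * y) = cis (- (\<Lambda> * c\<^sup>2)) * cis (\<Lambda> * (c + y)\<^sup>2)" for y
      by (simp only: cis_mult)
    then have "cmod (integral {0..1} (\<lambda>y. cis (\<Lambda> * y\<^sup>2 + \<beta> * y)))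
       = cmod (integral {0..1} (\<lambda>y. cis (\<Lambda> * (c + y)\<^sup>2)))"
      by (simp add: norm_mult)
    also have "integral {0..1} (\<lambda>y. cis (\<Lambda> * (c + y)\<^sup>2)) = integral {c..c+1} (\<lambda>v. cis (\<Lambda> * v\<^sup>2))"
      using integral_shift_real_ivl[of c c "c + 1" "\<lambda>v. cis (\<Lambda> * v\<^sup>2)"]
      by (simp add: add.commute fresnel_integrable)
    finally show ?thesis using fresnel_bound[OF \<Lambda>, of c "c + 1"] by simp
  qed
  show ?thesis
  proof (cases "\<Lambda> > 0")
    case True
    then show ?thesis using pos by simp
  next
    case False
    have "cnj (integral {0..1} (\<lambda>y. cis (\<Lambda> * y\<^sup>2 + \<beta> * y))) =
       integral {0..1} (\<lambda>y. cis ((- \<Lambda>) * y\<^sup>2 + (- \<beta>) * y))"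
      by (simp add: Henstock_Kurzweil_Integration.integral_cnj cis_cnj)
    then have "cmod (integral {0..1} (\<lambda>y. cis (\<Lambda> * y\<^sup>2 + \<beta> * y))) =
       cmod (integral {0..1} (\<lambda>y. cis ((- \<Lambda>) * y\<^sup>2 + (- \<beta>) * y)))"
      by (metis complex_mod_cnj)
    then show ?thesis using pos[of "- \<Lambda>" "- \<beta>"] False assms by simp
  qed
qed

lemma circle_eq: "circle = density lborel (\<lambda>x. ennreal (indicator {0..<1} x))"
  by (simp add: circle_def ennreal_indicator)

text \<open>Bridge from the Bochner integral to the gauge integral, in which the fundamental theorem
  of calculus and the oscillatory estimates are phrased.\<close>

lemma circle_integral_eq_integral:
  fixes f :: "real \<Rightarrow> 'a::euclidean_space"
  assumes [measurable]: "f \<in> borel_measurable borel" and B: "\<And>x. norm (f x) \<le> B"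
  shows "(LINT t|circle. f t) = integral {0..1} f"
proof -
  have "(LINT t|circle. f t) = (LINT t|lborel. indicator {0..<1} t *\<^sub>R f t)"
    unfolding circle_eq by (rule integral_density) auto
  also have "\<dots> = (LINT t:{0..1}|lborel. f t)"
    unfolding set_lebesgue_integral_def
    by (rule integral_cong_AE)
       (use AE_lborel_singleton[of 1] in \<open>auto simp: indicator_def elim!: eventually_mono\<close>)
  also have "\<dots> = integral {0..1} f"
  proof (rule set_borel_integral_eq_integral)
    show "set_integrable lborel {0..1} f"
      unfolding set_integrable_def
      by (rule integrableI_bounded_set_indicator[where B=B]) (use B in \<open>auto\<close>)
  qed
  finally show ?thesis .
qed

section \<open>One shear with random phase\<close>

text \<open>The slope of the parabola is spread uniformly over an interval, so by the second derivative
  test no Fourier coefficient of \<open>cis (2 * pi * a * profile t)\<close> is large. The amplitude is chosen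
  large enough for the contraction factor in \<open>sum_weight_phase_le\<close>.\<close>

definition profile :: "real \<Rightarrow> real" where
  "profile y = 10000 * (frac y * (1 - frac y))"

lemma int_periodic_profile: "int_periodic profile"
  by (simp add: int_periodic_def profile_def frac_add_int)

lemma borel_measurable_profile [measurable]: "profile \<in> borel_measurable borel"
  unfolding profile_def[abs_def] by measurable

lemma profile_nonneg: "0 \<le> profile y"
  by (simp add: profile_def frac_lt_1 less_imp_le)

lemma profile_le_frac: "profile y \<le> 10000 * frac y"
  using mult_left_mono[of "1 - frac y" 1 "frac y"] by (simp add: profile_def)

lemma profile_le_1_minus_frac: "profile y \<le> 10000 * (1 - frac y)"
  using mult_right_mono[of "frac y" 1 "1 - frac y"] frac_lt_1[of y]
  unfolding profile_def by (intro mult_left_mono) auto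

lemma profile_le: "profile y \<le> 10000"
  using profile_le_frac[of y] frac_lt_1[of y] by linarith

text \<open>Within one period the difference factors, with one factor at most 1 in modulus. Across
  an integer, where the parabola vanishes, each value is at most 10000 times the distance to a point
  in between, and both values are nonnegative.\<close>

lemma profile_lipschitz: "\<bar>profile x - profile y\<bar> \<le> 10000 * \<bar>x - y\<bar>"
proof -
  have *: "\<bar>profile x - profile y\<bar> \<le> 10000 * (y - x)" if "x \<le> y" for x y
  proof (cases "\<lfloor>x\<rfloor> = \<lfloor>y\<rfloor>")
    case True
    then have d: "frac x - frac y = x - y" by (simp add: frac_def)
    have "profile x - profile y = 10000 * ((frac x - frac y) * (1 - (frac x + frac y)))"
      by (simp add: profile_def algebra_simps)
    then have "\<bar>profile x - profile y\<bar> = 10000 * (\<bar>x - y\<bar> * \<bar>1 - (frac x + frac y)\<bar>)"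
      by (simp add: d abs_mult)
    also have "\<dots> \<le> 10000 * (\<bar>x - y\<bar> * 1)"
      using frac_ge_0[of x] frac_ge_0[of y] frac_lt_1[of x] frac_lt_1[of y]
      by (intro mult_left_mono) (auto simp: abs_le_iff intro: order_trans[of _ 0])
    finally show ?thesis using that by simp
  next
    case False
    then have "\<lfloor>x\<rfloor> + 1 \<le> \<lfloor>y\<rfloor>" using floor_mono[OF that] by linarith
    then have "1 - frac x \<le> of_int \<lfloor>y\<rfloor> - x" "frac y = y - of_int \<lfloor>y\<rfloor>" "x \<le> of_int \<lfloor>y\<rfloor>"
      unfolding frac_def by linarith+
    then obtain z where "1 - frac x \<le> z - x" "frac y = y - z" "x \<le> z" "z \<le> y"
      using of_int_floor_le[of y] by blast
    then have "1 - frac x \<le> y - x" "frac y \<le> y - x" by auto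
    then have "profile x \<le> 10000 * (y - x)" "profile y \<le> 10000 * (y - x)"
      using profile_le_1_minus_frac[of x] profile_le_frac[of y]
      by (meson mult_left_mono order_trans zero_le_numeral)+
    then show ?thesis using profile_nonneg[of x] profile_nonneg[of y] by linarith
  qed
  show ?thesis using *[of x y] *[of y x] by (cases "x \<le> y") (auto simp: abs_minus_commute)
qed

lemma continuous_profile [continuous_intros]:
  assumes "continuous_on S f"
  shows "continuous_on S (\<lambda>x. profile (f x))"
proof -
  have "10000-lipschitz_on UNIV profile"
    by (rule lipschitz_onI) (auto simp: dist_real_def profile_lipschitz)
  then have "continuous_on UNIV profile" by (rule lipschitz_on_continuous_on)
  then show ?thesis using assms continuous_on_compose2 by blast
qed

lemma norm_cis_diff_le: "cmod (cis s - cis t) \<le> \<bar>s - t\<bar>"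
proof -
  have "cis s - cis t = cis t * (exp (\<i> * of_real (s - t)) - 1)"
    by (simp add: cis_conv_exp right_diff_distrib flip: exp_add)
  then have "cmod (cis s - cis t) = 2 * \<bar>sin ((s - t) / 2)\<bar>"
    using dist_exp_i_1[of "s - t"] by (simp add: norm_mult dist_norm)
  also have "\<dots> \<le> \<bar>s - t\<bar>" using abs_sin_x_le_abs_x[of "(s - t) / 2"] by simp
  finally show ?thesis .
qed

lemma mode_lipschitz: "cmod (mode m s - mode m t) \<le> 2 * pi * \<bar>of_int m\<bar> * \<bar>s - t\<bar>"
  using norm_cis_diff_le[of "2 * pi * of_int m * s" "2 * pi * of_int m * t"]
  by (simp add: mode_def abs_mult flip: right_diff_distrib)

text \<open>Fourier coefficients of the unimodular function by which a shear multiplies the row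
  \<open>a\<close>.\<close>

definition phase_coeff :: "int \<Rightarrow> int \<Rightarrow> complex" where
  "phase_coeff a m = (LINT t|circle. mode (- a) (profile t) * mode m t)"

lemma phase_coeff_sum_le_1:
  assumes "finite J"
  shows "(\<Sum>m\<in>J. (cmod (phase_coeff a m))\<^sup>2) \<le> 1"
proof -
  have "(\<Sum>m\<in>J. (cmod (LINT t|circle. mode (- a) (profile t) * cnj (mode (- m) t)))\<^sup>2)
      \<le> (LINT t|circle. (cmod (mode (- a) (profile t)))\<^sup>2)"
    by (rule circle.bessel_inequality[where B=1])
       (use assms in \<open>auto simp: integral_mode_mult_cnj\<close>)
  then show ?thesis using circle.prob_space by (simp add: phase_coeff_def cnj_mode)
qed

text \<open>On the unit interval the profile is a parabola, so the phase is quadratic with leading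
  coefficient \<open>\<Lambda>\<close>. The 3 is a bound for \<open>16 / (2 * pi)\<close>, by
  \<open>pi > 3\<close>.\<close>

lemma phase_coeff_le:
  assumes "a \<noteq> 0"
  shows "(cmod (phase_coeff a m))\<^sup>2 \<le> 3 / (10000 * \<bar>of_int a\<bar>)"
proof -
  define \<Lambda> where "\<Lambda> = 2 * pi * of_int a * 10000"
  define \<beta> where "\<beta> = 2 * pi * of_int m - \<Lambda>"
  have "phase_coeff a m = integral {0..1} (\<lambda>t. mode (- a) (profile t) * mode m t)"
    unfolding phase_coeff_def
    by (rule circle_integral_eq_integral[where B=1]) (auto simp: norm_mult)
  also have "\<dots> = integral {0..1} (\<lambda>t. cis (\<Lambda> * t\<^sup>2 + \<beta> * t))"
  proof (rule Henstock_Kurzweil_Integration.integral_cong)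
    fix t :: real assume t: "t \<in> {0..1}"
    have "profile t = 10000 * (t * (1 - t))"
    proof (cases "t = 1")
      case False
      with t have "frac t = t" by (simp add: frac_eq)
      then show ?thesis by (simp add: profile_def)
    qed (simp add: profile_def frac_def)
    then show "mode (- a) (profile t) * mode m t = cis (\<Lambda> * t\<^sup>2 + \<beta> * t)"
      by (simp only: mode_def cis_mult) (simp add: \<Lambda>_def \<beta>_def power2_eq_square algebra_simps)
  qed
  finally have "cmod (phase_coeff a m) \<le> 4 / sqrt \<bar>\<Lambda>\<bar>"
    using quadratic_phase_bound[of \<Lambda> \<beta>] assms by (simp add: \<Lambda>_def)
  then have "(cmod (phase_coeff a m))\<^sup>2 \<le> (4 / sqrt \<bar>\<Lambda>\<bar>)\<^sup>2"
    by (intro power_mono) auto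
  also have "\<dots> = 16 / (2 * pi * (\<bar>of_int a\<bar> * 10000))"
    by (simp add: power_divide \<Lambda>_def abs_mult)
  also have "\<dots> \<le> 16 / (2 * 3 * (\<bar>of_int a\<bar> * 10000))"
    using assms pi_gt3 by (intro divide_left_mono mult_right_mono mult_pos_pos) auto
  also have "\<dots> \<le> 3 / (10000 * \<bar>of_int a\<bar>)" using assms by (simp add: field_simps)
  finally show ?thesis .
qed

subsection \<open>Functions on the product of two circles\<close>

abbreviation circle2 :: "(real \<times> real) measure" where
  "circle2 \<equiv> circle \<Otimes>\<^sub>M circle"

lemma sets_circle2: "sets circle2 = sets (borel \<Otimes>\<^sub>M borel)"
  by (intro sets_pair_measure_cong) auto

interpretation circle2: pair_prob_space circle circle ..

text \<open>Serves for densities and for test functions in product coordinates; the bound 1 supplies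
  integrability throughout.\<close>

definition cell_function :: "(real \<times> real \<Rightarrow> real) \<Rightarrow> bool" where
  "cell_function r \<longleftrightarrow> r \<in> borel_measurable (borel \<Otimes>\<^sub>M borel) \<and> (\<forall>z. \<bar>r z\<bar> \<le> 1) \<and>
     (\<forall>x y (m::int) (n::int). r (x + of_int m, y + of_int n) = r (x, y))"

lemma cell_function_measurable [measurable_dest]:
  "cell_function r \<Longrightarrow> r \<in> borel_measurable (borel \<Otimes>\<^sub>M borel)"
  and cell_function_bound: "cell_function r \<Longrightarrow> \<bar>r z\<bar> \<le> 1"
  and cell_function_periodic: "cell_function r \<Longrightarrow> r (x + of_int m, y + of_int n) = r (x, y)"
  unfolding cell_function_def by blast+

lemma circle2_integrable_bounded:
  fixes f :: "real \<times> real \<Rightarrow> 'a::{banach, second_countable_topology}"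
  assumes "f \<in> borel_measurable (borel \<Otimes>\<^sub>M borel)" "\<And>x. norm (f x) \<le> B"
  shows "integrable circle2 f"
  by (rule circle2.P.integrable_const_bound[where B=B])
     (use assms in \<open>auto simp: measurable_cong_sets[OF sets_circle2 refl]\<close>)

lemma circle2_integral_iterated:
  fixes f :: "real \<times> real \<Rightarrow> 'a::{banach, second_countable_topology}"
  assumes "f \<in> borel_measurable (borel \<Otimes>\<^sub>M borel)" "\<And>x. norm (f x) \<le> B"
  shows "(LINT z|circle2. f z) = (LINT y|circle. (LINT x|circle. f (x, y)))"
    and "(LINT z|circle2. f z) = (LINT x|circle. (LINT y|circle. f (x, y)))"
  using circle2.integral_snd[of "\<lambda>x y. f (x, y)"] circle2.integral_fst'[of f]
    circle2_integrable_bounded[OF assms] by (auto simp: case_prod_beta')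

definition fc :: "(real \<times> real \<Rightarrow> real) \<Rightarrow> int \<Rightarrow> int \<Rightarrow> complex" where
  "fc r a b = (LINT z|circle2. complex_of_real (r z) * (mode (- a) (fst z) * mode (- b) (snd z)))"

definition sheared :: "real \<Rightarrow> (real \<times> real \<Rightarrow> real) \<Rightarrow> real \<times> real \<Rightarrow> real" where
  "sheared w r = (\<lambda>(x, y). r (x - profile (y + w), y))"

text \<open>Exchanging the coordinates after each step turns alternating shears into shears along
  the first axis only.\<close>

definition swapped :: "(real \<times> real \<Rightarrow> 'a) \<Rightarrow> real \<times> real \<Rightarrow> 'a" where
  "swapped r = (\<lambda>(x, y). r (y, x))"

lemma cell_function_sheared:
  assumes "cell_function r"
  shows "cell_function (sheared w r)"
proof -
  note [measurable] = cell_function_measurable[OF assms]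
  have "r (x + of_int m - profile (y + of_int n + w), y + of_int n) = r (x - profile (y + w), y)" for x y m n
  proof -
    have "profile (y + of_int n + w) = profile (y + w)"
      using int_periodicD[OF int_periodic_profile, of "y + w" n] by (simp add: add_ac)
    then have "x + of_int m - profile (y + of_int n + w) = x - profile (y + w) + of_int m" by simp
    then show ?thesis using cell_function_periodic[OF assms] by (simp only:)
  qed
  moreover have "sheared w r \<in> borel_measurable (borel \<Otimes>\<^sub>M borel)"
    unfolding sheared_def by measurable
  ultimately show ?thesis
    using cell_function_bound[OF assms] by (simp add: cell_function_def sheared_def split: prod.splits)
qed

lemma cell_function_swapped:
  assumes "cell_function r"
  shows "cell_function (swapped r)"
proof -
  note [measurable] = cell_function_measurable[OF assms]
  have "swapped r \<in> borel_measurable (borel \<Otimes>\<^sub>M borel)"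
    unfolding swapped_def by measurable
  then show ?thesis
    using assms by (simp add: cell_function_def swapped_def split: prod.splits)
qed

lemma fc_iterated:
  assumes "cell_function r"
  shows "fc r a b = (LINT y|circle. (LINT x|circle. complex_of_real (r (x, y)) * mode (- a) x) * mode (- b) y)"
    and "fc r a b = (LINT x|circle. (LINT y|circle. complex_of_real (r (x, y)) * mode (- b) y) * mode (- a) x)"
proof -
  note [measurable] = cell_function_measurable[OF assms]
  note it = circle2_integral_iterated[where B=1 and
      f="\<lambda>z. complex_of_real (r z) * (mode (- a) (fst z) * mode (- b) (snd z))"]
  have m: "(\<lambda>z. complex_of_real (r z) * (mode (- a) (fst z) * mode (- b) (snd z))) \<in> borel_measurable (borel \<Otimes>\<^sub>M borel)"
    by measurable
  have b: "cmod (complex_of_real (r z) * (mode (- a) (fst z) * mode (- b) (snd z))) \<le> 1" for z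
    using cell_function_bound[OF assms] by (simp add: norm_mult)
  show "fc r a b = (LINT y|circle. (LINT x|circle. complex_of_real (r (x, y)) * mode (- a) x) * mode (- b) y)"
    unfolding fc_def it(1)[OF m b] by (simp flip: mult.assoc)
  have "fc r a b = (LINT x|circle. (LINT y|circle. (complex_of_real (r (x, y)) * mode (- b) y) * mode (- a) x))"
    unfolding fc_def it(2)[OF m b] by (simp add: mult_ac)
  then show "fc r a b = (LINT x|circle. (LINT y|circle. complex_of_real (r (x, y)) * mode (- b) y) * mode (- a) x)"
    by simp
qed

lemma fc_swapped:
  assumes "cell_function r"
  shows "fc (swapped r) a b = fc r b a"
  using fc_iterated(1)[OF cell_function_swapped[OF assms], of a b] fc_iterated(2)[OF assms, of b a]
  by (simp add: swapped_def)

text \<open>At fixed \<open>y\<close> the shear translates \<open>x\<close> and so multiplies the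
  row coefficient \<open>g y\<close> by a character. In the phase \<open>w\<close> the result is the
  cross-correlation of \<open>g y * mode (- b) y\<close> with \<open>mode (- a)\<close> composed
  with the profile.\<close>

lemma fc_sheared:
  fixes r a
  defines "g \<equiv> \<lambda>y. (LINT x|circle. complex_of_real (r (x, y)) * mode (- a) x)"
  assumes "cell_function r"
  shows "fc (sheared w r) a b = (LINT y|circle. (g y * mode (- b) y) * mode (- a) (profile (y + w)))"
proof -
  note [measurable] = cell_function_measurable[OF assms(2)]
  have "(LINT x|circle. complex_of_real (r (x - p, y)) * mode (- a) x) = g y * mode (- a) p" for p y
  proof -
    have "(LINT x|circle. complex_of_real (r (x - p, y)) * mode (- a) x)
       = (LINT x|circle. complex_of_real (r (x + - p, y)) * mode (- a) (x + - p)) * mode (- a) p"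
    proof -
      have "mode (- a) x = mode (- a) (x + - p) * mode (- a) p" for x
        by (simp flip: mode_add)
      then have "complex_of_real (r (x - p, y)) * mode (- a) x =
          complex_of_real (r (x + - p, y)) * mode (- a) (x + - p) * mode (- a) p" for x
        by (metis add_uminus_conv_diff mult.assoc)
      then show ?thesis by (simp only: integral_mult_left_zero)
    qed
    also have "(LINT x|circle. complex_of_real (r (x + - p, y)) * mode (- a) (x + - p)) = g y"
      unfolding g_def
      by (rule circle_integral_shift[of "\<lambda>x. complex_of_real (r (x, y)) * mode (- a) x"])
         (use cell_function_periodic[OF assms(2), of _ _ y 0] int_periodic_mode[of "- a"]
           in \<open>auto simp: int_periodic_def\<close>)
    finally show ?thesis .
  qed
  then show ?thesis
    unfolding fc_iterated(1)[OF cell_function_sheared[OF assms(2)]] by (simp add: sheared_def mult_ac)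
qed

section \<open>Sums over countable index sets as integrals against counting measure\<close>

lemma sum_le_nn_integral_count_space:
  fixes f :: "'a \<Rightarrow> ennreal"
  assumes "finite J"
  shows "(\<Sum>i\<in>J. f i) \<le> (\<integral>\<^sup>+i. f i \<partial>count_space UNIV)"
proof -
  have "(\<Sum>i\<in>J. f i) = (\<integral>\<^sup>+i. f i \<partial>count_space J)"
    using assms by (simp add: nn_integral_count_space_finite)
  also have "\<dots> = (\<integral>\<^sup>+i. f i * indicator J i \<partial>count_space UNIV)"
    by (simp add: nn_integral_count_space_indicator)
  also have "\<dots> \<le> (\<integral>\<^sup>+i. f i \<partial>count_space UNIV)"
    by (intro nn_integral_mono) (auto simp: indicator_def)
  finally show ?thesis .
qed

text \<open>The elements with code at most \<open>n\<close> form finite sets that exhaust the type;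
  monotone convergence passes the bound to the limit.\<close>

lemma nn_integral_count_space_le:
  fixes f :: "'a::countable \<Rightarrow> ennreal"
  assumes "\<And>J. finite J \<Longrightarrow> (\<Sum>i\<in>J. f i) \<le> B"
  shows "(\<integral>\<^sup>+i. f i \<partial>count_space UNIV) \<le> B"
proof -
  define A where "A n = {x :: 'a. to_nat x \<le> n}" for n
  have "A n \<subseteq> to_nat -` {..n}" for n by (auto simp: A_def)
  then have fin: "finite (A n)" for n
    using finite_vimageI[OF finite_atMost inj_to_nat, of n] finite_subset by blast
  have S: "(SUP n. f i * indicator (A n) i) = f i" for i
  proof (rule antisym)
    show "f i \<le> (SUP n. f i * indicator (A n) i)"
      by (rule SUP_upper2[of "to_nat i"]) (auto simp: A_def)
  qed (auto intro!: SUP_least simp: indicator_def)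
  have "(\<integral>\<^sup>+i. f i \<partial>count_space UNIV) = (\<integral>\<^sup>+i. (SUP n. f i * indicator (A n) i) \<partial>count_space UNIV)"
    by (simp only: S)
  also have "\<dots> = (SUP n. \<integral>\<^sup>+i. f i * indicator (A n) i \<partial>count_space UNIV)"
    by (rule nn_integral_monotone_convergence_SUP)
       (auto simp: incseq_def le_fun_def A_def indicator_def)
  also have "\<dots> \<le> B"
  proof (rule SUP_least)
    fix n
    have "(\<integral>\<^sup>+i. f i * indicator (A n) i \<partial>count_space UNIV) = (\<Sum>i\<in>A n. f i)"
      using fin[of n] nn_integral_count_space_indicator[of "A n" f] by (simp flip: nn_integral_count_space_finite)
    with assms[OF fin] show "(\<integral>\<^sup>+i. f i * indicator (A n) i \<partial>count_space UNIV) \<le> B" by simp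
  qed
  finally show ?thesis .
qed

lemma nn_integral_count_space_shift:
  fixes f :: "int \<Rightarrow> ennreal"
  shows "(\<integral>\<^sup>+m. f (b + m) \<partial>count_space UNIV) = (\<integral>\<^sup>+l. f l \<partial>count_space UNIV)"
proof -
  have "bij_betw (\<lambda>m. b + m) UNIV (UNIV :: int set)"
    by (rule bij_betwI[where g="\<lambda>l. l - b"]) auto
  then show ?thesis by (rule nn_integral_bij_count_space)
qed

definition mode_energy :: "(real \<times> real \<Rightarrow> real) \<Rightarrow> int \<Rightarrow> int \<Rightarrow> ennreal" where
  "mode_energy r a b = ennreal ((cmod (fc r a b))\<^sup>2)"

definition phase_weight :: "int \<Rightarrow> int \<Rightarrow> ennreal" where
  "phase_weight a m = ennreal ((cmod (phase_coeff a m))\<^sup>2)"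

lemma fc_sheared_measurable [measurable]:
  assumes "cell_function r"
  shows "(\<lambda>w. fc (sheared w r) a b) \<in> borel_measurable borel"
proof -
  note [measurable] = cell_function_measurable[OF assms]
  show ?thesis unfolding fc_sheared[OF assms] by measurable
qed

text \<open>\<open>parseval_correlation_le\<close> in the phase variable: the mean square of the
  correlation \<open>fc_sheared\<close> is bounded through products of squared coefficients. The
  coefficients of the row, shifted by \<open>b\<close>, are those of \<open>r\<close> at
  \<open>(a, b + m)\<close>.\<close>

lemma expected_mode_energy:
  assumes "cell_function r"
  shows "(\<integral>\<^sup>+w. mode_energy (sheared w r) a b \<partial>circle)
     \<le> (\<integral>\<^sup>+m. phase_weight a m * mode_energy r a (b + m) \<partial>count_space UNIV)"
    (is "?L \<le> ?R")
proof (cases "?R = \<infinity>")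
  case False
  note [measurable] = cell_function_measurable[OF assms] fc_sheared_measurable[OF assms]
  define g where "g y = (LINT x|circle. complex_of_real (r (x, y)) * mode (- a) x)" for y
  have g: "cmod (g y) \<le> 1" for y
    unfolding g_def using cell_function_bound[OF assms]
    by (intro norm_circle_integral_le) (auto simp: norm_mult)
  have [measurable]: "g \<in> borel_measurable borel" unfolding g_def by measurable
  have "(LINT w|circle. (cmod (LINT y|circle. (g y * mode (- b) y) * mode (- a) (profile (y + w))))\<^sup>2) \<le> enn2real ?R"
  proof (rule parseval_correlation_le)
    show "int_periodic (\<lambda>y. mode (- a) (profile y))"
      using int_periodic_profile by (simp add: int_periodic_def)
    show "cmod (mode (- a) (profile x) - mode (- a) (profile y)) \<le> (2 * pi * \<bar>of_int (- a)\<bar> * 10000) * \<bar>x - y\<bar>" for x y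
    proof -
      have "2 * pi * \<bar>of_int (- a)\<bar> * \<bar>profile x - profile y\<bar> \<le> 2 * pi * \<bar>of_int (- a)\<bar> * (10000 * \<bar>x - y\<bar>)"
        by (intro mult_left_mono profile_lipschitz) auto
      also have "\<dots> = (2 * pi * \<bar>of_int (- a)\<bar> * 10000) * \<bar>x - y\<bar>" by simp
      finally show ?thesis
        using mode_lipschitz[of "- a" "profile x" "profile y"] by linarith
    qed
    fix J :: "int set" assume "finite J"
    have e: "(LINT t|circle. g t * mode (- b) t * mode (- m) t) = fc r a (b + m)" for m
      unfolding fc_iterated(1)[OF assms] g_def by (simp add: mult.assoc mode_mult)
    have "ennreal (\<Sum>m\<in>J. (cmod (LINT t|circle. mode (- a) (profile t) * mode m t))\<^sup>2 *
        (cmod (LINT t|circle. g t * mode (- b) t * mode (- m) t))\<^sup>2) =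
       (\<Sum>m\<in>J. phase_weight a m * mode_energy r a (b + m))"
      unfolding e phase_weight_def mode_energy_def phase_coeff_def[symmetric]
      by (subst sum_ennreal[symmetric]) (auto simp: ennreal_mult)
    also have "\<dots> \<le> ?R" by (rule sum_le_nn_integral_count_space[OF \<open>finite J\<close>])
    finally show "(\<Sum>m\<in>J. (cmod (LINT t|circle. mode (- a) (profile t) * mode m t))\<^sup>2 *
        (cmod (LINT t|circle. g t * mode (- b) t * mode (- m) t))\<^sup>2) \<le> enn2real ?R"
      using False by (subst (asm) ennreal_enn2real[symmetric, of ?R]) (auto simp: less_top)
  qed (auto simp: norm_mult g)
  moreover have "?L = ennreal (LINT w|circle. (cmod (fc (sheared w r) a b))\<^sup>2)"
    unfolding mode_energy_def
  proof (rule nn_integral_eq_integral)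
    have "cmod (fc (sheared w r) a b) \<le> 1" for w
      unfolding fc_sheared[OF assms] g_def[symmetric] using g
      by (intro norm_circle_integral_le) (auto simp: norm_mult)
    then show "integrable circle (\<lambda>w. (cmod (fc (sheared w r) a b))\<^sup>2)"
      by (intro circle_integrable_bounded[where B=1]) (auto intro!: power_le_one)
  qed simp
  ultimately have "?L \<le> ennreal (enn2real ?R)"
    unfolding fc_sheared[OF assms] g_def[symmetric] by (simp add: ennreal_leI)
  then show ?thesis using False by (simp add: less_top)
qed simp

subsection \<open>Contraction of the mode energy\<close>

text \<open>In the Fourier variables a shear along the first axis with random phase moves the mode
  \<open>(a, b)\<close> to \<open>(a, b + m)\<close> with probability \<open>phase_weight a m\<close>, which is at most of order
  \<open>1 / \<bar>a\<bar>\<close> times a small constant. Modes with \<open>a = 0\<close> do not move and have to wait for the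
  next shear, along the other axis; this is what the factor 4 pays for.\<close>

definition weight :: "int \<Rightarrow> int \<Rightarrow> real" where
  "weight a b = (if a \<noteq> 0 then 1 / sqrt \<bar>of_int a\<bar> else if b \<noteq> 0 then 4 / sqrt \<bar>of_int b\<bar> else 0)"

lemma weight_nonneg: "0 \<le> weight a b"
  by (simp add: weight_def)

text \<open>Counting measure on pairs of integers lets Tonelli's theorem exchange the sum with the
  average over the phase.\<close>

definition energy :: "(real \<times> real \<Rightarrow> real) \<Rightarrow> ennreal" where
  "energy r = (\<integral>\<^sup>+p. ennreal (weight (fst p) (snd p)) * mode_energy r (fst p) (snd p) \<partial>count_space UNIV)"

text \<open>Each term is at most twice the increment of the square root, since the difference of
  consecutive roots times their sum is 1.\<close>

lemma sum_inverse_sqrt_le: "(\<Sum>k=1..n. 1 / sqrt (real k)) \<le> 2 * sqrt (real n)"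
proof (induction n)
  case (Suc n)
  have "1 / sqrt (real (Suc n)) \<le> 2 * (sqrt (real (Suc n)) - sqrt (real n))"
  proof -
    have "1 = (sqrt (real (Suc n)) - sqrt (real n)) * (sqrt (real (Suc n)) + sqrt (real n))"
      by (simp add: algebra_simps flip: power2_eq_square)
    also have "\<dots> \<le> (sqrt (real (Suc n)) - sqrt (real n)) * (2 * sqrt (real (Suc n)))"
      by (intro mult_left_mono) auto
    finally have "1 \<le> 2 * (sqrt (real (Suc n)) - sqrt (real n)) * sqrt (real (Suc n))"
      by (simp only: mult_ac)
    then show ?thesis by (subst pos_divide_le_eq) (auto simp del: of_nat_Suc)
  qed
  with Suc show ?case by simp
qed simp

lemma sum_inverse_sqrt_abs_le:
  assumes "finite J"
  shows "(\<Sum>b\<in>J. if b \<noteq> 0 \<and> \<bar>b\<bar> \<le> int K then 1 / sqrt \<bar>of_int b\<bar> else 0) \<le> 4 * sqrt (real K)"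
proof -
  let ?I = "{b. b \<noteq> 0 \<and> \<bar>b\<bar> \<le> int K}"
  have eq: "?I = int ` {1..K} \<union> (\<lambda>k. - int k) ` {1..K}"
  proof (rule set_eqI)
    fix b :: int
    show "b \<in> ?I \<longleftrightarrow> b \<in> int ` {1..K} \<union> (\<lambda>k. - int k) ` {1..K}"
    proof
      assume "b \<in> ?I"
      then have "b = int (nat b) \<and> nat b \<in> {1..K} \<or> b = - int (nat (- b)) \<and> nat (- b) \<in> {1..K}" by auto
      then show "b \<in> int ` {1..K} \<union> (\<lambda>k. - int k) ` {1..K}" by blast
    qed auto
  qed
  have fin: "finite ?I" unfolding eq by simp
  have "(\<Sum>b\<in>J. if b \<noteq> 0 \<and> \<bar>b\<bar> \<le> int K then 1 / sqrt \<bar>of_int b\<bar> else 0) = (\<Sum>b\<in>J \<inter> ?I. 1 / sqrt \<bar>of_int b\<bar>)"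
    using assms by (subst sum.inter_restrict) auto
  also have "\<dots> \<le> (\<Sum>b\<in>?I. 1 / sqrt \<bar>of_int b\<bar>)"
    by (rule sum_mono2[OF fin]) auto
  also have "\<dots> = (\<Sum>b\<in>int ` {1..K}. 1 / sqrt \<bar>of_int b\<bar>) + (\<Sum>b\<in>(\<lambda>k. - int k) ` {1..K}. 1 / sqrt \<bar>of_int b\<bar>)"
    unfolding eq by (rule sum.union_disjoint) auto
  also have "\<dots> = 2 * (\<Sum>k=1..K. 1 / sqrt (real k))"
    by (simp add: sum.reindex inj_on_def)
  also have "\<dots> \<le> 4 * sqrt (real K)" using sum_inverse_sqrt_le[of K] by simp
  finally show ?thesis .
qed

text \<open>The heart of the contraction. For \<open>\<bar>b\<bar> \<le> K\<close> the pointwise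
  bound \<open>q\<close> on the probabilities meets the sum of
  \<open>1 / sqrt \<bar>b\<bar>\<close>; beyond \<open>K\<close> the total mass 1 meets the small
  weight. As \<open>sqrt K = 100 * sqrt A\<close>, the two parts are 12 / 100 and 1 / 100 of
  \<open>1 / sqrt A\<close>, and \<open>b = 0\<close> with weight \<open>4 / sqrt A\<close> adds at
  most 12 / 10000 of it. The arguments of \<open>weight\<close> are in the order \<open>b a\<close>
  because the coordinates have been exchanged.\<close>

lemma sum_weight_phase_le:
  assumes "a \<noteq> 0" "finite J"
  shows "(\<Sum>b\<in>J. weight b a * (cmod (phase_coeff a (l - b)))\<^sup>2) \<le> 1 / 4 * (1 / sqrt \<bar>of_int a\<bar>)"
proof -
  define A where "A = \<bar>real_of_int a\<bar>"
  define K where "K = nat (10000 * \<bar>a\<bar>)"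
  define p where "p m = (cmod (phase_coeff a m))\<^sup>2" for m
  define q where "q = 3 / (10000 * A)"
  define f where "f b = (if b \<noteq> 0 \<and> \<bar>b\<bar> \<le> int K then 1 / sqrt \<bar>real_of_int b\<bar> else 0)" for b
  have A: "A \<ge> 1" using assms(1) by (simp add: A_def)
  have K: "real K = 10000 * A" by (simp add: K_def A_def)
  have sK: "sqrt (real K) = 100 * sqrt A"
    by (simp add: K real_sqrt_mult)
  have pq: "p m \<le> q" for m unfolding p_def q_def A_def by (rule phase_coeff_le[OF assms(1)])
  have p0: "0 \<le> p m" for m by (simp add: p_def)
  have f0: "0 \<le> f b" for b by (simp add: f_def)
  have w: "weight b a \<le> (if b = 0 then 4 / sqrt A else 0) + f b + 1 / sqrt (real K)" for b
  proof -
    have "1 / sqrt \<bar>real_of_int b\<bar> \<le> 1 / sqrt (real K)" if "\<bar>b\<bar> > int K"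
    proof -
      have "K > 0" using assms by (simp add: K_def)
      moreover have "real K \<le> \<bar>real_of_int b\<bar>" using that by linarith
      ultimately show ?thesis by (intro divide_left_mono) auto
    qed
    then show ?thesis using assms(1) A by (auto simp: weight_def f_def A_def)
  qed
  have sum_p: "(\<Sum>b\<in>J. p (l - b)) \<le> 1"
  proof -
    have "(\<Sum>b\<in>J. p (l - b)) = (\<Sum>m\<in>(\<lambda>b. l - b) ` J. p m)"
      by (subst sum.reindex) (auto simp: inj_on_def)
    also have "\<dots> \<le> 1" unfolding p_def by (rule phase_coeff_sum_le_1) (use assms in auto)
    finally show ?thesis .
  qed
  have "(\<Sum>b\<in>J. weight b a * p (l - b)) \<le>
     (\<Sum>b\<in>J. q * (if b = 0 then 4 / sqrt A else 0) + q * f b + 1 / sqrt (real K) * p (l - b))"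
  proof (rule sum_mono)
    fix b
    have "weight b a * p (l - b) \<le> ((if b = 0 then 4 / sqrt A else 0) + f b + 1 / sqrt (real K)) * p (l - b)"
      by (rule mult_right_mono[OF w p0])
    also have "\<dots> = (if b = 0 then 4 / sqrt A else 0) * p (l - b) + f b * p (l - b) + 1 / sqrt (real K) * p (l - b)"
      by (simp add: algebra_simps)
    also have "\<dots> \<le> (if b = 0 then 4 / sqrt A else 0) * q + f b * q + 1 / sqrt (real K) * p (l - b)"
      using A by (intro add_mono mult_left_mono pq f0) auto
    finally show "weight b a * p (l - b) \<le> q * (if b = 0 then 4 / sqrt A else 0) + q * f b + 1 / sqrt (real K) * p (l - b)"
      by (simp add: mult_ac)
  qed
  also have "\<dots> = q * (\<Sum>b\<in>J. if b = 0 then 4 / sqrt A else 0) + q * (\<Sum>b\<in>J. f b) + 1 / sqrt (real K) * (\<Sum>b\<in>J. p (l - b))"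
    by (simp only: sum.distrib sum_distrib_left)
  also have "\<dots> \<le> q * (4 / sqrt A) + q * (4 * sqrt (real K)) + 1 / sqrt (real K) * 1"
  proof (intro add_mono mult_left_mono)
    show "(\<Sum>b\<in>J. if b = 0 then 4 / sqrt A else 0) \<le> 4 / sqrt A" using A assms(2) by simp
    show "(\<Sum>b\<in>J. f b) \<le> 4 * sqrt (real K)" unfolding f_def by (rule sum_inverse_sqrt_abs_le[OF assms(2)])
  qed (use sum_p A in \<open>auto simp: q_def\<close>)
  also have "\<dots> = (12 / (10000 * A) + 12 / 100 + 1 / 100) / sqrt A"
  proof -
    have "sqrt A / A = 1 / sqrt A" using A real_div_sqrt[of A] by (simp add: field_simps)
    then have "q * (4 * sqrt (real K)) = 12 / 100 / sqrt A" by (simp add: q_def sK field_simps)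
    then show ?thesis by (simp add: sK q_def add_divide_distrib)
  qed
  also have "\<dots> \<le> (1 / 4) / sqrt A"
  proof (rule divide_right_mono)
    have "12 / (10000 * A) \<le> 12 / (10000 * 1)" using A by (intro divide_left_mono mult_left_mono) auto
    then show "12 / (10000 * A) + 12 / 100 + 1 / 100 \<le> 1 / 4" by linarith
  qed (use A in auto)
  finally show ?thesis by (simp add: p_def A_def)
qed

lemma weight_phase_le:
  assumes "a \<noteq> 0"
  shows "(\<integral>\<^sup>+b. ennreal (weight b a) * phase_weight a (l - b) \<partial>count_space UNIV)
     \<le> ennreal (1 / 4) * ennreal (1 / sqrt \<bar>of_int a\<bar>)"
proof (rule nn_integral_count_space_le)
  fix J :: "int set" assume "finite J"
  have "(\<Sum>b\<in>J. ennreal (weight b a) * phase_weight a (l - b)) =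
     ennreal (\<Sum>b\<in>J. weight b a * (cmod (phase_coeff a (l - b)))\<^sup>2)"
    unfolding phase_weight_def
    by (subst sum_ennreal[symmetric]) (auto simp: ennreal_mult weight_nonneg)
  also have "\<dots> \<le> ennreal (1 / 4 * (1 / sqrt \<bar>of_int a\<bar>))"
    by (intro ennreal_leI sum_weight_phase_le assms \<open>finite J\<close>)
  also have "\<dots> = ennreal (1 / 4) * ennreal (1 / sqrt \<bar>of_int a\<bar>)"
    by (rule ennreal_mult) auto
  finally show "(\<Sum>b\<in>J. ennreal (weight b a) * phase_weight a (l - b)) \<le> ennreal (1 / 4) * ennreal (1 / sqrt \<bar>of_int a\<bar>)" .
qed

text \<open>For \<open>a = 0\<close> the coefficients do not change and the gain is the ratio 4
  between the weights before and after the exchange of coordinates. For \<open>a \<noteq> 0\<close>,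
  Tonelli's theorem moves the sum over the target frequency \<open>b\<close> inside, where
  \<open>weight_phase_le\<close> applies at each source frequency \<open>l\<close>.\<close>

lemma expected_row_energy:
  assumes "cell_function r"
  shows "(\<integral>\<^sup>+b. ennreal (weight b a) * (\<integral>\<^sup>+w. mode_energy (sheared w r) a b \<partial>circle) \<partial>count_space UNIV)
     \<le> ennreal (1 / 4) * (\<integral>\<^sup>+b. ennreal (weight a b) * mode_energy r a b \<partial>count_space UNIV)"
proof (cases "a = 0")
  case True
  have "mode_energy (sheared w r) 0 b = mode_energy r 0 b" for w b
    using fc_sheared[OF assms, of w 0 b] fc_iterated(1)[OF assms, of 0 b] by (simp add: mode_energy_def)
  moreover have "ennreal (weight b 0) = ennreal (1 / 4) * ennreal (weight 0 b)" for b
    by (subst ennreal_mult[symmetric]) (auto simp: weight_def)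
  ultimately show ?thesis
    by (simp add: True circle.emeasure_space_1[simplified] mult.assoc nn_integral_cmult)
next
  case False
  let ?W = "\<lambda>b. ennreal (weight b a)" and ?C = "count_space UNIV :: int measure"
  have "(\<integral>\<^sup>+b. ?W b * (\<integral>\<^sup>+w. mode_energy (sheared w r) a b \<partial>circle) \<partial>?C)
      \<le> (\<integral>\<^sup>+b. ?W b * (\<integral>\<^sup>+m. phase_weight a m * mode_energy r a (b + m) \<partial>?C) \<partial>?C)"
    by (intro nn_integral_mono mult_left_mono expected_mode_energy assms) auto
  also have "\<dots> = (\<integral>\<^sup>+b. (\<integral>\<^sup>+l. ?W b * (phase_weight a (l - b) * mode_energy r a l) \<partial>?C) \<partial>?C)"
  proof (rule nn_integral_cong)
    fix b :: int
    have "(\<integral>\<^sup>+m. phase_weight a m * mode_energy r a (b + m) \<partial>?C) =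
       (\<integral>\<^sup>+l. phase_weight a (l - b) * mode_energy r a l \<partial>?C)"
      using nn_integral_count_space_shift[of "\<lambda>l. phase_weight a (l - b) * mode_energy r a l" b] by simp
    then show "?W b * (\<integral>\<^sup>+m. phase_weight a m * mode_energy r a (b + m) \<partial>?C) =
       (\<integral>\<^sup>+l. ?W b * (phase_weight a (l - b) * mode_energy r a l) \<partial>?C)"
      by (simp add: nn_integral_cmult)
  qed
  also have "\<dots> = (\<integral>\<^sup>+l. (\<integral>\<^sup>+b. ?W b * (phase_weight a (l - b) * mode_energy r a l) \<partial>?C) \<partial>?C)"
    by (rule nn_integral_count_space_nn_integral) auto
  also have "\<dots> = (\<integral>\<^sup>+l. (\<integral>\<^sup>+b. ?W b * phase_weight a (l - b) \<partial>?C) * mode_energy r a l \<partial>?C)"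
    by (simp add: nn_integral_multc flip: mult.assoc)
  also have "\<dots> \<le> (\<integral>\<^sup>+l. (ennreal (1 / 4) * ennreal (1 / sqrt \<bar>of_int a\<bar>)) * mode_energy r a l \<partial>?C)"
    by (intro nn_integral_mono mult_right_mono weight_phase_le False) auto
  also have "\<dots> = ennreal (1 / 4) * (\<integral>\<^sup>+b. ennreal (weight a b) * mode_energy r a b \<partial>?C)"
    using False by (simp add: weight_def mult.assoc nn_integral_cmult)
  finally show ?thesis .
qed

lemma energy_iterated:
  "energy r = (\<integral>\<^sup>+a. (\<integral>\<^sup>+b. ennreal (weight a b) * mode_energy r a b \<partial>count_space UNIV) \<partial>count_space UNIV)"
  unfolding energy_def
  using nn_integral_fst_count_space[of "\<lambda>p. ennreal (weight (fst p) (snd p)) * mode_energy r (fst p) (snd p)"] by simp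

lemma expected_energy:
  assumes "cell_function r"
  shows "(\<integral>\<^sup>+w. energy (swapped (sheared w r)) \<partial>circle) \<le> ennreal (1 / 4) * energy r"
proof -
  let ?C = "count_space UNIV :: int measure" and ?CC = "count_space UNIV :: (int \<times> int) measure"
  note [measurable] = fc_sheared_measurable[OF assms]
  let ?E = "\<lambda>w a b. mode_energy (sheared w r) a b"
  have [measurable]: "(\<lambda>w. ?E w a b) \<in> borel_measurable borel" for a b
    unfolding mode_energy_def by measurable
  have en: "energy (swapped (sheared w r)) = (\<integral>\<^sup>+p. ennreal (weight (snd p) (fst p)) * ?E w (fst p) (snd p) \<partial>?CC)" for w
  proof -
    have "energy (swapped (sheared w r)) = (\<integral>\<^sup>+p. ennreal (weight (fst p) (snd p)) * ?E w (snd p) (fst p) \<partial>?CC)"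
      unfolding energy_def mode_energy_def
      by (simp add: fc_swapped cell_function_sheared assms)
    also have "\<dots> = (\<integral>\<^sup>+p. ennreal (weight (snd p) (fst p)) * ?E w (fst p) (snd p) \<partial>?CC)"
      using nn_integral_bij_count_space[of prod.swap UNIV UNIV "\<lambda>p. ennreal (weight (fst p) (snd p)) * ?E w (snd p) (fst p)"]
      by (simp add: bij_swap)
    finally show ?thesis .
  qed
  have "(\<integral>\<^sup>+w. energy (swapped (sheared w r)) \<partial>circle) =
      (\<integral>\<^sup>+p. \<integral>\<^sup>+w. ennreal (weight (snd p) (fst p)) * ?E w (fst p) (snd p) \<partial>circle \<partial>?CC)"
    unfolding en by (rule nn_integral_count_space_nn_integral) auto
  also have "\<dots> = (\<integral>\<^sup>+p. ennreal (weight (snd p) (fst p)) * (\<integral>\<^sup>+w. ?E w (fst p) (snd p) \<partial>circle) \<partial>?CC)"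
    by (intro nn_integral_cong nn_integral_cmult) simp
  also have "\<dots> = (\<integral>\<^sup>+a. \<integral>\<^sup>+b. ennreal (weight b a) * (\<integral>\<^sup>+w. ?E w a b \<partial>circle) \<partial>?C \<partial>?C)"
    using nn_integral_fst_count_space[of "\<lambda>p. ennreal (weight (snd p) (fst p)) * (\<integral>\<^sup>+w. ?E w (fst p) (snd p) \<partial>circle)"]
    by simp
  also have "\<dots> \<le> (\<integral>\<^sup>+a. ennreal (1 / 4) * (\<integral>\<^sup>+b. ennreal (weight a b) * mode_energy r a b \<partial>?C) \<partial>?C)"
    by (intro nn_integral_mono expected_row_energy assms)
  also have "\<dots> = ennreal (1 / 4) * energy r"
    unfolding energy_iterated by (simp add: nn_integral_cmult)
  finally show ?thesis .
qed

text \<open>Some phase does no worse than the mean. Asking only for \<open>D / 2\<close> where the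
  mean is at most \<open>D / 4\<close> makes the contradiction immediate, as
  \<open>D > 0\<close>.\<close>

lemma exists_good_phase:
  assumes "cell_function r" "energy r \<le> ennreal D" "D > 0"
  shows "\<exists>w. energy (swapped (sheared w r)) \<le> ennreal (D / 2)"
proof (rule ccontr)
  assume "\<not> ?thesis"
  then have "ennreal (D / 2) \<le> energy (swapped (sheared w r))" for w
    by (meson linear)
  then have "(\<integral>\<^sup>+w. ennreal (D / 2) \<partial>circle) \<le> (\<integral>\<^sup>+w. energy (swapped (sheared w r)) \<partial>circle)"
    by (intro nn_integral_mono)
  also have "\<dots> \<le> ennreal (1 / 4) * energy r" by (rule expected_energy[OF assms(1)])
  also have "\<dots> \<le> ennreal (1 / 4) * ennreal D" by (intro mult_left_mono assms) auto
  also have "\<dots> = ennreal (D / 4)" using assms by (subst ennreal_mult[symmetric]) auto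
  finally have "ennreal (D / 2) \<le> ennreal (D / 4)" by (simp add: circle.emeasure_space_1[simplified])
  then show False using assms(3) by simp
qed

section \<open>Comparison of the energy with single Fourier coefficients\<close>

lemma sum_fc_le_1:
  assumes "cell_function r" "finite J"
  shows "(\<Sum>p\<in>J. (cmod (fc r (fst p) (snd p)))\<^sup>2) \<le> 1"
proof -
  note [measurable] = cell_function_measurable[OF assms(1)]
  let ?\<phi> = "\<lambda>p z. mode (fst p) (fst z) * mode (snd p) (snd z)"
  have m: "?\<phi> p \<in> borel_measurable circle2" for p
    by (simp add: measurable_cong_sets[OF sets_circle2 refl])
  have orth: "(LINT z|circle2. ?\<phi> p z * cnj (?\<phi> q z)) = (if p = q then 1 else 0)" for p q
  proof -
    have "(LINT z|circle2. ?\<phi> p z * cnj (?\<phi> q z)) =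
       (LINT y|circle. (LINT x|circle. mode (fst p - fst q) x * mode (snd p - snd q) y))"
      by (subst circle2_integral_iterated(1)[where B=1])
         (auto simp: norm_mult cnj_mode mode_mult[symmetric] diff_conv_add_uminus mult_ac simp del: add_uminus_conv_diff)
    then show ?thesis by (auto simp: integral_mode prod_eq_iff)
  qed
  have "(\<Sum>p\<in>J. (cmod (LINT z|circle2. complex_of_real (r z) * cnj (?\<phi> p z)))\<^sup>2) \<le> (LINT z|circle2. (cmod (complex_of_real (r z)))\<^sup>2)"
    by (rule circle2.P.bessel_inequality[where B=1])
       (use assms cell_function_bound[OF assms(1)] orth m in \<open>auto simp: norm_mult measurable_cong_sets[OF sets_circle2 refl]\<close>)
  also have "\<dots> \<le> (LINT z|circle2. 1)"
    using cell_function_bound[OF assms(1)]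
    by (intro integral_mono circle2_integrable_bounded[where B=1])
       (auto simp: abs_square_le_1)
  finally show ?thesis by (simp add: fc_def cnj_mode circle2.P.prob_space)
qed

lemma energy_le_4:
  assumes "cell_function r"
  shows "energy r \<le> 4"
  unfolding energy_def
proof (rule nn_integral_count_space_le)
  fix J :: "(int \<times> int) set" assume J: "finite J"
  have w: "weight a b \<le> 4" for a b
  proof -
    have "1 \<le> sqrt \<bar>real_of_int k\<bar>" if "k \<noteq> 0" for k :: int using that by simp
    from this[of a] this[of b] have "a \<noteq> 0 \<Longrightarrow> 1 \<le> 4 * sqrt \<bar>real_of_int a\<bar>" "b \<noteq> 0 \<Longrightarrow> 4 \<le> 4 * sqrt \<bar>real_of_int b\<bar>"
      by linarith+
    then show ?thesis by (auto simp: weight_def divide_le_eq)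
  qed
  have "(\<Sum>p\<in>J. ennreal (weight (fst p) (snd p)) * mode_energy r (fst p) (snd p)) \<le>
      (\<Sum>p\<in>J. ennreal 4 * ennreal ((cmod (fc r (fst p) (snd p)))\<^sup>2))"
    unfolding mode_energy_def by (intro sum_mono mult_right_mono ennreal_leI w) auto
  also have "\<dots> = ennreal (4 * (\<Sum>p\<in>J. (cmod (fc r (fst p) (snd p)))\<^sup>2))"
    by (subst ennreal_mult) (auto intro!: sum_nonneg simp: sum_distrib_left simp flip: sum_ennreal)
  also have "\<dots> \<le> ennreal (4 * 1)"
    by (intro ennreal_leI mult_left_mono sum_fc_le_1 assms J) auto
  finally show "(\<Sum>p\<in>J. ennreal (weight (fst p) (snd p)) * mode_energy r (fst p) (snd p)) \<le> 4" by simp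
qed

text \<open>One term is bounded by the whole energy, and a nonzero mode of frequency at most
  \<open>N\<close> has weight at least \<open>1 / N\<close>. Replacing a square root by
  \<open>N\<close> is crude but costs only a power.\<close>

lemma fc_le_energy:
  assumes "energy r \<le> ennreal D" "0 \<le> D" "(a, b) \<noteq> (0, 0)" "\<bar>a\<bar> \<le> int N" "\<bar>b\<bar> \<le> int N"
  shows "(cmod (fc r a b))\<^sup>2 \<le> real N * D"
proof -
  have N: "N \<ge> 1" using assms(3-5) by (cases N) auto
  have s: "sqrt \<bar>real_of_int k\<bar> \<le> real N" if "\<bar>k\<bar> \<le> int N" for k
  proof -
    have "\<bar>real_of_int k\<bar> \<le> real N" using that by linarith
    then have "sqrt \<bar>real_of_int k\<bar> \<le> sqrt (real N)" by simp
    also have "\<dots> \<le> real N" using N self_le_power[of "real N" 2] by (intro real_le_lsqrt) auto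
    finally show ?thesis .
  qed
  have w: "1 \<le> real N * weight a b"
    using s[OF assms(4)] s[OF assms(5)] assms(3) by (auto simp: weight_def le_divide_eq)
  have "ennreal (weight a b * (cmod (fc r a b))\<^sup>2) = (\<Sum>p\<in>{(a, b)}. ennreal (weight (fst p) (snd p)) * mode_energy r (fst p) (snd p))"
    by (simp add: mode_energy_def ennreal_mult weight_nonneg)
  also have "\<dots> \<le> energy r" unfolding energy_def by (rule sum_le_nn_integral_count_space) simp
  also note assms(1)
  finally have "weight a b * (cmod (fc r a b))\<^sup>2 \<le> D" using assms(2) by simp
  then have "real N * (weight a b * (cmod (fc r a b))\<^sup>2) \<le> real N * D" by (intro mult_left_mono) auto
  moreover have "1 * (cmod (fc r a b))\<^sup>2 \<le> (real N * weight a b) * (cmod (fc r a b))\<^sup>2"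
    by (intro mult_right_mono w) auto
  ultimately show ?thesis by (simp add: mult_ac)
qed

subsection \<open>Pairing with Lipschitz functions\<close>

lemma norm_circle2_integral_le:
  fixes f :: "real \<times> real \<Rightarrow> 'a::{banach, second_countable_topology}"
  assumes "f \<in> borel_measurable (borel \<Otimes>\<^sub>M borel)" "\<And>x. norm (f x) \<le> B"
  shows "norm (LINT x|circle2. f x) \<le> B"
proof -
  have "norm (LINT x|circle2. f x) \<le> (LINT x|circle2. norm (f x))" by (rule integral_norm_bound)
  also have "\<dots> \<le> (LINT x|circle2. B)"
    using assms circle2_integrable_bounded[OF assms] by (intro integral_mono integrable_norm) auto
  finally show ?thesis by (simp add: circle2.P.prob_space)
qed

lemma circle2_integral_close:
  fixes f g :: "real \<times> real \<Rightarrow> complex"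
  assumes "f \<in> borel_measurable (borel \<Otimes>\<^sub>M borel)" "\<And>x. cmod (f x) \<le> B"
    and "g \<in> borel_measurable (borel \<Otimes>\<^sub>M borel)" "\<And>x. cmod (g x) \<le> C"
    and "\<And>x. cmod (f x - g x) \<le> d"
  shows "cmod (LINT x|circle2. f x) \<le> d + cmod (LINT x|circle2. g x)"
proof -
  have "cmod ((LINT x|circle2. f x) - (LINT x|circle2. g x)) \<le> d"
    using norm_circle2_integral_le[of "\<lambda>x. f x - g x" d] assms
      circle2_integrable_bounded[OF assms(1,2)] circle2_integrable_bounded[OF assms(3,4)]
    by (simp add: Bochner_Integration.integral_diff borel_measurable_diff)
  then show ?thesis by (smt (verit) norm_triangle_ineq2)
qed

text \<open>Two nested Fejer means replace \<open>\<phi>\<close> by a trigonometric polynomial: of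
  order \<open>N\<close> in \<open>x\<close> and, coefficient by coefficient, of order
  \<open>N ^ 4\<close> in \<open>y\<close>. The \<open>2 * N + 1\<close> inner errors add up, so
  each should be of order \<open>1 / N\<^sup>2\<close>, which is the rate
  \<open>1 / sqrt (N ^ 4)\<close>.\<close>

lemma pairing_le:
  fixes r \<phi> :: "real \<times> real \<Rightarrow> real"
  assumes r: "cell_function r" and \<phi>: "cell_function \<phi>"
    and lip1: "\<And>x x' y. \<bar>\<phi> (x, y) - \<phi> (x', y)\<bar> \<le> L * \<bar>x - x'\<bar>"
    and lip2: "\<And>x y y'. \<bar>\<phi> (x, y) - \<phi> (x, y')\<bar> \<le> L * \<bar>y - y'\<bar>"
    and N: "N > 0" and E: "\<And>a b. \<bar>a\<bar> \<le> int (N ^ 4) \<Longrightarrow> \<bar>b\<bar> \<le> int (N ^ 4) \<Longrightarrow> cmod (fc r a b) \<le> E"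
  shows "\<bar>LINT z|circle2. r z * \<phi> z\<bar> \<le> L / sqrt (real N) +
     (2 * real N + 1) * (L / (real N)\<^sup>2 + (2 * real N ^ 4 + 1) * E)"
proof -
  note [measurable] = cell_function_measurable[OF r] cell_function_measurable[OF \<phi>]
  note rb = cell_function_bound[OF r] and \<phi>b = cell_function_bound[OF \<phi>]
  have L: "0 \<le> L" using order_trans[OF _ lip1[of 1 0 0]] by simp
  define M where "M = N ^ 4"
  have "real M = ((real N)\<^sup>2)\<^sup>2" by (simp add: M_def flip: power_mult)
  then have M: "M > 0" "sqrt (real M) = (real N)\<^sup>2"
    using N by (simp add: M_def, simp only: real_sqrt_abs abs_power2)
  have E0: "0 \<le> E" using order_trans[OF norm_ge_zero E[of 0 0]] by simp
  \<comment> \<open>Coefficients in \<open>x\<close> alone. They inherit the bound 1, the period and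
    the Lipschitz constant in \<open>y\<close> from \<open>\<phi>\<close>, so a second Fejer mean
    applies to them.\<close>
  define c where "c m y = (LINT t|circle. complex_of_real (\<phi> (t, y)) * mode m t)" for m y
  have [measurable]: "c m \<in> borel_measurable borel" for m
    unfolding c_def by measurable
  have cb: "cmod (c m y) \<le> 1" for m y
    unfolding c_def by (rule norm_circle_integral_le) (auto simp: norm_mult \<phi>b)
  have c_lip: "cmod (c m y - c m y') \<le> L * \<bar>y - y'\<bar>" for m y y'
  proof -
    have i: "integrable circle (\<lambda>t. complex_of_real (\<phi> (t, y)) * mode m t)" for y
      by (rule circle_integrable_bounded[where B=1]) (auto simp: norm_mult \<phi>b)
    have "c m y - c m y' = (LINT t|circle. complex_of_real (\<phi> (t, y) - \<phi> (t, y')) * mode m t)"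
      unfolding c_def by (simp add: i left_diff_distrib flip: Bochner_Integration.integral_diff)
    also have "cmod \<dots> \<le> L * \<bar>y - y'\<bar>"
      by (rule norm_circle_integral_le) (auto simp: norm_mult lip2 simp flip: of_real_diff)
    finally show ?thesis .
  qed
  have c_per: "int_periodic (c m)" for m
    using cell_function_periodic[OF \<phi>, of _ 0] by (simp add: int_periodic_def c_def)
  define d where "d m m' = (LINT y|circle. c m y * mode m' y)" for m m'
  have db: "cmod (d m m') \<le> 1" for m m'
    unfolding d_def by (rule norm_circle_integral_le) (auto simp: norm_mult cb)
  define A where "A z = (\<Sum>m\<in>{- int N..int N}. complex_of_real (fejer_weight N m) * c m (snd z) * mode (- m) (fst z))" for z
  define B where "B m y = (\<Sum>m'\<in>{- int M..int M}. complex_of_real (fejer_weight M m') * d m m' * mode (- m') y)" for m y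
  have A_close: "cmod (A z - complex_of_real (\<phi> z)) \<le> L / sqrt (real N)" for z
  proof -
    have "cmod (A (x, y) - complex_of_real (\<phi> (x, y))) \<le> L / sqrt (real N)" for x y
      unfolding A_def c_def fst_conv snd_conv
      by (rule fejer_approximation[of "\<lambda>x. complex_of_real (\<phi> (x, y))" 1])
         (use cell_function_periodic[OF \<phi>, of _ _ y 0] N in
           \<open>auto simp: \<phi>b int_periodic_def lip1 simp flip: of_real_diff\<close>)
    then show ?thesis by (cases z) simp
  qed
  have B_close: "cmod (B m y - c m y) \<le> L / (real N)\<^sup>2" for m y
    unfolding B_def d_def M(2)[symmetric]
    by (rule fejer_approximation[of "c m" 1]) (auto simp: cb c_per c_lip M)
  have A_meas [measurable]: "A \<in> borel_measurable (borel \<Otimes>\<^sub>M borel)"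
    unfolding A_def by measurable
  have B_meas [measurable]: "B m \<in> borel_measurable borel" for m
    unfolding B_def by measurable
  have Ab: "cmod (A z) \<le> 1 + L / sqrt (real N)" for z
    using A_close[of z] \<phi>b[of z] norm_triangle_ineq2[of "A z" "complex_of_real (\<phi> z)"] by simp
  have Bb: "cmod (B m y) \<le> 1 + L / (real N)\<^sup>2" for m y
    using B_close[of m y] cb[of m y] norm_triangle_ineq2[of "B m y" "c m y"] by simp
  have mult_b: "cmod (complex_of_real (r z) * w) \<le> b" if "cmod w \<le> b" for z w b
  proof -
    have "\<bar>r z\<bar> * cmod w \<le> 1 * b" using that rb by (intro mult_mono) auto
    then show ?thesis by (simp add: norm_mult)
  qed
  have step1: "\<bar>LINT z|circle2. r z * \<phi> z\<bar> \<le> L / sqrt (real N) + cmod (LINT z|circle2. complex_of_real (r z) * A z)"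
  proof -
    have "cmod (LINT z|circle2. complex_of_real (r z) * complex_of_real (\<phi> z))
       \<le> L / sqrt (real N) + cmod (LINT z|circle2. complex_of_real (r z) * A z)"
    proof (rule circle2_integral_close)
      show "cmod (complex_of_real (r z) * complex_of_real (\<phi> z)) \<le> 1" for z
        by (rule mult_b) (simp add: \<phi>b)
      show "cmod (complex_of_real (r z) * A z) \<le> 1 + L / sqrt (real N)" for z
        by (rule mult_b[OF Ab])
      show "cmod (complex_of_real (r z) * complex_of_real (\<phi> z) - complex_of_real (r z) * A z) \<le> L / sqrt (real N)" for z
        using mult_b[OF A_close[of z, unfolded norm_minus_commute[of "A z"]], of z]
        by (simp add: right_diff_distrib)
    qed measurable
    moreover have "(LINT z|circle2. complex_of_real (r z) * complex_of_real (\<phi> z)) = complex_of_real (LINT z|circle2. r z * \<phi> z)"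
      by (simp flip: of_real_mult)
    ultimately show ?thesis by simp
  qed
  have sum_le: "cmod (\<Sum>m\<in>{- int K..int K}. f m) \<le> (2 * real K + 1) * b" if "\<And>m. \<bar>m\<bar> \<le> int K \<Longrightarrow> cmod (f m) \<le> b" for f K b
  proof -
    have "cmod (\<Sum>m\<in>{- int K..int K}. f m) \<le> (\<Sum>m\<in>{- int K..int K}. b)"
      by (rule sum_norm_le) (use that in auto)
    then show ?thesis by (simp add: add_ac)
  qed
  have w1: "cmod (complex_of_real (fejer_weight K m) * x) \<le> b" if "cmod x \<le> b" for K m x b
  proof -
    have "\<bar>fejer_weight K m\<bar> * cmod x \<le> 1 * b"
      using that by (intro mult_mono) (auto simp: fejer_weight_nonneg fejer_weight_le_1)
    then show ?thesis by (simp add: norm_mult)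
  qed
  have step3: "cmod (LINT z|circle2. complex_of_real (r z) * (B m (snd z) * mode (- m) (fst z))) \<le> (2 * real M + 1) * E" if m: "\<bar>m\<bar> \<le> int N" for m
  proof -
    have NM: "int N \<le> int M" unfolding M_def using N by (simp add: self_le_power)
    have "(LINT z|circle2. complex_of_real (r z) * (B m (snd z) * mode (- m) (fst z))) =
      (LINT z|circle2. (\<Sum>m'\<in>{- int M..int M}. complex_of_real (fejer_weight M m') * d m m' *
        (complex_of_real (r z) * (mode (- m) (fst z) * mode (- m') (snd z)))))"
      by (simp add: B_def sum_distrib_left sum_distrib_right mult_ac)
    also have "\<dots> = (\<Sum>m'\<in>{- int M..int M}. complex_of_real (fejer_weight M m') * (d m m' * fc r m m'))"
      unfolding fc_def
      by (subst Bochner_Integration.integral_sum)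
         (auto intro!: integrable_mult_right circle2_integrable_bounded[where B=1] mult_b simp: norm_mult mult.assoc)
    also have "cmod \<dots> \<le> (2 * real M + 1) * E"
    proof (rule sum_le)
      fix m' :: int assume "\<bar>m'\<bar> \<le> int M"
      then have "cmod (fc r m m') \<le> E" using m NM by (intro E[folded M_def]) linarith+
      then have "cmod (d m m' * fc r m m') \<le> 1 * E"
        unfolding norm_mult by (intro mult_mono db) auto
      then show "cmod (complex_of_real (fejer_weight M m') * (d m m' * fc r m m')) \<le> E"
        using w1 by simp
    qed
    finally show ?thesis .
  qed
  have step2: "cmod (LINT z|circle2. complex_of_real (r z) * (c m (snd z) * mode (- m) (fst z)))
     \<le> L / (real N)\<^sup>2 + (2 * real M + 1) * E" if m: "\<bar>m\<bar> \<le> int N" for m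
  proof -
    have "cmod (LINT z|circle2. complex_of_real (r z) * (c m (snd z) * mode (- m) (fst z)))
     \<le> L / (real N)\<^sup>2 + cmod (LINT z|circle2. complex_of_real (r z) * (B m (snd z) * mode (- m) (fst z)))"
    proof (rule circle2_integral_close)
      show "cmod (complex_of_real (r z) * (c m (snd z) * mode (- m) (fst z))) \<le> 1" for z
        by (rule mult_b) (simp add: norm_mult cb)
      show "cmod (complex_of_real (r z) * (B m (snd z) * mode (- m) (fst z))) \<le> 1 + L / (real N)\<^sup>2" for z
        by (rule mult_b) (simp add: norm_mult Bb)
      have "cmod (complex_of_real (r z) * ((c m (snd z) - B m (snd z)) * mode (- m) (fst z))) \<le> L / (real N)\<^sup>2" for z
        using B_close[of m "snd z"] by (intro mult_b) (simp add: norm_mult norm_minus_commute)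
      then show "cmod (complex_of_real (r z) * (c m (snd z) * mode (- m) (fst z)) -
          complex_of_real (r z) * (B m (snd z) * mode (- m) (fst z))) \<le> L / (real N)\<^sup>2" for z
        by (simp add: algebra_simps)
    qed measurable
    then show ?thesis using step3[OF m] by linarith
  qed
  have "(LINT z|circle2. complex_of_real (r z) * A z) =
     (LINT z|circle2. (\<Sum>m\<in>{- int N..int N}. complex_of_real (fejer_weight N m) *
        (complex_of_real (r z) * (c m (snd z) * mode (- m) (fst z)))))"
    by (simp add: A_def sum_distrib_left mult_ac)
  also have "\<dots> = (\<Sum>m\<in>{- int N..int N}. complex_of_real (fejer_weight N m) *
        (LINT z|circle2. complex_of_real (r z) * (c m (snd z) * mode (- m) (fst z))))"
    by (subst Bochner_Integration.integral_sum)
       (auto intro!: integrable_mult_right circle2_integrable_bounded[where B=1] mult_b simp: norm_mult cb)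
  also have "cmod \<dots> \<le> (2 * real N + 1) * (L / (real N)\<^sup>2 + (2 * real M + 1) * E)"
    by (rule sum_le) (intro w1 step2)
  finally show ?thesis using step1 by (simp add: M_def)
qed

text \<open>With \<open>N = 2 ^ m\<close> the energy is at most \<open>4 / N ^ 16\<close>. Modes up
  to frequency \<open>N ^ 4\<close> lose a factor \<open>N ^ 4\<close>, so coefficients are at most
  \<open>2 / N ^ 6\<close>, which beats the order of \<open>N ^ 5\<close> terms in
  \<open>pairing_le\<close>. The rate \<open>1 / sqrt N\<close> of the outer Fejer mean survives.
  The mode \<open>(0, 0)\<close> has weight 0 and is covered by \<open>mean\<close>.\<close>

lemma pairing_decay:
  fixes r \<phi> :: "real \<times> real \<Rightarrow> real"
  assumes r: "cell_function r" and \<phi>: "cell_function \<phi>"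
    and lip1: "\<And>x x' y. \<bar>\<phi> (x, y) - \<phi> (x', y)\<bar> \<le> L * \<bar>x - x'\<bar>"
    and lip2: "\<And>x y y'. \<bar>\<phi> (x, y) - \<phi> (x, y')\<bar> \<le> L * \<bar>y - y'\<bar>"
    and mean: "fc r 0 0 = 0" and en: "energy r \<le> ennreal (4 / 2 ^ (16 * m))"
  shows "\<bar>LINT z|circle2. r z * \<phi> z\<bar> \<le> 18 * (1 + L) * (1 / sqrt 2) ^ m"
proof -
  define N :: nat where "N = 2 ^ m"
  have L: "0 \<le> L" using order_trans[OF _ lip1[of 1 0 0]] by simp
  have N: "N > 0" "real N \<ge> 1" by (auto simp: N_def)
  define s where "s = (1 / sqrt 2 :: real) ^ m"
  have s: "0 < s" "s \<le> 1" by (auto simp: s_def power_le_one divide_le_eq)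
  have s2: "s\<^sup>2 = 1 / real N"
    by (simp add: s_def N_def power_mult[symmetric] mult.commute[of m 2]) (simp add: power_mult power_divide)
  have Ns: "1 / sqrt (real N) = s"
    by (simp add: s_def N_def real_sqrt_power power_divide)
  have "cmod (fc r a b) \<le> 2 / real N ^ 6" if ab: "\<bar>a\<bar> \<le> int (N ^ 4)" "\<bar>b\<bar> \<le> int (N ^ 4)" for a b
  proof (cases "(a, b) = (0, 0)")
    case False
    have "(cmod (fc r a b))\<^sup>2 \<le> real (N ^ 4) * (4 / 2 ^ (16 * m))"
      by (rule fc_le_energy[OF en _ False ab]) simp
    also have "(2 :: real) ^ (16 * m) = real N ^ 16"
      by (simp add: N_def power_mult[symmetric] mult.commute)
    also have "real (N ^ 4) * (4 / real N ^ 16) = (2 / real N ^ 6)\<^sup>2"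
      using N by (simp add: power_divide field_simps flip: power_add power_mult)
    finally show ?thesis by (rule power2_le_imp_le) simp
  qed (use mean in simp)
  from pairing_le[OF r \<phi> lip1 lip2 N(1) this]
  have "\<bar>LINT z|circle2. r z * \<phi> z\<bar> \<le> L / sqrt (real N) +
     (2 * real N + 1) * (L / (real N)\<^sup>2 + (2 * real N ^ 4 + 1) * (2 / real N ^ 6))" by simp
  also have "\<dots> \<le> L / sqrt (real N) + (3 * real N) * (L / (real N)\<^sup>2 + (3 * real N ^ 4) * (2 / real N ^ 6))"
    using N L by (intro add_mono mult_mono mult_nonneg_nonneg add_nonneg_nonneg) (auto simp: one_le_power)
  also have "\<dots> = L * s + 3 * L / real N + 18 / real N"
  proof -
    have "real N ^ 6 = real N ^ 4 * (real N * real N)" by (simp add: eval_nat_numeral)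
    then show ?thesis using N by (simp add: power2_eq_square field_simps flip: Ns)
  qed
  also have "\<dots> = L * s + (3 * L + 18) * s\<^sup>2" by (simp add: s2 add_divide_distrib)
  also have "\<dots> \<le> L * s + (3 * L + 18) * s"
    using s L by (intro add_left_mono mult_left_mono) (auto simp: power2_eq_square mult_le_cancel_left1)
  also have "\<dots> \<le> 18 * (1 + L) * s"
    using s L by (simp add: algebra_simps)
  finally show ?thesis by (simp add: s_def)
qed

section \<open>The torus\<close>

lemma index2_neq [simp]: "i + 1 \<noteq> (i :: 2)" "i \<noteq> i + 1"
  by simp_all

lemma index2_cases: "k = i \<or> k = i + (1 :: 2)"
  using exhaust_2[of i] exhaust_2[of k] by auto

lemma index2_UNIV: "(UNIV :: 2 set) = {i, i + 1}"
  using index2_cases[of _ i] by auto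

lemma index2_twice [simp]: "i + 1 + 1 = (i :: 2)"
  using exhaust_2[of i] by auto

text \<open>Indices of type \<open>2\<close> add modulo 2, so \<open>i + 1\<close> is the other
  axis. Listing coordinate \<open>i\<close> first turns a shear along either axis into one along the
  first axis.\<close>

definition pt :: "2 \<Rightarrow> real \<times> real \<Rightarrow> real ^ 2" where
  "pt i z = (\<chi> k. if k = i then fst z else snd z)"

lemma pt_nth [simp]: "pt i z $ i = fst z" "pt i z $ (i + 1) = snd z"
  by (simp_all add: pt_def)

lemma vec2_eq_iff: "x = (y :: 'a ^ 2) \<longleftrightarrow> x $ i = y $ i \<and> x $ (i + 1) = y $ (i + 1)"
proof -
  have "(\<forall>k. x $ k = y $ k) \<longleftrightarrow> (\<forall>k\<in>{i, i + 1}. x $ k = y $ k)"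
    unfolding index2_UNIV[of i, symmetric] by blast
  then show ?thesis unfolding vec_eq_iff by blast
qed

lemma pt_swap: "pt (i + 1) (x, y) = pt i (y, x)"
  using pt_nth[of "i + 1" "(x, y)"] by (simp add: vec2_eq_iff[of _ _ i])

lemma pt_measurable [measurable]: "pt i \<in> borel_measurable (borel \<Otimes>\<^sub>M borel)"
proof -
  have "pt i = (\<lambda>z. fst z *\<^sub>R axis i 1 + snd z *\<^sub>R axis (i + 1) 1)"
    by (rule ext) (simp add: vec2_eq_iff[of _ _ i], simp add: axis_def)
  then show ?thesis by simp
qed

lemma vec_nth_measurable [measurable]: "(\<lambda>x :: real ^ 2. x $ i) \<in> borel_measurable borel"
  by (intro borel_measurable_continuous_onI continuous_intros)

text \<open>Lebesgue measure is determined by its values on open boxes, whose preimages are products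
  of two intervals.\<close>

lemma distr_pt_lborel: "distr (lborel \<Otimes>\<^sub>M lborel) borel (pt i) = lborel"
proof (rule lborel_eqI[symmetric])
  fix l u :: "real ^ 2"
  assume le: "\<And>b. b \<in> Basis \<Longrightarrow> l \<bullet> b \<le> u \<bullet> b"
  have le': "l $ k \<le> u $ k" for k
    using le[of "axis k 1"] by (simp add: inner_axis axis_in_Basis_iff)
  have "pt i -` box l u = {l $ i<..<u $ i} \<times> {l $ (i + 1)<..<u $ (i + 1)}"
  proof (rule set_eqI)
    fix z
    have "z \<in> pt i -` box l u \<longleftrightarrow> (\<forall>k\<in>{i, i + 1}. l $ k < pt i z $ k \<and> pt i z $ k < u $ k)"
      by (simp add: mem_box_cart index2_UNIV[of i, symmetric])
    also have "\<dots> \<longleftrightarrow> z \<in> {l $ i<..<u $ i} \<times> {l $ (i + 1)<..<u $ (i + 1)}"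
      by (cases z) auto
    finally show "z \<in> pt i -` box l u \<longleftrightarrow> z \<in> {l $ i<..<u $ i} \<times> {l $ (i + 1)<..<u $ (i + 1)}" .
  qed
  then have "emeasure (distr (lborel \<Otimes>\<^sub>M lborel) borel (pt i)) (box l u) =
      emeasure lborel {l $ i<..<u $ i} * emeasure lborel {l $ (i + 1)<..<u $ (i + 1)}"
    by (subst emeasure_distr)
       (simp_all add: space_pair_measure lborel.emeasure_pair_measure_Times measurable_cong_sets[OF sets_pair_measure_cong[OF sets_lborel sets_lborel] refl])
  also have "\<dots> = ennreal ((u - l) $ i * (u - l) $ (i + 1))"
    using le' by (simp add: ennreal_mult)
  also have "(u - l) $ i * (u - l) $ (i + 1) = (\<Prod>k\<in>UNIV. (u - l) $ k)"
    by (simp add: index2_UNIV[of i])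
  also have "\<dots> = (\<Prod>b\<in>Basis. (u - l) \<bullet> b)"
  proof -
    have B: "(Basis :: (real ^ 2) set) = (\<lambda>k. axis k 1) ` UNIV" by (auto simp: Basis_vec_def)
    show ?thesis unfolding B
      by (subst prod.reindex) (auto simp: inj_on_def axis_eq_axis inner_axis)
  qed
  finally show "emeasure (distr (lborel \<Otimes>\<^sub>M lborel) borel (pt i)) (box l u) = ennreal (\<Prod>b\<in>Basis. (u - l) \<bullet> b)" .
qed simp

lemma unit_cell_borel [measurable]: "unit_cell \<in> sets borel"
proof -
  have "unit_cell = {x :: real ^ 2. 0 \<le> x $ 1 \<and> x $ 1 < 1 \<and> 0 \<le> x $ 2 \<and> x $ 2 < 1}"
    by (auto simp: unit_cell_def forall_2)
  moreover have "{x :: real ^ 2 \<in> space borel. 0 \<le> x $ 1 \<and> x $ 1 < 1 \<and> 0 \<le> x $ 2 \<and> x $ 2 < 1} \<in> sets borel"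
    by measurable
  ultimately show ?thesis by simp
qed

lemma pt_in_unit_cell: "pt i z \<in> unit_cell \<longleftrightarrow> fst z \<in> {0..<1} \<and> snd z \<in> {0..<1}"
proof -
  have "pt i z \<in> unit_cell \<longleftrightarrow> (\<forall>k\<in>{i, i + 1}. 0 \<le> pt i z $ k \<and> pt i z $ k < 1)"
    by (simp add: unit_cell_def index2_UNIV[of i, symmetric])
  then show ?thesis by auto
qed

text \<open>The Borel version of \<open>torus_measure\<close>, extended by zero to the plane.\<close>

definition torus :: "(real ^ 2) measure" where
  "torus = density lborel (indicator unit_cell)"

lemma sets_torus [simp, measurable_cong]: "sets torus = sets borel"
  by (simp add: torus_def)

lemma space_torus [simp]: "space torus = UNIV"
  by (simp add: torus_def)

lemma pt_measurable_circle2 [measurable]: "pt i \<in> borel_measurable circle2"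
  by (simp add: measurable_cong_sets[OF sets_circle2 refl])

lemma distr_pt_circle2: "distr circle2 borel (pt i) = torus"
proof -
  have "circle2 = density (lborel \<Otimes>\<^sub>M lborel) (\<lambda>(x, y). indicator {0..<1} x * indicator {0..<1} y)"
    unfolding circle_def
    by (rule pair_measure_density)
       (use circle.sigma_finite_measure_axioms in \<open>auto simp: circle_def lborel.sigma_finite_measure_axioms\<close>)
  also have "\<dots> = density (lborel \<Otimes>\<^sub>M lborel) (\<lambda>z. indicator unit_cell (pt i z))"
    by (intro arg_cong2[where f=density] refl ext)
       (auto simp: indicator_def pt_in_unit_cell)
  finally have c: "circle2 = density (lborel \<Otimes>\<^sub>M lborel) (\<lambda>z. indicator unit_cell (pt i z))" .
  have "torus = density (distr (lborel \<Otimes>\<^sub>M lborel) borel (pt i)) (indicator unit_cell)"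
    by (simp add: torus_def distr_pt_lborel)
  also have "\<dots> = distr circle2 borel (pt i)"
    unfolding c
    by (rule density_distr)
       (simp_all add: measurable_cong_sets[OF sets_pair_measure_cong[OF sets_lborel sets_lborel] refl])
  finally show ?thesis ..
qed

interpretation torus: prob_space torus
  using circle2.P.prob_space_distr[OF pt_measurable_circle2] by (simp add: distr_pt_circle2)

section \<open>Integration over the torus and its invariance under shears and translations\<close>

lemma torus_integral_pt:
  fixes f :: "real ^ 2 \<Rightarrow> 'a::{banach, second_countable_topology}"
  assumes "f \<in> borel_measurable borel"
  shows "(LINT x|torus. f x) = (LINT z|circle2. f (pt i z))"
  unfolding distr_pt_circle2[of i, symmetric]
  by (rule integral_distr) (use assms in auto)

lemma torus_measure_integral:
  fixes f :: "real ^ 2 \<Rightarrow> 'a::{banach, second_countable_topology}"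
  assumes [measurable]: "f \<in> borel_measurable borel"
  shows "(LINT x|torus_measure. f x) = (LINT x|torus. f x)"
proof -
  have "(LINT x|torus_measure. f x) = (LINT x|lebesgue. indicator unit_cell x *\<^sub>R f x)"
    by (rule integral_restrict_space) simp
  also have "\<dots> = (LINT x|lborel. indicator unit_cell x *\<^sub>R f x)"
    by (rule integral_completion) simp
  also have "\<dots> = (LINT x|torus. f x)"
    unfolding torus_def
    using integral_density[of f lborel "indicator unit_cell"] by (simp add: ennreal_indicator)
  finally show ?thesis .
qed

lemma torus_integrable_bounded:
  fixes f :: "real ^ 2 \<Rightarrow> 'a::{banach, second_countable_topology}"
  assumes "f \<in> borel_measurable borel" "\<And>x. norm (f x) \<le> B"
  shows "integrable torus f"
  by (rule torus.integrable_const_bound[where B=B]) (use assms in auto)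

lemma norm_torus_integral_le:
  fixes f :: "real ^ 2 \<Rightarrow> 'a::{banach, second_countable_topology}"
  assumes "f \<in> borel_measurable borel" "\<And>x. norm (f x) \<le> B"
  shows "norm (LINT x|torus. f x) \<le> B"
proof -
  have "norm (LINT x|torus. f x) \<le> (LINT x|torus. norm (f x))" by (rule integral_norm_bound)
  also have "\<dots> \<le> (LINT x|torus. B)"
    using assms torus_integrable_bounded[OF assms] by (intro integral_mono integrable_norm) auto
  finally show ?thesis using torus.prob_space by simp
qed

definition torus_function :: "(real ^ 2 \<Rightarrow> real) \<Rightarrow> bool" where
  "torus_function f \<longleftrightarrow> f \<in> borel_measurable borel \<and> (\<forall>x. \<bar>f x\<bar> \<le> 1) \<and> periodic f"

lemma torus_functionD:
  "torus_function f \<Longrightarrow> f \<in> borel_measurable borel" "torus_function f \<Longrightarrow> \<bar>f x\<bar> \<le> 1"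
  "torus_function f \<Longrightarrow> periodic f"
  by (auto simp: torus_function_def)

lemma pt_add_int: "pt i (x + of_int m, y + of_int n) = pt i (x, y) + lattice_point (\<chi> k. if k = i then m else n)"
  by (simp add: vec2_eq_iff[of _ _ i] lattice_point_def)

lemma periodic_pt: "periodic f \<Longrightarrow> f (pt i (x + of_int m, y + of_int n)) = f (pt i (x, y))"
  by (simp add: pt_add_int periodic_def)

lemma cell_function_pt:
  assumes "torus_function f"
  shows "cell_function (\<lambda>z. f (pt i z))"
proof -
  note [measurable] = torus_functionD(1)[OF assms]
  have "(\<lambda>z. f (pt i z)) \<in> borel_measurable (borel \<Otimes>\<^sub>M borel)" by measurable
  then show ?thesis
    using torus_functionD(2,3)[OF assms] by (auto simp: cell_function_def periodic_pt)
qed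

text \<open>Fubini in the coordinates \<open>pt i\<close>: for a fixed transverse coordinate the
  shear is a rotation of the circle.\<close>

lemma torus_integral_shear:
  fixes f :: "real ^ 2 \<Rightarrow> 'a::{banach, second_countable_topology}"
  assumes [measurable]: "f \<in> borel_measurable borel" "g \<in> borel_measurable borel"
    and "periodic f" and B: "\<And>x. norm (f x) \<le> B"
  shows "(LINT x|torus. f (x + g (x $ (i + 1)) *\<^sub>R axis i 1)) = (LINT x|torus. f x)"
proof -
  have pt: "pt i (x, y) + g (pt i (x, y) $ (i + 1)) *\<^sub>R axis i 1 = pt i (x + g y, y)" for x y
    by (simp add: vec2_eq_iff[of _ _ i]) (simp add: axis_def)
  have "(LINT x|torus. f (x + g (x $ (i + 1)) *\<^sub>R axis i 1)) =
      (LINT z|circle2. f (pt i z + g (pt i z $ (i + 1)) *\<^sub>R axis i 1))"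
    by (rule torus_integral_pt) simp
  also have "\<dots> = (LINT y|circle. LINT x|circle. f (pt i (x + g y, y)))"
    by (subst circle2_integral_iterated(1)[where B=B]) (use B in \<open>simp_all only: pt\<close>, measurable)
  also have "\<dots> = (LINT y|circle. LINT x|circle. f (pt i (x, y)))"
  proof (rule Bochner_Integration.integral_cong)
    fix y
    show "(LINT x|circle. f (pt i (x + g y, y))) = (LINT x|circle. f (pt i (x, y)))"
      by (rule circle_integral_shift[of "\<lambda>x. f (pt i (x, y))"])
         (use periodic_pt[OF assms(3), of i _ _ y 0] in \<open>auto simp: int_periodic_def\<close>)
  qed simp
  also have "\<dots> = (LINT z|circle2. f (pt i z))"
    by (rule circle2_integral_iterated(1)[symmetric, where B=B]) (use B in auto)
  also have "\<dots> = (LINT x|torus. f x)" by (rule torus_integral_pt[symmetric]) simp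
  finally show ?thesis .
qed

text \<open>A translation is the composition of two shears with constant displacement.\<close>

lemma torus_integral_translate:
  fixes f :: "real ^ 2 \<Rightarrow> 'a::{banach, second_countable_topology}"
  assumes [measurable]: "f \<in> borel_measurable borel" and "periodic f" and B: "\<And>x. norm (f x) \<le> B"
  shows "(LINT x|torus. f (x + v)) = (LINT x|torus. f x)"
proof -
  have v: "x + v = (x + v $ 1 *\<^sub>R axis 1 1) + v $ 2 *\<^sub>R axis 2 1" for x :: "real ^ 2"
    by (simp add: vec_eq_iff forall_2 axis_def)
  have p: "periodic (\<lambda>x. f (x + w))" for w
    unfolding periodic_def
  proof (intro allI)
    fix x k
    have "x + lattice_point k + w = x + w + lattice_point k" by (simp add: add_ac)
    then show "f (x + lattice_point k + w) = f (x + w)" using assms(2) unfolding periodic_def by metis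
  qed
  have "(LINT x|torus. f (x + v)) = (LINT x|torus. f (x + v $ 2 *\<^sub>R axis 2 1))"
    unfolding v
    using torus_integral_shear[of "\<lambda>x. f (x + v $ 2 *\<^sub>R axis 2 1)" "\<lambda>_. v $ 1" B 1] p B by simp
  also have "\<dots> = (LINT x|torus. f x)"
    using torus_integral_shear[of f "\<lambda>_. v $ 2" B 2] assms by simp
  finally show ?thesis .
qed

subsection \<open>Shear flows\<close>

text \<open>The flow map, for time \<open>\<tau>\<close>, of the steady shear with phase
  \<open>w\<close>. It is explicit because the transverse coordinate stays constant along
  trajectories.\<close>

definition shear :: "2 \<Rightarrow> real \<Rightarrow> real \<Rightarrow> real ^ 2 \<Rightarrow> real ^ 2" where
  "shear i w \<tau> x = x + (\<tau> * profile (x $ (i + 1) + w)) *\<^sub>R axis i 1"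

lemma shear_nth [simp]: "shear i w \<tau> x $ i = x $ i + \<tau> * profile (x $ (i + 1) + w)"
  "shear i w \<tau> x $ (i + 1) = x $ (i + 1)"
  by (simp_all add: shear_def axis_def)

lemma shear_shear: "shear i w \<sigma> (shear i w \<tau> x) = shear i w (\<sigma> + \<tau>) x"
  by (simp add: vec2_eq_iff[of _ _ i] distrib_right)

lemma shear_0 [simp]: "shear i w 0 x = x"
  by (simp add: shear_def)

lemma shear_pt: "shear i w \<tau> (pt i (x, y)) = pt i (x + \<tau> * profile (y + w), y)"
  by (simp add: vec2_eq_iff[of _ _ i])

lemma shear_add_lattice_point: "shear i w \<tau> (x + lattice_point k) = shear i w \<tau> x + lattice_point k"
proof -
  have "profile (x $ (i + 1) + of_int (k $ (i + 1)) + w) = profile (x $ (i + 1) + w)"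
    using int_periodicD[OF int_periodic_profile, of "x $ (i + 1) + w" "k $ (i + 1)"] by (simp add: add_ac)
  then show ?thesis by (simp add: vec2_eq_iff[of _ _ i] lattice_point_def)
qed

lemma shear_measurable [measurable]:
  assumes [measurable]: "f \<in> borel_measurable M" "g \<in> borel_measurable M"
  shows "(\<lambda>x. shear i w (f x) (g x)) \<in> borel_measurable M"
  unfolding shear_def by measurable

text \<open>The constant adds 1 for the identity to the Lipschitz constant 10000 of the profile,
  scaled by \<open>\<bar>\<tau>\<bar> \<le> 1\<close>.\<close>

lemma norm_shear_diff_le:
  assumes "\<bar>\<tau>\<bar> \<le> 1"
  shows "norm (shear i w \<tau> x - shear i w \<tau> y) \<le> 10001 * norm (x - y)"
proof -
  define d where "d = \<tau> * (profile (x $ (i + 1) + w) - profile (y $ (i + 1) + w))"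
  have "\<bar>d\<bar> \<le> 1 * (10000 * \<bar>x $ (i + 1) - y $ (i + 1)\<bar>)"
    unfolding d_def abs_mult using profile_lipschitz[of "x $ (i + 1) + w" "y $ (i + 1) + w"] assms
    by (intro mult_mono) auto
  also have "\<dots> \<le> 10000 * norm (x - y)"
    using component_le_norm_cart[of "x - y" "i + 1"] by simp
  finally have d: "\<bar>d\<bar> \<le> 10000 * norm (x - y)" .
  have "shear i w \<tau> x - shear i w \<tau> y = (x - y) + d *\<^sub>R axis i 1"
    by (simp add: shear_def d_def algebra_simps)
  then have "norm (shear i w \<tau> x - shear i w \<tau> y) \<le> norm (x - y) + \<bar>d\<bar>"
    using norm_triangle_ineq[of "x - y" "d *\<^sub>R axis i 1"] by simp
  with d show ?thesis by simp
qed

lemma torus_function_shear: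
  assumes "torus_function f"
  shows "torus_function (\<lambda>x. f (shear i w \<tau> x))"
  using assms by (auto simp: torus_function_def periodic_def shear_add_lattice_point)

text \<open>Change of variables under a measure-preserving map whose inverse runs the flow
  backwards. It moves the transport from a merely measurable density to the test function.\<close>

lemma torus_integral_shear_move:
  assumes f: "torus_function f" and [measurable]: "\<phi> \<in> borel_measurable borel"
    and "periodic \<phi>" and B: "\<And>x. \<bar>\<phi> x\<bar> \<le> B"
  shows "(LINT x|torus. f (shear i w (- \<tau>) x) * \<phi> x) = (LINT x|torus. f x * \<phi> (shear i w \<tau> x))"
proof -
  note [measurable] = torus_functionD(1)[OF f]
  define h where "h x = f (shear i w (- \<tau>) x) * \<phi> x" for x
  have "(LINT x|torus. h (x + (\<tau> * profile (x $ (i + 1) + w)) *\<^sub>R axis i 1)) = (LINT x|torus. h x)"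
  proof (rule torus_integral_shear[of h "\<lambda>y. \<tau> * profile (y + w)" "1 * B"])
    show "h \<in> borel_measurable borel" unfolding h_def by measurable
    show "periodic h"
      using assms(3) torus_functionD(3)[OF f] by (simp add: h_def periodic_def shear_add_lattice_point)
    show "norm (h x) \<le> 1 * B" for x
      unfolding h_def real_norm_def abs_mult using torus_functionD(2)[OF f] B by (intro mult_mono) auto
  qed measurable
  moreover have "h (x + (\<tau> * profile (x $ (i + 1) + w)) *\<^sub>R axis i 1) = f x * \<phi> (shear i w \<tau> x)" for x
    unfolding shear_def[symmetric] h_def by (simp add: shear_shear)
  ultimately show ?thesis by (simp add: h_def)
qed

section \<open>Mixing scales from decay against Lipschitz functions\<close>

lemma inner_lattice_point: "lattice_point k \<bullet> lattice_point m \<in> \<int>"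
  by (simp add: lattice_point_def inner_vec_def sum_2)

lemma cis_lattice_periodic: "periodic (\<lambda>x. cis (2 * pi * (lattice_point k \<bullet> x)))"
proof -
  have "cis (2 * pi * (lattice_point k \<bullet> (x + lattice_point m))) = cis (2 * pi * (lattice_point k \<bullet> x))" for x m
  proof -
    obtain n where "lattice_point k \<bullet> lattice_point m = of_int n"
      using inner_lattice_point Ints_cases by metis
    then show ?thesis
      using cis_multiple_2pi[of "of_int n"]
      by (simp add: inner_add_right distrib_left cis_mult[symmetric])
  qed
  then show ?thesis by (simp add: periodic_def)
qed

lemma lattice_point_eq_0: "lattice_point k = 0 \<longleftrightarrow> k = 0"
  by (simp add: lattice_point_def vec_eq_iff)

lemma lattice_point_0 [simp]: "lattice_point 0 = 0"
  by (simp add: lattice_point_eq_0)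

lemma norm_lattice_point_ge:
  "real_of_int \<bar>k $ i\<bar> \<le> norm (lattice_point k)"
  using component_le_norm_cart[of "lattice_point k" i] by (simp add: lattice_point_def)

lemma norm_lattice_point_ge_1:
  assumes "k \<noteq> 0"
  shows "1 \<le> norm (lattice_point k)"
proof -
  obtain i where "k $ i \<noteq> 0" using assms by (auto simp: vec_eq_iff)
  then have "1 \<le> real_of_int \<bar>k $ i\<bar>" by linarith
  then show ?thesis using norm_lattice_point_ge[of k i] by linarith
qed

lemma borel_measurable_cis [measurable (raw)]:
  "f \<in> borel_measurable M \<Longrightarrow> (\<lambda>x. cis (f x)) \<in> borel_measurable M"
  by (rule measurable_compose[OF _ borel_measurable_continuous_onI])
     (auto intro: continuous_intros)

text \<open>As on the circle, translation by half a period along an axis with nonzero frequency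
  flips the sign.\<close>

lemma torus_integral_cis:
  assumes "k \<noteq> 0"
  shows "(LINT x|torus. cis (2 * pi * (lattice_point k \<bullet> x))) = 0"
proof -
  obtain i where i: "k $ i \<noteq> 0" using assms by (auto simp: vec_eq_iff)
  define v :: "real ^ 2" where "v = axis i (1 / (2 * of_int (k $ i)))"
  have "2 * pi * (lattice_point k \<bullet> v) = pi"
    using i by (simp add: v_def inner_axis lattice_point_def)
  then have "2 * pi * (lattice_point k \<bullet> (x + v)) = 2 * pi * (lattice_point k \<bullet> x) + pi" for x
    by (simp only: inner_add_right distrib_left)
  then have "cis (2 * pi * (lattice_point k \<bullet> (x + v))) = cis (2 * pi * (lattice_point k \<bullet> x)) * cis pi" for x
    by (metis cis_mult)
  then have "cis (2 * pi * (lattice_point k \<bullet> (x + v))) = - cis (2 * pi * (lattice_point k \<bullet> x))" for x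
    by simp
  moreover have "(LINT x|torus. cis (2 * pi * (lattice_point k \<bullet> (x + v)))) = (LINT x|torus. cis (2 * pi * (lattice_point k \<bullet> x)))"
    by (rule torus_integral_translate[where B=1]) (auto intro: cis_lattice_periodic)
  ultimately have "(LINT x|torus. cis (2 * pi * (lattice_point k \<bullet> x))) = - (LINT x|torus. cis (2 * pi * (lattice_point k \<bullet> x)))"
    by (simp only: Bochner_Integration.integral_minus)
  then show ?thesis by (simp add: eq_neg_iff_add_eq_0 flip: mult_2)
qed

lemma fourier_coeff_torus:
  assumes "torus_function f"
  shows "fourier_coeff f k = (LINT x|torus. complex_of_real (f x) * cnj (cis (2 * pi * (lattice_point k \<bullet> x))))"
proof -
  note [measurable] = torus_functionD(1)[OF assms]
  show ?thesis unfolding fourier_coeff_def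
    by (subst torus_measure_integral) (auto simp: cis_cnj)
qed

lemma sum_fourier_coeff_le_1:
  assumes "torus_function f" "finite F"
  shows "(\<Sum>k\<in>F. (cmod (fourier_coeff f k))\<^sup>2) \<le> 1"
proof -
  note [measurable] = torus_functionD(1)[OF assms(1)]
  let ?\<phi> = "\<lambda>k x. cis (2 * pi * (lattice_point k \<bullet> x))"
  have "(LINT x|torus. ?\<phi> k x * cnj (?\<phi> l x)) = (if k = l then 1 else 0)" for k l
  proof -
    have "lattice_point (k - l) = lattice_point k - lattice_point l"
      by (simp add: lattice_point_def vec_eq_iff)
    then have "?\<phi> k x * cnj (?\<phi> l x) = ?\<phi> (k - l) x" for x
      by (simp add: cis_cnj cis_mult inner_diff_left right_diff_distrib)
    then show ?thesis
      using torus_integral_cis[of "k - l"] torus.prob_space by (simp add: lattice_point_eq_0)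
  qed
  then have "(\<Sum>k\<in>F. (cmod (LINT x|torus. complex_of_real (f x) * cnj (?\<phi> k x)))\<^sup>2)
     \<le> (LINT x|torus. (cmod (complex_of_real (f x)))\<^sup>2)"
    by (intro torus.bessel_inequality[where B=1]) (use assms torus_functionD(2)[OF assms(1)] in auto)
  also have "\<dots> \<le> (LINT x|torus. 1)"
    using torus_functionD(2)[OF assms(1)]
    by (intro integral_mono torus_integrable_bounded[where B=1]) (auto simp: abs_square_le_1)
  finally show ?thesis using torus.prob_space by (simp add: fourier_coeff_torus[OF assms(1)])
qed

text \<open>A bound in the dual of the bounded Lipschitz functions: test functions are normalized to
  have modulus at most 1, and \<open>1 + L\<close> plays the role of their norm.\<close>

definition lipschitz_decay :: "(real ^ 2 \<Rightarrow> real) \<Rightarrow> real \<Rightarrow> bool" where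
  "lipschitz_decay f \<delta> \<longleftrightarrow> (\<forall>\<phi> L. torus_function \<phi> \<and> (\<forall>x y. \<bar>\<phi> x - \<phi> y\<bar> \<le> L * norm (x - y)) \<longrightarrow>
     \<bar>LINT x|torus. f x * \<phi> x\<bar> \<le> (1 + L) * \<delta>)"

lemma lipschitz_decayD:
  "lipschitz_decay f \<delta> \<Longrightarrow> torus_function \<phi> \<Longrightarrow> (\<And>x y. \<bar>\<phi> x - \<phi> y\<bar> \<le> L * norm (x - y)) \<Longrightarrow>
     \<bar>LINT x|torus. f x * \<phi> x\<bar> \<le> (1 + L) * \<delta>"
  by (auto simp: lipschitz_decay_def)

text \<open>Real and imaginary parts of the exponential are admissible tests with Lipschitz constant
  \<open>R\<close>. As \<open>R \<ge> 6\<close>, \<open>2 * (1 + R) \<le> 3 * R\<close>, and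
  dividing by the square of \<open>R\<close> makes the bound uniform in \<open>k\<close>.\<close>

lemma fourier_coeff_decay:
  assumes f: "torus_function f" and dec: "lipschitz_decay f \<delta>" and "0 \<le> \<delta>" "k \<noteq> 0"
  shows "(cmod (fourier_coeff f k))\<^sup>2 / (2 * pi * norm (lattice_point k))\<^sup>2 \<le> 9 * \<delta>\<^sup>2"
proof -
  note [measurable] = torus_functionD(1)[OF f]
  define R where "R = 2 * pi * norm (lattice_point k)"
  have "6 * 1 \<le> R"
    unfolding R_def using pi_gt3 norm_lattice_point_ge_1[OF assms(4)] by (intro mult_mono) auto
  then have R: "6 \<le> R" by simp
  let ?c = "\<lambda>x. cis (2 * pi * (lattice_point k \<bullet> x))"
  have lip: "cmod (?c x - ?c y) \<le> R * norm (x - y)" for x y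
  proof -
    have "cmod (?c x - ?c y) \<le> \<bar>2 * pi * (lattice_point k \<bullet> x) - 2 * pi * (lattice_point k \<bullet> y)\<bar>"
      by (rule norm_cis_diff_le)
    also have "\<dots> = 2 * pi * \<bar>lattice_point k \<bullet> (x - y)\<bar>"
      by (simp add: inner_diff_right abs_mult flip: right_diff_distrib)
    also have "\<dots> \<le> 2 * pi * (norm (lattice_point k) * norm (x - y))"
      by (intro mult_left_mono Cauchy_Schwarz_ineq2) auto
    finally show ?thesis by (simp add: R_def)
  qed
  have tfRe: "torus_function (\<lambda>x. Re (?c x))" and tfIm: "torus_function (\<lambda>x. Im (?c x))"
    using cis_lattice_periodic[of k] abs_cos_le_one abs_sin_le_one
    by (auto simp: torus_function_def periodic_def complex_eq_iff simp del: cis.sel)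
       (auto simp: cis.sel)
  have 1: "\<bar>LINT x|torus. f x * Re (?c x)\<bar> \<le> (1 + R) * \<delta>"
    by (rule lipschitz_decayD[OF dec tfRe])
       (metis abs_Re_le_cmod lip minus_complex.sel(1) order_trans)
  have 2: "\<bar>LINT x|torus. f x * Im (?c x)\<bar> \<le> (1 + R) * \<delta>"
    by (rule lipschitz_decayD[OF dec tfIm])
       (metis abs_Im_le_cmod lip minus_complex.sel(2) order_trans)
  have i: "integrable torus (\<lambda>x. complex_of_real (f x) * cnj (?c x))"
    by (rule torus_integrable_bounded[where B=1]) (use torus_functionD(2)[OF f] in \<open>auto simp: norm_mult\<close>)
  have "Re (fourier_coeff f k) = (LINT x|torus. f x * Re (?c x))"
    unfolding fourier_coeff_torus[OF f] by (subst integral_Re[OF i, symmetric]) simp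
  moreover have "Im (fourier_coeff f k) = - (LINT x|torus. f x * Im (?c x))"
    unfolding fourier_coeff_torus[OF f] by (subst integral_Im[OF i, symmetric]) simp
  ultimately have "cmod (fourier_coeff f k) \<le> 2 * ((1 + R) * \<delta>)"
    using cmod_le[of "fourier_coeff f k"] 1 2 by simp
  also have "\<dots> \<le> 3 * \<delta> * R"
    using R assms(3) mult_right_mono[of "2 * (1 + R)" "3 * R" \<delta>] by (simp add: mult_ac)
  finally have "(cmod (fourier_coeff f k))\<^sup>2 \<le> (3 * \<delta> * R)\<^sup>2" by (intro power_mono) auto
  then show ?thesis using R by (simp add: R_def[symmetric] divide_le_eq power_mult_distrib)
qed

text \<open>Frequencies are split at \<open>N\<close>, of order \<open>1 / sqrt \<delta>\<close>.
  Below, at most \<open>9 * N\<^sup>2\<close> modes contribute \<open>9 * \<delta>\<^sup>2\<close>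
  each, in total at most \<open>324 * \<delta>\<close>; above, the factor
  \<open>1 / N\<^sup>2 \<le> \<delta>\<close> multiplies Bessel's bound 1. The sum
  \<open>325 * \<delta>\<close> is rounded up to \<open>19\<^sup>2 * \<delta>\<close>.\<close>

lemma functional_mixing_scale_le:
  assumes f: "torus_function f" and dec: "lipschitz_decay f \<delta>" and \<delta>: "0 < \<delta>" "\<delta> \<le> 1"
  shows "functional_mixing_scale f \<le> ennreal (19 * sqrt \<delta>)"
proof -
  define N where "N = nat \<lceil>1 / sqrt \<delta>\<rceil>"
  have sd: "0 < sqrt \<delta>" "sqrt \<delta> \<le> 1" using \<delta> by auto
  have N1: "1 / sqrt \<delta> \<le> real N" unfolding N_def by linarith
  have "real N < 1 / sqrt \<delta> + 1" unfolding N_def using sd by (simp add: ceiling_less_iff) linarith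
  moreover have "1 \<le> 1 / sqrt \<delta>" using sd by simp
  ultimately have N2: "real N \<le> 2 / sqrt \<delta>" "1 \<le> real N" using N1 by auto
  have N3: "1 / (real N)\<^sup>2 \<le> \<delta>"
  proof -
    have "1 \<le> real N * sqrt \<delta>" using N1 sd by (simp add: divide_le_eq)
    then have "1 \<le> (real N * sqrt \<delta>)\<^sup>2" by (simp add: one_le_power)
    then show ?thesis using N2 \<delta> by (simp add: power_mult_distrib divide_le_eq mult.commute)
  qed
  have N4: "(real N)\<^sup>2 * \<delta> \<le> 4"
  proof -
    have "real N * sqrt \<delta> \<le> 2" using N2 sd by (simp add: le_divide_eq)
    then have "(real N * sqrt \<delta>)\<^sup>2 \<le> 2\<^sup>2" by (intro power_mono) (use sd in auto)
    then show ?thesis using \<delta> by (simp add: power_mult_distrib)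
  qed
  define g where "g k = (cmod (fourier_coeff f k))\<^sup>2 / (2 * pi * norm (lattice_point k))\<^sup>2" for k
  define A where "A = {k :: int ^ 2. \<bar>k $ 1\<bar> \<le> int N \<and> \<bar>k $ 2\<bar> \<le> int N}"
  have A: "finite A \<and> real (card A) \<le> 9 * (real N)\<^sup>2"
  proof -
    let ?S = "{- int N..int N} \<times> {- int N..int N}"
    have "A \<subseteq> (\<lambda>(a, b). \<chi> i. if i = 1 then a else b) ` ?S"
    proof
      fix k assume "k \<in> A"
      then show "k \<in> (\<lambda>(a, b). \<chi> i. if i = 1 then a else b) ` ?S"
        by (intro image_eqI[of _ _ "(k $ 1, k $ 2)"]) (auto simp: A_def vec_eq_iff forall_2)
    qed
    then have "finite A" "card A \<le> card ?S"
      using surj_card_le[of ?S A] finite_subset by blast+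
    moreover have "real (card ?S) = (2 * real N + 1)\<^sup>2" by (simp add: card_cartesian_product power2_eq_square)
    moreover have "(2 * real N + 1)\<^sup>2 \<le> (3 * real N)\<^sup>2" using N2 by (intro power_mono) auto
    ultimately have "real (card A) \<le> (3 * real N)\<^sup>2" "finite A"
      using of_nat_mono[of "card A" "card ?S", where 'a=real] by linarith+
    then show ?thesis by (simp add: power_mult_distrib)
  qed
  have fin: "(\<Sum>k\<in>F. g k) \<le> 325 * \<delta>" if F: "finite F" "F \<subseteq> UNIV - {0}" for F
  proof -
    have "(\<Sum>k\<in>F. g k) = (\<Sum>k\<in>F \<inter> A. g k) + (\<Sum>k\<in>F - A. g k)"
      by (rule sum.Int_Diff[OF F(1)])
    also have "(\<Sum>k\<in>F \<inter> A. g k) \<le> (\<Sum>k\<in>F \<inter> A. 9 * \<delta>\<^sup>2)"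
      unfolding g_def by (intro sum_mono fourier_coeff_decay f dec) (use F \<delta> in auto)
    also have "\<dots> \<le> (9 * (real N)\<^sup>2) * (9 * \<delta>\<^sup>2)"
    proof -
      have "real (card (F \<inter> A)) \<le> 9 * (real N)\<^sup>2"
        using A card_mono[of A "F \<inter> A"] by (auto intro: order_trans[of _ "real (card A)"])
      from mult_right_mono[OF this, of "9 * \<delta>\<^sup>2"] show ?thesis by simp
    qed
    also have "\<dots> \<le> 324 * \<delta>"
      using mult_right_mono[OF N4, of "81 * \<delta>"] \<delta> by (simp add: power2_eq_square mult_ac)
    also have "(\<Sum>k\<in>F - A. g k) \<le> (\<Sum>k\<in>F - A. \<delta> * (cmod (fourier_coeff f k))\<^sup>2)"
    proof (rule sum_mono)
      fix k assume "k \<in> F - A"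
      then obtain i where "\<bar>k $ i\<bar> > int N" by (auto simp: A_def not_le)
      then have "real N \<le> real_of_int \<bar>k $ i\<bar>" by linarith
      then have n: "real N \<le> norm (lattice_point k)" using norm_lattice_point_ge[of k i] by linarith
      have "1 * real N \<le> 2 * pi * norm (lattice_point k)"
        using n pi_gt3 by (intro mult_mono) auto
      then have "(real N)\<^sup>2 \<le> (2 * pi * norm (lattice_point k))\<^sup>2" by (intro power_mono) auto
      then have "1 / (2 * pi * norm (lattice_point k))\<^sup>2 \<le> 1 / (real N)\<^sup>2"
        using N2 by (intro divide_left_mono) (auto intro!: mult_pos_pos)
      also note N3
      finally have "1 / (2 * pi * norm (lattice_point k))\<^sup>2 * (cmod (fourier_coeff f k))\<^sup>2 \<le> \<delta> * (cmod (fourier_coeff f k))\<^sup>2"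
        by (intro mult_right_mono) auto
      then show "g k \<le> \<delta> * (cmod (fourier_coeff f k))\<^sup>2" by (simp add: g_def)
    qed
    also have "\<dots> \<le> \<delta> * 1"
      unfolding sum_distrib_left[symmetric]
      using \<delta> sum_fourier_coeff_le_1[OF f, of "F - A"] F by (intro mult_left_mono) auto
    finally show ?thesis by simp
  qed
  let ?S = "\<Sum>\<^sub>\<infinity>k\<in>UNIV - {0}. ennreal ((2 * pi * norm (lattice_point k)) powr (2 * - 1) * (cmod (fourier_coeff f k))\<^sup>2)"
  have "?S \<le> ennreal (325 * \<delta>)"
  proof -
    have eq: "(2 * pi * norm (lattice_point k)) powr (2 * - 1) * (cmod (fourier_coeff f k))\<^sup>2 = g k" if "k \<noteq> 0" for k
      using norm_lattice_point_ge_1[OF that] by (simp add: g_def powr_minus_divide)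
    have "?S = (\<Sum>\<^sub>\<infinity>k\<in>UNIV - {0}. ennreal (g k))"
      by (rule infsum_cong, subst eq) auto
    also have "\<dots> = (SUP F\<in>{F. finite F \<and> F \<subseteq> UNIV - {0}}. (\<Sum>k\<in>F. ennreal (g k)))"
      by (rule nonneg_infsum_complete) simp
    also have "\<dots> \<le> ennreal (325 * \<delta>)"
      by (rule SUP_least) (auto simp: g_def sum_ennreal fin[unfolded g_def] intro!: ennreal_leI)
    finally show ?thesis .
  qed
  then have "enn2real ?S \<le> 325 * \<delta>" and "?S \<noteq> \<infinity>"
    using \<delta> neq_top_trans[OF ennreal_neq_top] by (auto intro!: enn2real_leI simp del: mult_minus1_right)
  have "Hs_seminorm (- 1) f = ennreal (enn2real ?S powr (1 / 2))"
    unfolding Hs_seminorm_def ennreal_powr_def using \<open>?S \<noteq> \<infinity>\<close> by simp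
  also have "\<dots> \<le> ennreal (19 * sqrt \<delta>)"
  proof (rule ennreal_leI)
    have "enn2real ?S powr (1 / 2) \<le> (361 * \<delta>) powr (1 / 2)"
      using \<open>enn2real ?S \<le> 325 * \<delta>\<close> \<delta> by (intro powr_mono2) auto
    also have "\<dots> = sqrt (19\<^sup>2 * \<delta>)" using \<delta> by (simp add: powr_half_sqrt)
    also have "\<dots> = 19 * sqrt \<delta>" by (simp only: real_sqrt_mult real_sqrt_abs)
    finally show "enn2real ?S powr (1 / 2) \<le> 19 * sqrt \<delta>" .
  qed
  finally show ?thesis .
qed

subsection \<open>Balls on the torus\<close>

lemma torus_ball_eq: "torus_ball x r = (\<Union>k. ball (x - lattice_point k) r)"
  by (auto simp: torus_ball_def dist_norm algebra_simps)

lemma torus_ball_borel [measurable]: "torus_ball x r \<in> sets borel"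
  unfolding torus_ball_eq by (intro borel_open open_UN) auto

lemma lattice_point_add: "lattice_point (k + l) = lattice_point k + lattice_point l"
  and lattice_point_diff: "lattice_point (k - l) = lattice_point k - lattice_point l"
  by (simp_all add: lattice_point_def vec_eq_iff)

lemma torus_ball_periodic: "y + lattice_point m \<in> torus_ball x r \<longleftrightarrow> y \<in> torus_ball x r"
proof
  assume "y + lattice_point m \<in> torus_ball x r"
  then obtain k where "dist x (y + lattice_point m + lattice_point k) < r" by (auto simp: torus_ball_def)
  then show "y \<in> torus_ball x r"
    unfolding torus_ball_def by (auto intro!: exI[of _ "m + k"] simp: lattice_point_add add.assoc)
next
  assume "y \<in> torus_ball x r"
  then obtain k where "dist x (y + lattice_point k) < r" by (auto simp: torus_ball_def)
  then show "y + lattice_point m \<in> torus_ball x r"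
    unfolding torus_ball_def by (auto intro!: exI[of _ "k - m"] simp: lattice_point_diff)
qed

lemma measure_torus: "S \<in> sets borel \<Longrightarrow> measure torus S = measure lborel (unit_cell \<inter> S)"
  unfolding measure_def torus_def by (simp add: emeasure_density indicator_inter_arith[symmetric])

lemma measure_torus_measure:
  assumes [measurable]: "S \<in> sets borel"
  shows "measure torus_measure (unit_cell \<inter> S) = measure torus S"
proof -
  have "unit_cell \<in> sets lebesgue" by simp
  then have "measure torus_measure (unit_cell \<inter> S) = measure lebesgue (unit_cell \<inter> S)"
    by (intro measure_restrict_space) auto
  also have "\<dots> = measure lborel (unit_cell \<inter> S)" by (rule measure_completion) simp
  finally show ?thesis by (simp add: measure_torus)
qed

text \<open>A translation moves the centre to the midpoint of the unit cell. There, for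
  \<open>r \<le> 1 / 2\<close>, exactly one lattice translate of the ball meets the cell, and it
  lies inside.\<close>

lemma measure_torus_ball:
  assumes "0 < r" "r \<le> 1 / 2"
  shows "measure torus (torus_ball x r) = pi * r\<^sup>2"
proof -
  define c :: "real ^ 2" where "c = (\<chi> i. 1 / 2)"
  have ball: "unit_cell \<inter> torus_ball c r = ball c r"
  proof (intro equalityI subsetI)
    fix y assume y: "y \<in> unit_cell \<inter> torus_ball c r"
    then obtain k where k: "dist c (y + lattice_point k) < r" by (auto simp: torus_ball_def)
    have "k $ i = 0" for i
    proof -
      have "\<bar>(c - (y + lattice_point k)) $ i\<bar> < 1 / 2"
        using component_le_norm_cart[of "c - (y + lattice_point k)" i] k assms by (simp add: dist_norm)
      moreover have "0 \<le> y $ i" "y $ i < 1" using y by (auto simp: unit_cell_def)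
      ultimately have "-1 < real_of_int (k $ i)" "real_of_int (k $ i) < 1"
        unfolding c_def lattice_point_def vector_minus_component vector_add_component vec_lambda_beta
        by linarith+
      then show ?thesis by linarith
    qed
    then have "lattice_point k = 0" by (simp add: lattice_point_def vec_eq_iff)
    with k show "y \<in> ball c r" by simp
  next
    fix y assume y: "y \<in> ball c r"
    have "\<bar>(c - y) $ i\<bar> < 1 / 2" for i
      using component_le_norm_cart[of "c - y" i] y assms by (simp add: dist_norm)
    then have "0 \<le> y $ i \<and> y $ i < 1" for i
      unfolding c_def vector_minus_component vec_lambda_beta abs_less_iff
      by (smt (verit) field_sum_of_halves)
    moreover have "y \<in> torus_ball c r"
      using y by (auto simp: torus_ball_def intro!: exI[of _ 0])
    ultimately show "y \<in> unit_cell \<inter> torus_ball c r" by (simp add: unit_cell_def)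
  qed
  have shift: "y \<in> torus_ball x r \<longleftrightarrow> y + (c - x) \<in> torus_ball c r" for y
    by (auto simp: torus_ball_def dist_norm algebra_simps)
  have "measure torus (torus_ball x r) = (LINT y|torus. indicator (torus_ball c r) (y + (c - x)))"
  proof -
    have "measure torus (torus_ball x r) = (LINT y|torus. indicator (torus_ball x r) y)" by simp
    also have "\<dots> = (LINT y|torus. indicator (torus_ball c r) (y + (c - x)))"
      by (intro Bochner_Integration.integral_cong) (auto simp: indicator_def shift)
    finally show ?thesis .
  qed
  also have "\<dots> = (LINT y|torus. indicat_real (torus_ball c r) y)"
    by (rule torus_integral_translate[where B=1])
       (auto simp: periodic_def indicator_def torus_ball_periodic)
  also have "\<dots> = measure torus (torus_ball c r)" by simp
  also have "\<dots> = pi * r\<^sup>2"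
    unfolding measure_torus[OF torus_ball_borel] ball
    using assms content_ball[of r c] by (simp add: unit_ball_vol_2)
  finally show ?thesis .
qed

text \<open>The quotient distance, taken as the distance of \<open>y\<close> to the orbit of
  \<open>x\<close>: as a distance to a set it is Lipschitz with constant 1, and its open sublevel
  sets are the torus balls.\<close>

definition lattice_dist :: "real ^ 2 \<Rightarrow> real ^ 2 \<Rightarrow> real" where
  "lattice_dist x y = infdist y (range (\<lambda>k. x - lattice_point k))"

lemma torus_ball_lattice_dist: "y \<in> torus_ball x r \<longleftrightarrow> lattice_dist x y < r"
proof -
  have "lattice_dist x y < r \<longleftrightarrow> (\<exists>a\<in>range (\<lambda>k. x - lattice_point k). dist y a < r)"
    unfolding lattice_dist_def infdist_def
    by (subst if_not_P, simp) (rule cINF_less_iff, simp, rule bdd_belowI[of _ 0], auto)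
  then show ?thesis by (auto simp: torus_ball_eq dist_commute)
qed

lemma lattice_dist_lipschitz: "\<bar>lattice_dist x y - lattice_dist x z\<bar> \<le> norm (y - z)"
  unfolding lattice_dist_def dist_norm[symmetric] by (rule infdist_triangle_abs)

lemma lattice_dist_periodic: "lattice_dist x (y + lattice_point m) = lattice_dist x y"
proof (rule antisym)
  show "lattice_dist x (y + lattice_point m) \<le> lattice_dist x y"
    by (rule dense_ge) (metis torus_ball_lattice_dist torus_ball_periodic less_imp_le)
  show "lattice_dist x y \<le> lattice_dist x (y + lattice_point m)"
    by (rule dense_ge) (metis torus_ball_lattice_dist torus_ball_periodic less_imp_le)
qed

text \<open>The indicator of the ball is replaced by a cutoff \<open>\<phi>\<close> descending from
  1 to 0 between the radii \<open>(1 - \<eta>) * \<epsilon>\<close> and \<open>\<epsilon>\<close>,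
  with slope \<open>1 / (\<eta> * \<epsilon>)\<close>. The cutoff is paired by
  \<open>lipschitz_decay\<close>; the error is at most the area of the annulus, a fraction at most
  \<open>2 * \<eta>\<close> of the ball.\<close>

lemma integral_on_ball_le:
  assumes f: "torus_function f" and dec: "lipschitz_decay f \<delta>"
    and \<epsilon>: "0 < \<epsilon>" "\<epsilon> \<le> 1 / 2" and \<eta>: "0 < \<eta>" "\<eta> < 1"
  shows "\<bar>LINT y|torus. f y * indicator (torus_ball x \<epsilon>) y\<bar> \<le> (1 + 1 / (\<eta> * \<epsilon>)) * \<delta> + 2 * \<eta> * (pi * \<epsilon>\<^sup>2)"
proof -
  note [measurable] = torus_functionD(1)[OF f]
  define \<phi> where "\<phi> y = max 0 (min 1 ((\<epsilon> - lattice_dist x y) / (\<eta> * \<epsilon>)))" for y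
  have \<eta>\<epsilon>: "0 < \<eta> * \<epsilon>" using \<epsilon> \<eta> by simp
  have lip: "\<bar>\<phi> y - \<phi> z\<bar> \<le> 1 / (\<eta> * \<epsilon>) * norm (y - z)" for y z
  proof -
    have "\<bar>\<phi> y - \<phi> z\<bar> \<le> \<bar>(\<epsilon> - lattice_dist x y) / (\<eta> * \<epsilon>) - (\<epsilon> - lattice_dist x z) / (\<eta> * \<epsilon>)\<bar>"
      unfolding \<phi>_def by linarith
    also have "\<dots> = \<bar>lattice_dist x y - lattice_dist x z\<bar> / (\<eta> * \<epsilon>)"
      using \<eta>\<epsilon> by (simp add: abs_minus_commute flip: diff_divide_distrib)
    also have "\<dots> \<le> norm (y - z) / (\<eta> * \<epsilon>)"
      using \<eta>\<epsilon> lattice_dist_lipschitz by (intro divide_right_mono) auto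
    finally show ?thesis by simp
  qed
  have "continuous_on UNIV \<phi>"
  proof (rule lipschitz_on_continuous_on)
    show "(1 / (\<eta> * \<epsilon>))-lipschitz_on UNIV \<phi>"
      using lip \<eta>\<epsilon> by (intro lipschitz_onI) (auto simp: dist_norm)
  qed
  then have \<phi>_meas [measurable]: "\<phi> \<in> borel_measurable borel" by (rule borel_measurable_continuous_onI)
  have tf: "torus_function \<phi>"
    using \<phi>_meas by (auto simp: torus_function_def periodic_def \<phi>_def lattice_dist_periodic)
  let ?B = "indicat_real (torus_ball x \<epsilon>)" and ?B' = "indicat_real (torus_ball x ((1 - \<eta>) * \<epsilon>))"
  have le: "?B' y \<le> \<phi> y" "\<phi> y \<le> ?B y" for y
  proof -
    show "?B' y \<le> \<phi> y"
    proof (cases "y \<in> torus_ball x ((1 - \<eta>) * \<epsilon>)")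
      case True
      then have "\<eta> * \<epsilon> \<le> \<epsilon> - lattice_dist x y"
        by (simp add: torus_ball_lattice_dist algebra_simps)
      then have "1 \<le> (\<epsilon> - lattice_dist x y) / (\<eta> * \<epsilon>)" using \<eta>\<epsilon> by simp
      then show ?thesis by (simp add: \<phi>_def indicator_def)
    qed (simp add: \<phi>_def)
    show "\<phi> y \<le> ?B y"
    proof (cases "y \<in> torus_ball x \<epsilon>")
      case False
      then have "(\<epsilon> - lattice_dist x y) / (\<eta> * \<epsilon>) \<le> 0"
        using \<eta>\<epsilon> by (simp add: torus_ball_lattice_dist divide_le_0_iff)
      then show ?thesis by (simp add: \<phi>_def)
    qed (simp add: \<phi>_def)
  qed
  have \<phi>01: "0 \<le> \<phi> y" "\<phi> y \<le> 1" for y by (auto simp: \<phi>_def)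
  have int: "integrable torus (\<lambda>y. f y * \<phi> y)" "integrable torus (\<lambda>y. f y * ?B y)"
    "integrable torus \<phi>" "integrable torus ?B" "integrable torus ?B'"
    using torus_functionD(2)[OF f] \<phi>01
    by (auto intro!: torus_integrable_bounded[where B=1] mult_le_one simp: abs_mult indicator_def)
  have "(LINT y|torus. f y * ?B y) - (LINT y|torus. f y * \<phi> y) = (LINT y|torus. f y * (?B y - \<phi> y))"
    using int by (simp add: right_diff_distrib)
  moreover have "\<bar>LINT y|torus. f y * (?B y - \<phi> y)\<bar> \<le> (LINT y|torus. ?B y - ?B' y)"
  proof -
    have "\<bar>LINT y|torus. f y * (?B y - \<phi> y)\<bar> \<le> (LINT y|torus. \<bar>f y * (?B y - \<phi> y)\<bar>)"
      by (rule integral_abs_bound)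
    also have "\<dots> \<le> (LINT y|torus. ?B y - ?B' y)"
    proof (rule integral_mono)
      show "integrable torus (\<lambda>y. \<bar>f y * (?B y - \<phi> y)\<bar>)"
        using int by (intro integrable_abs) (simp add: right_diff_distrib)
      show "\<bar>f y * (?B y - \<phi> y)\<bar> \<le> ?B y - ?B' y" for y
      proof -
        have "\<bar>f y * (?B y - \<phi> y)\<bar> \<le> 1 * (?B y - \<phi> y)"
          unfolding abs_mult using torus_functionD(2)[OF f] le[of y] by (intro mult_mono) auto
        then show ?thesis using le[of y] by simp
      qed
    qed (use int in auto)
    finally show ?thesis .
  qed
  moreover have "(LINT y|torus. ?B y - ?B' y) \<le> 2 * \<eta> * (pi * \<epsilon>\<^sup>2)"
  proof -
    have r: "0 < (1 - \<eta>) * \<epsilon>" using \<epsilon> \<eta> by simp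
    have "(1 - \<eta>) * \<epsilon> \<le> 1 * \<epsilon>" using \<epsilon> \<eta> by (intro mult_right_mono) auto
    then have r': "(1 - \<eta>) * \<epsilon> \<le> 1 / 2" using \<epsilon> by linarith
    have "(LINT y|torus. ?B y - ?B' y) = pi * \<epsilon>\<^sup>2 - pi * ((1 - \<eta>) * \<epsilon>)\<^sup>2"
      using int measure_torus_ball[OF \<epsilon>, of x] measure_torus_ball[OF r r', of x] by simp
    also have "\<dots> = (pi * \<epsilon>\<^sup>2) * (2 * \<eta> - \<eta>\<^sup>2)" by (simp add: power2_eq_square algebra_simps)
    also have "\<dots> \<le> (pi * \<epsilon>\<^sup>2) * (2 * \<eta>)" by (intro mult_left_mono) auto
    finally show ?thesis by (simp add: mult_ac)
  qed
  moreover have "\<bar>LINT y|torus. f y * \<phi> y\<bar> \<le> (1 + 1 / (\<eta> * \<epsilon>)) * \<delta>"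
    by (rule lipschitz_decayD[OF dec tf lip])
  ultimately show ?thesis by linarith
qed

section \<open>Volume fractions and the geometric mixing scale\<close>

lemma measure_plus_set:
  assumes f: "torus_function f" and val: "\<And>x. f x \<in> {1, -1}" and [measurable]: "S \<in> sets borel"
  shows "2 * measure torus ({y. f y = 1} \<inter> S) = measure torus S + (LINT y|torus. f y * indicator S y)"
proof -
  note [measurable] = torus_functionD(1)[OF f]
  have [measurable]: "{y. f y = 1} \<in> sets borel"
    using measurable_sets[OF torus_functionD(1)[OF f], of "{1}"] by (simp add: vimage_def)
  have "f y * indicator S y = 2 * indicator ({y. f y = 1} \<inter> S) y - indicator S y" for y
    using val[of y] by (auto simp: indicator_def)
  then have "(LINT y|torus. f y * indicator S y) = (LINT y|torus. 2 * indicator ({y. f y = 1} \<inter> S) y - indicator S y)"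
    by simp
  also have "\<dots> = 2 * measure torus ({y. f y = 1} \<inter> S) - measure torus S"
  proof -
    have "integrable torus (indicat_real A)" if "A \<in> sets borel" for A
      by (rule torus_integrable_bounded[where B=1]) (use that in \<open>auto simp: indicator_def\<close>)
    then show ?thesis by (simp add: sets.Int)
  qed
  finally show ?thesis by simp
qed

text \<open>The volume fraction of \<open>f = 1\<close> in a ball is one half plus half the mean of
  \<open>f\<close> there, so it lies in \<open>{\<kappa>..1 - \<kappa>}\<close> once this mean is at
  most \<open>1 - 2 * \<kappa>\<close> in modulus.\<close>

lemma geometric_mixing_scale_leI:
  assumes f: "torus_function f" and val: "\<And>x. f x \<in> {1, -1}" and \<epsilon>: "\<epsilon> > 0"
    and le: "\<And>x. \<bar>LINT y|torus. f y * indicator (torus_ball x \<epsilon>) y\<bar> \<le> (1 - 2 * \<kappa>) * measure torus (torus_ball x \<epsilon>)"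
    and pos: "\<And>x. 0 < measure torus (torus_ball x \<epsilon>)"
  shows "geometric_mixing_scale \<kappa> f \<le> ennreal \<epsilon>"
  unfolding geometric_mixing_scale_def
proof (rule INF_lower, safe)
  fix x
  note [measurable] = torus_functionD(1)[OF f]
  have [measurable]: "{y. f y = 1} \<in> sets borel"
    using measurable_sets[OF torus_functionD(1)[OF f], of "{1}"] by (simp add: vimage_def)
  let ?m = "measure torus (torus_ball x \<epsilon>)" and ?p = "measure torus ({y. f y = 1} \<inter> torus_ball x \<epsilon>)"
  have "{y \<in> unit_cell. f y = 1} \<inter> torus_ball x \<epsilon> = unit_cell \<inter> ({y. f y = 1} \<inter> torus_ball x \<epsilon>)" by auto
  then have eq: "measure torus_measure ({y \<in> unit_cell. f y = 1} \<inter> torus_ball x \<epsilon>) = ?p"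
    "measure torus_measure (unit_cell \<inter> torus_ball x \<epsilon>) = ?m"
    by (simp_all add: measure_torus_measure)
  have "2 * ?p = ?m + (LINT y|torus. f y * indicator (torus_ball x \<epsilon>) y)"
    by (rule measure_plus_set[OF f val]) simp
  with le[of x] have "2 * ?p \<le> 2 * ((1 - \<kappa>) * ?m)" "2 * (\<kappa> * ?m) \<le> 2 * ?p"
    by (auto simp: abs_le_iff algebra_simps)
  then show "measure torus_measure ({y \<in> unit_cell. f y = 1} \<inter> torus_ball x \<epsilon>) /
      measure torus_measure (unit_cell \<inter> torus_ball x \<epsilon>) \<in> {\<kappa>..1 - \<kappa>}"
    using pos[of x] unfolding eq by (simp add: le_divide_eq divide_le_eq)
qed (use \<epsilon> in simp)

lemma torus_ball_2: "torus_ball x 2 = UNIV"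
proof -
  have "y \<in> torus_ball x 2" for y
  proof -
    define k where "k = (\<chi> i. round ((x - y) $ i))"
    have "\<bar>(x - (y + lattice_point k)) $ i\<bar> \<le> 1 / 2" for i
      using of_int_round_abs_le[of "(x - y) $ i"]
      by (simp add: k_def lattice_point_def abs_minus_commute algebra_simps)
    then have "(\<Sum>i\<in>UNIV. \<bar>(x - (y + lattice_point k)) $ i\<bar>) \<le> (\<Sum>i\<in>(UNIV :: 2 set). 1 / 2)"
      by (intro sum_mono) auto
    then have "dist x (y + lattice_point k) < 2"
      using norm_le_l1_cart[of "x - (y + lattice_point k)"] by (simp add: dist_norm)
    then show ?thesis by (auto simp: torus_ball_def)
  qed
  then show ?thesis by auto
qed

text \<open>With \<open>a = 1 - 2 * \<kappa>\<close>, the choices \<open>\<eta> = a / 4\<close> and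
  \<open>\<epsilon> ^ 3 = 16 / (pi * a\<^sup>2) * \<delta>\<close> balance the errors of
  \<open>integral_on_ball_le\<close>: for \<open>\<epsilon> \<le> 1 / 2\<close> each is at most
  \<open>a / 2\<close> times the area of the ball.\<close>

lemma geometric_mixing_scale_le:
  assumes f: "torus_function f" and val: "\<And>x. f x \<in> {1, -1}" and mean: "(LINT x|torus. f x) = 0"
    and dec: "lipschitz_decay f \<delta>" and \<delta>: "0 < \<delta>" and \<kappa>: "0 < \<kappa>" "\<kappa> < 1 / 2"
  shows "geometric_mixing_scale \<kappa> f \<le> ennreal (4 * (16 / (pi * (1 - 2 * \<kappa>)\<^sup>2)) powr (1 / 3) * \<delta> powr (1 / 3))"
proof -
  define a where "a = 1 - 2 * \<kappa>"
  have a: "0 < a" "a < 1" using \<kappa> by (auto simp: a_def)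
  define \<epsilon> where "\<epsilon> = (16 / (pi * a\<^sup>2) * \<delta>) powr (1 / 3)"
  have \<epsilon>0: "\<epsilon> > 0" using \<delta> a by (simp add: \<epsilon>_def)
  have \<epsilon>3: "\<epsilon> ^ 3 = 16 / (pi * a\<^sup>2) * \<delta>"
    using \<delta> a by (simp add: \<epsilon>_def powr_powr flip: powr_numeral)
  have \<epsilon>_eq: "\<epsilon> = (16 / (pi * a\<^sup>2)) powr (1 / 3) * \<delta> powr (1 / 3)"
    unfolding \<epsilon>_def using \<delta> a by (intro powr_mult)
  have "geometric_mixing_scale \<kappa> f \<le> ennreal (4 * \<epsilon>)"
  proof (cases "\<epsilon> \<le> 1 / 2")
    case True
    have m: "measure torus (torus_ball x \<epsilon>) = pi * \<epsilon>\<^sup>2" for x by (rule measure_torus_ball[OF \<epsilon>0 True])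
    have "geometric_mixing_scale \<kappa> f \<le> ennreal \<epsilon>"
    proof (rule geometric_mixing_scale_leI[OF f val \<epsilon>0])
      fix x
      have "\<bar>LINT y|torus. f y * indicator (torus_ball x \<epsilon>) y\<bar> \<le> (1 + 1 / (a / 4 * \<epsilon>)) * \<delta> + 2 * (a / 4) * (pi * \<epsilon>\<^sup>2)"
        by (rule integral_on_ball_le[OF f dec \<epsilon>0 True]) (use a in auto)
      also have "(1 + 1 / (a / 4 * \<epsilon>)) * \<delta> \<le> (8 / (a * \<epsilon>)) * \<delta>"
      proof (rule mult_right_mono)
        \<comment> \<open>This absorbs the summand 1 into
          \<open>4 / (a * \<epsilon>)\<close>.\<close>
        have "a * \<epsilon> \<le> 1 * 1" using a True \<epsilon>0 by (intro mult_mono) auto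
        define X where "X = 1 / (a * \<epsilon>)"
        have "1 \<le> 4 * X" using \<open>a * \<epsilon> \<le> 1 * 1\<close> a \<epsilon>0 by (simp add: X_def le_divide_eq)
        moreover have "8 / (a * \<epsilon>) = 8 * X" "1 / (a / 4 * \<epsilon>) = 4 * X" by (simp_all add: X_def)
        moreover have "1 + 4 * X \<le> 8 * X" using calculation(1) by linarith
        ultimately show "1 + 1 / (a / 4 * \<epsilon>) \<le> 8 / (a * \<epsilon>)" by (simp only:)
      qed (use \<delta> in simp)
      also have "(8 / (a * \<epsilon>)) * \<delta> = a / 2 * (pi * \<epsilon>\<^sup>2)"
      proof -
        have "\<delta> = pi * a\<^sup>2 / 16 * \<epsilon> ^ 3" using \<epsilon>3 a by simp
        then have "(8 / (a * \<epsilon>)) * \<delta> = (8 / (a * \<epsilon>)) * (pi * a\<^sup>2 / 16 * \<epsilon> ^ 3)" by (rule arg_cong)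
        also have "\<dots> = a / 2 * (pi * \<epsilon>\<^sup>2)"
          using a \<epsilon>0 by (simp add: power2_eq_square power3_eq_cube)
        finally show ?thesis .
      qed
      finally show "\<bar>LINT y|torus. f y * indicator (torus_ball x \<epsilon>) y\<bar> \<le> (1 - 2 * \<kappa>) * measure torus (torus_ball x \<epsilon>)"
        unfolding m a_def[symmetric] by (simp add: mult_ac)
    qed (use m \<epsilon>0 in simp)
    also have "\<dots> \<le> ennreal (4 * \<epsilon>)" using \<epsilon>0 by (intro ennreal_leI) auto
    finally show ?thesis .
  next
    case False
    \<comment> \<open>If \<open>\<epsilon> > 1 / 2\<close>, the radius 2 is admissible: its ball is
      the whole torus, over which \<open>f\<close> has mean zero, and
      \<open>2 \<le> 4 * \<epsilon>\<close>. This is the origin of the factor 4.\<close>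
    have "measure torus UNIV = 1" using torus.prob_space by simp
    then have "geometric_mixing_scale \<kappa> f \<le> ennreal 2"
      using mean \<kappa> by (intro geometric_mixing_scale_leI[OF f val]) (auto simp: torus_ball_2)
    also have "\<dots> \<le> ennreal (4 * \<epsilon>)" using False by (intro ennreal_leI) auto
    finally show ?thesis .
  qed
  then show ?thesis by (simp add: \<epsilon>_eq a_def mult.assoc)
qed

section \<open>Test functions and integration by parts\<close>

lemma C_infinity_differentiable: "C_infinity f \<Longrightarrow> f differentiable (at x)"
  unfolding C_infinity_def by (metis C_k.simps(2))

lemma C_infinity_has_derivative:
  "C_infinity f \<Longrightarrow> (f has_derivative frechet_derivative f (at x)) (at x)"
  using C_infinity_differentiable frechet_derivative_works by blast

lemma C_infinity_continuous: "C_infinity f \<Longrightarrow> continuous_on UNIV f"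
  unfolding C_infinity_def by (metis C_k.simps(1))

lemma C_infinity_continuous_partial:
  "C_infinity f \<Longrightarrow> b \<in> Basis \<Longrightarrow> continuous_on UNIV (\<lambda>x. frechet_derivative f (at x) b)"
  unfolding C_infinity_def by (metis C_k.simps)

lemma frechet_derivative_scaleR:
  "C_infinity f \<Longrightarrow> frechet_derivative f (at x) (c *\<^sub>R v) = c * frechet_derivative f (at x) v"
  using linear_cmul[OF has_derivative_linear[OF C_infinity_has_derivative]] by simp

lemma DERIV_along_line:
  assumes "C_infinity f" "(g has_vector_derivative v) (at s)"
  shows "((\<lambda>s. f (g s)) has_real_derivative frechet_derivative f (at (g s)) v) (at s)"
proof -
  have "((\<lambda>s. f (g s)) has_derivative (\<lambda>h. frechet_derivative f (at (g s)) (h *\<^sub>R v))) (at s)"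
    using has_derivative_compose[OF assms(2)[unfolded has_vector_derivative_def] C_infinity_has_derivative[OF assms(1)]] .
  then show ?thesis
    unfolding has_field_derivative_def
    by (simp add: frechet_derivative_scaleR[OF assms(1)] mult.commute[of _ "frechet_derivative f (at (g s)) v"])
qed

lemma frechet_derivative_translate:
  assumes "C_infinity f" "\<And>x. f (x + l) = f x"
  shows "frechet_derivative f (at (x + l)) = frechet_derivative f (at x)"
proof -
  have "((\<lambda>z. f (z + l)) has_derivative frechet_derivative f (at (x + l))) (at x)"
    using has_derivative_compose[of "\<lambda>z. z + l" "\<lambda>h. h" x UNIV f "frechet_derivative f (at (x + l))"]
      C_infinity_has_derivative[OF assms(1), of "x + l"]
      has_derivative_add_const[OF has_derivative_ident, of l "at x"] by simp
  then show ?thesis using assms(2) by (simp add: frechet_derivative_at)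
qed

lemma periodic_cell_representative:
  obtains y k where "y \<in> cbox 0 (\<chi> i. 1)" "x = y + lattice_point k"
proof
  show "(\<chi> i. frac (x $ i)) \<in> cbox 0 (\<chi> i. 1)"
    by (simp add: mem_box_cart less_imp_le frac_lt_1)
  show "x = (\<chi> i. frac (x $ i)) + lattice_point (\<chi> i. \<lfloor>x $ i\<rfloor>)"
    by (simp add: vec_eq_iff lattice_point_def frac_def)
qed

text \<open>By periodicity, all values over \<open>{a..b}\<close> are attained on the compact
  product of \<open>{a..b}\<close> with the closed unit cell.\<close>

lemma periodic_continuous_bounded:
  fixes f :: "real \<times> (real ^ 2) \<Rightarrow> real"
  assumes "continuous_on UNIV f" "\<And>t. periodic (\<lambda>x. f (t, x))"
  obtains B where "\<And>t x. t \<in> {a..b} \<Longrightarrow> \<bar>f (t, x)\<bar> \<le> B"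
proof -
  have "compact (f ` ({a..b} \<times> cbox 0 (\<chi> i. 1)))"
    by (intro compact_continuous_image continuous_on_subset[OF assms(1)] compact_Times) auto
  then obtain B where B: "\<And>z. z \<in> {a..b} \<times> cbox 0 (\<chi> i. 1) \<Longrightarrow> \<bar>f z\<bar> \<le> B"
    using compact_imp_bounded[THEN bounded_iff[THEN iffD1]] by (metis imageI real_norm_def)
  have "\<bar>f (t, x)\<bar> \<le> B" if "t \<in> {a..b}" for t x
  proof -
    obtain y k where y: "y \<in> cbox 0 (\<chi> i. 1)" "x = y + lattice_point k"
      by (rule periodic_cell_representative)
    then have "f (t, x) = f (t, y)" using assms(2)[of t] by (simp add: periodic_def)
    with B[of "(t, y)"] y that show ?thesis by simp
  qed
  then show thesis by (rule that)
qed

lemma periodic_continuous_bounded_space: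
  fixes f :: "real ^ 2 \<Rightarrow> real"
  assumes "continuous_on UNIV f" "periodic f"
  obtains B where "\<And>x. \<bar>f x\<bar> \<le> B"
proof -
  have "continuous_on UNIV (\<lambda>z :: real \<times> (real ^ 2). f (snd z))"
    by (rule continuous_on_compose2[OF assms(1)]) (auto intro: continuous_intros)
  then show thesis
  proof (rule periodic_continuous_bounded[where a=0 and b=0])
    fix B assume B: "\<And>t x. t \<in> {0..0 :: real} \<Longrightarrow> \<bar>f (snd (t, x))\<bar> \<le> B"
    show thesis by (rule that[of B]) (use B[of 0] in simp)
  qed (use assms(2) in simp)
qed

text \<open>The finite exceptional set accommodates the corners of the profile at the
  integers.\<close>

lemma circle_integral_derivative_endpoints:
  fixes F f :: "real \<Rightarrow> real"
  assumes "continuous_on {0..1} F" "finite S"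
    and der: "\<And>x. x \<in> {0<..<1} - S \<Longrightarrow> (F has_real_derivative f x) (at x)"
    and [measurable]: "f \<in> borel_measurable borel" and B: "\<And>x. \<bar>f x\<bar> \<le> B"
  shows "(LINT x|circle. f x) = F 1 - F 0"
proof -
  have "(f has_integral F 1 - F 0) {0..1}"
    by (rule fundamental_theorem_of_calculus_interior_strong[OF assms(2)])
       (use der assms(1) in \<open>auto simp flip: has_real_derivative_iff_has_vector_derivative\<close>)
  moreover have "(LINT x|circle. f x) = integral {0..1} f"
    by (rule circle_integral_eq_integral[where B=B]) (use B in auto)
  ultimately show ?thesis by (simp add: integral_unique)
qed

lemma circle_integral_derivative_periodic:
  fixes F f :: "real \<Rightarrow> real"
  assumes "int_periodic F" "continuous_on {0..1} F" "finite S"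
    and "\<And>x. x \<in> {0<..<1} - S \<Longrightarrow> (F has_real_derivative f x) (at x)"
    and "f \<in> borel_measurable borel" and "\<And>x. \<bar>f x\<bar> \<le> B"
  shows "(LINT x|circle. f x) = 0"
  using circle_integral_derivative_endpoints[OF assms(2-)] int_periodicD[OF assms(1), of 0 1] by simp

text \<open>At the integers, where the profile has corners, the formula returns the right
  derivative.\<close>

definition profile_deriv :: "real \<Rightarrow> real" where
  "profile_deriv y = 10000 * (1 - 2 * frac y)"

lemma profile_deriv_measurable [measurable]: "profile_deriv \<in> borel_measurable borel"
  unfolding profile_deriv_def by measurable

lemma profile_deriv_bound: "\<bar>profile_deriv y\<bar> \<le> 10000"
  using frac_ge_0[of y] frac_lt_1[of y] by (simp add: profile_deriv_def abs_le_iff)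

lemma profile_has_derivative:
  assumes "y \<notin> \<int>"
  shows "(profile has_real_derivative profile_deriv y) (at y)"
proof -
  define n where "n = \<lfloor>y\<rfloor>"
  have y: "y \<in> {of_int n<..<of_int n + 1}"
  proof -
    have "y \<noteq> of_int n" using assms by auto
    moreover have "of_int n \<le> y" "y < of_int n + 1" unfolding n_def by linarith+
    ultimately show ?thesis by simp
  qed
  have f: "frac x = x - of_int n" if "x \<in> {of_int n<..<of_int n + 1}" for x
  proof -
    have "\<lfloor>x\<rfloor> = n" using that by (intro floor_unique) auto
    then show ?thesis by (simp add: frac_def)
  qed
  have "((\<lambda>x. 10000 * ((x - of_int n) * (1 - (x - of_int n)))) has_real_derivative profile_deriv y) (at y)"
    by (auto intro!: derivative_eq_intros simp: profile_deriv_def f[OF y] algebra_simps)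
  then show ?thesis
    by (rule has_field_derivative_transform_within_open[where S="{of_int n<..<of_int n + 1}"])
       (use y in \<open>auto simp: profile_def f\<close>)
qed

lemma finite_shifted_Ints: "finite {x \<in> {a..b}. x + w \<in> (\<int> :: real set)}"
proof (rule finite_subset)
  show "{x \<in> {a..b}. x + w \<in> \<int>} \<subseteq> (\<lambda>n. of_int n - w) ` {\<lfloor>a + w\<rfloor>..\<lceil>b + w\<rceil>}"
  proof
    fix x assume x: "x \<in> {x \<in> {a..b}. x + w \<in> \<int>}"
    then obtain n where n: "x + w = of_int n" by (auto elim: Ints_cases)
    with x have "\<lfloor>a + w\<rfloor> \<le> n" "n \<le> \<lceil>b + w\<rceil>"
      by (auto simp: floor_le_iff le_ceiling_iff)
    with n show "x \<in> (\<lambda>n. of_int n - w) ` {\<lfloor>a + w\<rfloor>..\<lceil>b + w\<rceil>}"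
      by (intro image_eqI[of _ _ n]) auto
  qed
qed simp

section \<open>The shear velocity: weak Jacobian, divergence and Sobolev bounds\<close>

definition velocity :: "2 \<Rightarrow> real \<Rightarrow> real ^ 2 \<Rightarrow> real ^ 2" where
  "velocity i w x = profile (x $ (i + 1) + w) *\<^sub>R axis i 1"

definition velocity_jacobian :: "2 \<Rightarrow> real \<Rightarrow> real ^ 2 \<Rightarrow> real ^ 2 ^ 2" where
  "velocity_jacobian i w x = profile_deriv (x $ (i + 1) + w) *\<^sub>R axis i (axis (i + 1) 1)"

lemma velocity_measurable [measurable]: "velocity i w \<in> borel_measurable borel"
  unfolding velocity_def[abs_def] by measurable

lemma velocity_jacobian_measurable [measurable]: "velocity_jacobian i w \<in> borel_measurable borel"
  unfolding velocity_jacobian_def[abs_def] by measurable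

lemma norm_velocity_le: "norm (velocity i w x) \<le> 10000"
  using profile_nonneg profile_le by (simp add: velocity_def)

lemma norm_velocity_jacobian_le: "norm (velocity_jacobian i w x) \<le> 10000"
  using profile_deriv_bound by (simp add: velocity_jacobian_def)

lemma periodic_velocity: "periodic (velocity i w)"
proof -
  have "profile (x $ (i + 1) + of_int (k $ (i + 1)) + w) = profile (x $ (i + 1) + w)" for x and k :: "int ^ 2"
    using int_periodicD[OF int_periodic_profile, of "x $ (i + 1) + w" "k $ (i + 1)"] by (simp add: add_ac)
  then show ?thesis by (simp add: periodic_def velocity_def lattice_point_def)
qed

lemma finite_measure_torus_measure: "finite_measure torus_measure" "emeasure torus_measure (space torus_measure) = 1"
proof -
  have "unit_cell \<in> sets lebesgue" by simp
  then have "emeasure torus_measure (space torus_measure) = emeasure lebesgue unit_cell"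
    by (simp add: space_restrict_space emeasure_restrict_space)
  also have "\<dots> = emeasure lborel unit_cell" by (simp add: emeasure_completion main_part_sets)
  also have "\<dots> = emeasure torus UNIV"
    by (simp add: torus_def emeasure_density)
  also have "\<dots> = 1" using torus.emeasure_space_1 by simp
  finally show e: "emeasure torus_measure (space torus_measure) = 1" .
  show "finite_measure torus_measure" by standard (simp only: e, simp)
qed

lemma borel_measurable_lebesgue_on: "f \<in> borel_measurable borel \<Longrightarrow> f \<in> borel_measurable (lebesgue_on S)"
  by (rule measurable_restrict_space1) (simp add: measurable_completion)

lemma torus_measure_integrable_bounded:
  fixes f :: "real ^ 2 \<Rightarrow> 'a::{banach, second_countable_topology}"
  assumes "f \<in> borel_measurable borel" "\<And>x. norm (f x) \<le> B"
  shows "integrable torus_measure f"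
  by (rule finite_measure.integrable_const_bound[OF finite_measure_torus_measure(1), of _ B])
     (use assms borel_measurable_lebesgue_on in auto)

lemma pt_eq_add: "pt i (s, y) = pt i (0, y) + s *\<^sub>R axis i 1" "pt i (x, s) = pt i (x, 0) + s *\<^sub>R axis (i + 1) 1"
  by (simp_all add: vec2_eq_iff[of _ _ i]) (simp_all add: axis_def)

lemma DERIV_pt:
  assumes "C_infinity \<psi>"
  shows "((\<lambda>s. \<psi> (pt i (s, y))) has_real_derivative frechet_derivative \<psi> (at (pt i (s, y))) (axis i 1)) (at s)"
    and "((\<lambda>s. \<psi> (pt i (x, s))) has_real_derivative frechet_derivative \<psi> (at (pt i (x, s))) (axis (i + 1) 1)) (at s)"
proof -
  have "((\<lambda>s. pt i (s, y)) has_vector_derivative axis i 1) (at s)"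
    by (subst pt_eq_add(1)) (auto intro!: derivative_eq_intros)
  then show "((\<lambda>s. \<psi> (pt i (s, y))) has_real_derivative frechet_derivative \<psi> (at (pt i (s, y))) (axis i 1)) (at s)"
    by (rule DERIV_along_line[OF assms])
  have "((\<lambda>s. pt i (x, s)) has_vector_derivative axis (i + 1) 1) (at s)"
    by (subst pt_eq_add(2)) (auto intro!: derivative_eq_intros)
  then show "((\<lambda>s. \<psi> (pt i (x, s))) has_real_derivative frechet_derivative \<psi> (at (pt i (x, s))) (axis (i + 1) 1)) (at s)"
    by (rule DERIV_along_line[OF assms])
qed

lemma axis_Basis [simp]: "axis i (1 :: real) \<in> Basis"
  by (simp add: axis_in_Basis_iff)

lemma test_function_partial:
  assumes "test_function \<psi>"
  shows "(\<lambda>x. frechet_derivative \<psi> (at x) (axis j 1)) \<in> borel_measurable borel"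
    "periodic (\<lambda>x. frechet_derivative \<psi> (at x) (axis j 1))"
    "\<exists>B. \<forall>x. \<bar>frechet_derivative \<psi> (at x) (axis j 1)\<bar> \<le> B"
proof -
  have C: "C_infinity \<psi>" and P: "periodic \<psi>" using assms by (auto simp: test_function_def)
  have c: "continuous_on UNIV (\<lambda>x. frechet_derivative \<psi> (at x) (axis j 1))"
    by (rule C_infinity_continuous_partial[OF C]) simp
  then show "(\<lambda>x. frechet_derivative \<psi> (at x) (axis j 1)) \<in> borel_measurable borel"
    by (rule borel_measurable_continuous_onI)
  show p: "periodic (\<lambda>x. frechet_derivative \<psi> (at x) (axis j 1))"
    using frechet_derivative_translate[OF C] P by (simp add: periodic_def)
  show "\<exists>B. \<forall>x. \<bar>frechet_derivative \<psi> (at x) (axis j 1)\<bar> \<le> B"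
    by (rule periodic_continuous_bounded_space[OF c p]) blast
qed

lemma test_function_bounded:
  assumes "test_function \<psi>"
  shows "\<psi> \<in> borel_measurable borel" "\<exists>B. \<forall>x. \<bar>\<psi> x\<bar> \<le> B" "continuous_on UNIV \<psi>" "periodic \<psi>"
proof -
  have C: "C_infinity \<psi>" and P: "periodic \<psi>" using assms by (auto simp: test_function_def)
  show c: "continuous_on UNIV \<psi>" by (rule C_infinity_continuous[OF C])
  then show "\<psi> \<in> borel_measurable borel" by (rule borel_measurable_continuous_onI)
  show "\<exists>B. \<forall>x. \<bar>\<psi> x\<bar> \<le> B" by (rule periodic_continuous_bounded_space[OF c P]) blast
  show "periodic \<psi>" by fact
qed

text \<open>Along axis \<open>i\<close> the profile is constant, so the integrand is a constant
  times the derivative of a periodic function. This yields both the vanishing divergence and the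
  zero diagonal entry of the Jacobian.\<close>

lemma shear_partial_integral:
  assumes \<psi>: "test_function \<psi>"
  shows "(LINT x|torus. profile (x $ (i + 1) + w) * frechet_derivative \<psi> (at x) (axis i 1)) = 0"
proof -
  note [measurable] = test_function_partial(1)[OF \<psi>]
  have C: "C_infinity \<psi>" and P: "periodic \<psi>" using \<psi> by (auto simp: test_function_def)
  obtain B where B: "\<And>x. \<bar>frechet_derivative \<psi> (at x) (axis i 1)\<bar> \<le> B"
    using test_function_partial(3)[OF \<psi>] by blast
  have b: "\<bar>profile y * frechet_derivative \<psi> (at x) (axis i 1)\<bar> \<le> 10000 * B" for x y
    unfolding abs_mult using profile_nonneg profile_le B by (intro mult_mono) auto
  have "(LINT x|circle. frechet_derivative \<psi> (at (pt i (x, y))) (axis i 1)) = 0" for y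
  proof (rule circle_integral_derivative_periodic[where S="{}" and B=B])
    show "int_periodic (\<lambda>x. \<psi> (pt i (x, y)))"
      using periodic_pt[OF P, of i _ _ y 0] by (simp add: int_periodic_def)
    show "continuous_on {0..1} (\<lambda>x. \<psi> (pt i (x, y)))"
      using DERIV_pt(1)[OF C] by (intro DERIV_continuous_on) (auto intro: DERIV_subset)
  qed (use DERIV_pt(1)[OF C] B in auto)
  then have "(LINT z|circle2. profile (snd z + w) * frechet_derivative \<psi> (at (pt i z)) (axis i 1)) = 0"
    by (subst circle2_integral_iterated(1)[where B="10000 * B"]) (use b in auto)
  then show ?thesis by (subst torus_integral_pt[of _ i]) auto
qed

text \<open>Integration by parts along the transverse axis: the product of the profile and
  \<open>\<psi>\<close> is continuous, periodic and differentiable off finitely many points, so its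
  derivative has mean zero.\<close>

lemma shear_cross_partial_integral:
  assumes \<psi>: "test_function \<psi>"
  shows "(LINT x|torus. profile (x $ (i + 1) + w) * frechet_derivative \<psi> (at x) (axis (i + 1) 1)) =
     - (LINT x|torus. profile_deriv (x $ (i + 1) + w) * \<psi> x)"
proof -
  note [measurable] = test_function_partial(1)[OF \<psi>] test_function_bounded(1)[OF \<psi>]
  have C: "C_infinity \<psi>" and P: "periodic \<psi>" using \<psi> by (auto simp: test_function_def)
  obtain B1 where B1: "\<And>x. \<bar>frechet_derivative \<psi> (at x) (axis (i + 1) 1)\<bar> \<le> B1"
    using test_function_partial(3)[OF \<psi>] by blast
  obtain B2 where B2: "\<And>x. \<bar>\<psi> x\<bar> \<le> B2" using test_function_bounded(2)[OF \<psi>] by blast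
  have b1: "\<bar>profile y * frechet_derivative \<psi> (at x) (axis (i + 1) 1)\<bar> \<le> 10000 * B1" for x y
    unfolding abs_mult using profile_nonneg profile_le B1 by (intro mult_mono) auto
  have b2: "\<bar>profile_deriv y * \<psi> x\<bar> \<le> 10000 * B2" for x y
    unfolding abs_mult using profile_deriv_bound B2 by (intro mult_mono) auto
  have b: "\<bar>profile y * frechet_derivative \<psi> (at x) (axis (i + 1) 1) + profile_deriv y * \<psi> x\<bar> \<le> 10000 * B1 + 10000 * B2" for x y
    using abs_triangle_ineq[of "profile y * frechet_derivative \<psi> (at x) (axis (i + 1) 1)" "profile_deriv y * \<psi> x"]
      b1[of y x] b2[of y x] by linarith
  have z: "(LINT y|circle. profile (y + w) * frechet_derivative \<psi> (at (pt i (x, y))) (axis (i + 1) 1) +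
      profile_deriv (y + w) * \<psi> (pt i (x, y))) = 0" for x
  proof (rule circle_integral_derivative_periodic[where S="{y \<in> {0..1}. y + w \<in> \<int>}" and B="10000 * B1 + 10000 * B2"])
    have "profile (y + of_int n + w) = profile (y + w)" for y n
      using int_periodicD[OF int_periodic_profile, of "y + w" n] by (simp add: add_ac)
    then show "int_periodic (\<lambda>y. profile (y + w) * \<psi> (pt i (x, y)))"
      using periodic_pt[OF P, of i x 0] by (simp add: int_periodic_def)
    have "continuous_on {0..1} (\<lambda>y. \<psi> (pt i (x, y)))"
      using DERIV_pt(2)[OF C] by (intro DERIV_continuous_on) (auto intro: DERIV_subset)
    then show "continuous_on {0..1} (\<lambda>y. profile (y + w) * \<psi> (pt i (x, y)))"
      by (intro continuous_intros)
    show "((\<lambda>y. profile (y + w) * \<psi> (pt i (x, y))) has_real_derivative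
        profile (y + w) * frechet_derivative \<psi> (at (pt i (x, y))) (axis (i + 1) 1) +
        profile_deriv (y + w) * \<psi> (pt i (x, y))) (at y)"
      if "y \<in> {0<..<1} - {y \<in> {0..1}. y + w \<in> \<int>}" for y
    proof -
      have "((\<lambda>y. profile (y + w)) has_real_derivative profile_deriv (y + w)) (at y)"
        using profile_has_derivative[of "y + w"] that by (simp add: DERIV_shift)
      from DERIV_mult[OF this DERIV_pt(2)[OF C, of i x y]] show ?thesis by (simp add: algebra_simps)
    qed
  qed (use b finite_shifted_Ints[of 0 1 w] in auto)
  have m1: "(\<lambda>z. profile (snd z + w) * frechet_derivative \<psi> (at (pt i z)) (axis (i + 1) 1)) \<in> borel_measurable (borel \<Otimes>\<^sub>M borel)"
    and m2: "(\<lambda>z. profile_deriv (snd z + w) * \<psi> (pt i z)) \<in> borel_measurable (borel \<Otimes>\<^sub>M borel)"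
    by measurable
  have "0 = (LINT z|circle2. profile (snd z + w) * frechet_derivative \<psi> (at (pt i z)) (axis (i + 1) 1) +
      profile_deriv (snd z + w) * \<psi> (pt i z))"
    by (subst circle2_integral_iterated(2)[where B="10000 * B1 + 10000 * B2"])
       (use b m1 m2 in \<open>auto simp: z\<close>)
  also have "\<dots> = (LINT z|circle2. profile (snd z + w) * frechet_derivative \<psi> (at (pt i z)) (axis (i + 1) 1)) +
      (LINT z|circle2. profile_deriv (snd z + w) * \<psi> (pt i z))"
    using circle2_integrable_bounded[OF m1, of "10000 * B1"] circle2_integrable_bounded[OF m2, of "10000 * B2"] b1 b2
    by (intro Bochner_Integration.integral_add) auto
  finally show ?thesis
    by (subst (1 2) torus_integral_pt[of _ i]) auto
qed

lemma divergence_free_velocity: "divergence_free (velocity i w)"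
  unfolding divergence_free_def
proof (intro conjI allI impI)
  show "integrable torus_measure (velocity i w)"
    by (rule torus_measure_integrable_bounded[OF _ norm_velocity_le]) simp
  fix \<psi> assume \<psi>: "test_function \<psi>"
  then have C: "C_infinity \<psi>" by (simp add: test_function_def)
  note [measurable] = test_function_partial(1)[OF \<psi>]
  show "(LINT x|torus_measure. frechet_derivative \<psi> (at x) (velocity i w x)) = 0"
    unfolding velocity_def frechet_derivative_scaleR[OF C]
    by (subst torus_measure_integral) (auto simp: shear_partial_integral[OF \<psi>])
qed

lemma weak_gradient_velocity: "weak_gradient (velocity i w) (velocity_jacobian i w)"
  unfolding weak_gradient_def
proof (intro conjI allI impI)
  show "integrable torus_measure (velocity i w)"
    by (rule torus_measure_integrable_bounded[OF _ norm_velocity_le]) simp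
  show "integrable torus_measure (velocity_jacobian i w)"
    by (rule torus_measure_integrable_bounded[OF _ norm_velocity_jacobian_le]) simp
  fix \<psi> l j assume \<psi>: "test_function \<psi>"
  note [measurable] = test_function_partial(1)[OF \<psi>] test_function_bounded(1)[OF \<psi>]
  have v: "velocity i w x $ l = (if l = i then profile (x $ (i + 1) + w) else 0)" for x
    by (simp add: velocity_def axis_def)
  have J: "velocity_jacobian i w x $ l $ j = (if l = i \<and> j = i + 1 then profile_deriv (x $ (i + 1) + w) else 0)" for x
    by (simp add: velocity_jacobian_def axis_def)
  consider "l \<noteq> i" | "l = i" "j = i" | "l = i" "j = i + 1" using index2_cases[of j i] by blast
  then show "(LINT x|torus_measure. velocity i w x $ l * frechet_derivative \<psi> (at x) (axis j 1)) =
      - (LINT x|torus_measure. velocity_jacobian i w x $ l $ j * \<psi> x)"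
  proof cases
    case 1
    then show ?thesis by (simp add: v J)
  next
    case 2
    then show ?thesis
      unfolding v J by (subst torus_measure_integral) (auto simp: shear_partial_integral[OF \<psi>])
  next
    case 3
    then show ?thesis
      unfolding v J by (subst (1 2) torus_measure_integral) (auto simp: shear_cross_partial_integral[OF \<psi>])
  qed
qed

text \<open>The torus has total measure 1, so a pointwise bound dominates every Lebesgue norm with
  the same constant.\<close>

lemma Lp_norm_le:
  fixes G :: "real ^ 2 \<Rightarrow> 'a::{real_normed_vector, second_countable_topology}"
  assumes "G \<in> borel_measurable borel" and G: "\<And>x. norm (G x) \<le> K" and p: "1 \<le> p"
  shows "Lp_norm p G \<le> ennreal K"
proof -
  have [measurable]: "G \<in> borel_measurable torus_measure"
    by (rule borel_measurable_lebesgue_on) fact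
  have K: "0 \<le> K" using order_trans[OF norm_ge_zero G] .
  show ?thesis
  proof (cases "p = \<infinity>")
    case True
    have "esssup torus_measure (\<lambda>x. ennreal (norm (G x))) \<le> ennreal K"
      by (rule esssup_I) (auto intro!: ennreal_leI G AE_I2)
    with True show ?thesis by (simp add: Lp_norm_def)
  next
    case False
    define q where "q = enn2real p"
    have "enn2real 1 \<le> enn2real p" using p False by (intro enn2real_mono) (auto simp: less_top)
    then have q: "1 \<le> q" by (simp add: q_def)
    let ?I = "\<integral>\<^sup>+ x. ennreal (norm (G x) powr q) \<partial>torus_measure"
    have "?I \<le> (\<integral>\<^sup>+ x. ennreal (K powr q) \<partial>torus_measure)"
      using q G by (intro nn_integral_mono ennreal_leI powr_mono2) auto
    also have "\<dots> = ennreal (K powr q)"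
      by (simp only: nn_integral_const finite_measure_torus_measure(2) mult_1_right)
    finally have I: "?I \<le> ennreal (K powr q)" .
    then have "?I \<noteq> \<infinity>" using neq_top_trans[OF ennreal_neq_top] by auto
    have "enn2real ?I powr (1 / q) \<le> (K powr q) powr (1 / q)"
      using I q by (intro powr_mono2) (auto intro!: enn2real_leI)
    also have "\<dots> = K" using q K by (simp add: powr_powr)
    finally show ?thesis
      using False \<open>?I \<noteq> \<infinity>\<close> by (simp add: Lp_norm_def ennreal_powr_def ennreal_leI flip: q_def)
  qed
qed

lemma W1p_seminorm_velocity_le: "1 \<le> p \<Longrightarrow> W1p_seminorm p (velocity i w) \<le> ennreal 10000"
  unfolding W1p_seminorm_def
  by (rule INF_lower2[of "velocity_jacobian i w"], simp add: weak_gradient_velocity)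
     (rule Lp_norm_le[OF velocity_jacobian_measurable norm_velocity_jacobian_le])

section \<open>The flow\<close>

lemma lebesgue_on_integral:
  fixes f :: "'a::euclidean_space \<Rightarrow> 'b::{banach, second_countable_topology}"
  assumes [measurable]: "S \<in> sets borel" "f \<in> borel_measurable borel"
  shows "(LINT x|lebesgue_on S. f x) = (LINT x|lborel. indicator S x *\<^sub>R f x)"
proof -
  have "(LINT x|lebesgue_on S. f x) = (LINT x|lebesgue. indicator S x *\<^sub>R f x)"
    by (rule integral_restrict_space) simp
  also have "\<dots> = (LINT x|lborel. indicator S x *\<^sub>R f x)"
    by (rule integral_completion) simp
  finally show ?thesis .
qed

text \<open>A block of unit duration is parametrized by the circle measure in the elapsed time, so
  that the one-dimensional integral lemmas apply to it.\<close>

lemma lborel_block_integral: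
  fixes g :: "real \<times> (real ^ 2) \<Rightarrow> real"
  assumes [measurable]: "g \<in> borel_measurable borel"
    and B: "\<And>t x. t \<in> {c..<c+1} \<Longrightarrow> \<bar>g (t, x)\<bar> \<le> B"
  shows "(LINT z|lborel. indicator ({c..<c+1} \<times> unit_cell) z * g z) = (LINT s|circle. (LINT x|torus. g (c + s, x)))"
    and "integrable lborel (\<lambda>z. indicator ({c..<c+1} \<times> unit_cell) z * g z)"
proof -
  have [measurable]: "g \<in> borel_measurable (borel \<Otimes>\<^sub>M borel)" unfolding borel_prod by fact
  have [measurable]: "{c..<c+1} \<times> unit_cell \<in> sets (borel \<Otimes>\<^sub>M borel)" by (intro pair_measureI) auto
  have B0: "0 \<le> B" using order_trans[OF abs_ge_zero B[of c]] by simp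
  have em: "emeasure (lborel \<Otimes>\<^sub>M lborel) ({c..<c+1} \<times> unit_cell) = emeasure lborel {c..<c+1} * emeasure lborel unit_cell"
    by (rule lborel.emeasure_pair_measure_Times) auto
  have cell: "emeasure lborel unit_cell = 1"
    using torus.emeasure_space_1 by (simp add: torus_def emeasure_density)
  have int: "integrable (lborel \<Otimes>\<^sub>M lborel) (\<lambda>z. indicator ({c..<c+1} \<times> unit_cell) z *\<^sub>R g z)"
    by (rule integrableI_bounded_set_indicator[where B=B])
       (use B in \<open>auto simp: em cell measurable_cong_sets[OF sets_pair_measure_cong[OF sets_lborel sets_lborel] refl] sets_pair_measure_cong[OF sets_lborel sets_lborel]\<close>)
  then show "integrable lborel (\<lambda>z. indicator ({c..<c+1} \<times> unit_cell) z * g z)"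
    by (simp add: lborel_prod)
  have "(LINT z|lborel. indicator ({c..<c+1} \<times> unit_cell) z * g z) =
      (LINT z|(lborel \<Otimes>\<^sub>M lborel). indicator ({c..<c+1} \<times> unit_cell) z *\<^sub>R g z)"
    by (simp add: lborel_prod)
  also have "\<dots> = (LINT t|lborel. (LINT x|lborel. indicator ({c..<c+1} \<times> unit_cell) (t, x) *\<^sub>R g (t, x)))"
    by (rule lborel_pair.integral_fst'[OF int, symmetric])
  also have "\<dots> = (LINT t|lborel. indicator {c..<c+1} t *\<^sub>R (LINT x|torus. g (t, x)))"
  proof (rule Bochner_Integration.integral_cong)
    fix t
    have "(LINT x|torus. g (t, x)) = (LINT x|lborel. indicator unit_cell x *\<^sub>R g (t, x))"
      unfolding torus_def using integral_density[of "\<lambda>x. g (t, x)" lborel "indicator unit_cell"]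
      by (simp add: ennreal_indicator)
    then show "(LINT x|lborel. indicator ({c..<c+1} \<times> unit_cell) (t, x) *\<^sub>R g (t, x)) =
        indicator {c..<c+1} t *\<^sub>R (LINT x|torus. g (t, x))"
      by (simp add: indicator_times mult.assoc)
  qed simp
  also have "\<dots> = (LINT s|lborel. indicator {0..<1} s *\<^sub>R (LINT x|torus. g (c + s, x)))"
    by (subst lborel_integral_real_affine[of 1 _ c])
       (auto intro!: Bochner_Integration.integral_cong simp: indicator_def)
  also have "\<dots> = (LINT s|circle. (LINT x|torus. g (c + s, x)))"
    unfolding circle_eq by (rule integral_density[symmetric]) auto
  finally show "(LINT z|lborel. indicator ({c..<c+1} \<times> unit_cell) z * g z) = (LINT s|circle. (LINT x|torus. g (c + s, x)))" .
qed

lemma lipschitz_decay_min: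
  "lipschitz_decay f a \<Longrightarrow> lipschitz_decay f b \<Longrightarrow> lipschitz_decay f (min a b)"
  by (auto simp: min_def)

lemma lipschitz_constant_nonneg:
  fixes \<phi> :: "real ^ 2 \<Rightarrow> real"
  assumes "\<And>x y. \<bar>\<phi> x - \<phi> y\<bar> \<le> L * norm (x - y)"
  shows "0 \<le> L"
  using order_trans[OF abs_ge_zero assms[of "axis 1 1" 0]] by simp

text \<open>The trivial constant keeps \<open>\<delta> \<le> 1\<close> while the exponential bound
  still exceeds 1.\<close>

lemma lipschitz_decay_1:
  assumes "torus_function f"
  shows "lipschitz_decay f 1"
  unfolding lipschitz_decay_def
proof (intro allI impI)
  fix \<phi> L assume \<phi>: "torus_function \<phi> \<and> (\<forall>x y. \<bar>\<phi> x - \<phi> y\<bar> \<le> L * norm (x - y))"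
  then have L: "0 \<le> L" using lipschitz_constant_nonneg by blast
  note [measurable] = torus_functionD(1)[OF assms] torus_functionD(1)[OF conjunct1[OF \<phi>]]
  have "norm (LINT x|torus. f x * \<phi> x) \<le> 1"
    using torus_functionD(2)[OF assms] torus_functionD(2)[OF conjunct1[OF \<phi>]]
    by (intro norm_torus_integral_le) (auto simp: abs_mult intro!: mult_le_one)
  then show "\<bar>LINT x|torus. f x * \<phi> x\<bar> \<le> (1 + L) * 1" using L by simp
qed

text \<open>The outcome of choosing the phases: \<open>R n\<close> is the density at time
  \<open>n\<close>, and \<open>w n\<close> the phase of the shear acting from \<open>n\<close> to
  \<open>n + 1\<close>. Its axis \<open>of_nat n\<close> alternates with the parity of
  \<open>n\<close>, and the energy is taken in coordinates that list this axis first.\<close>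

locale mixer =
  fixes R :: "nat \<Rightarrow> real ^ 2 \<Rightarrow> real" and w :: "nat \<Rightarrow> real"
  assumes R_measurable [measurable]: "R n \<in> borel_measurable borel"
    and R_periodic: "periodic (R n)"
    and R_values: "R n x \<in> {1, -1}"
    and R_mean: "(LINT x|torus. R n x) = 0"
    and R_Suc: "R (Suc n) x = R n (shear (of_nat n) (w n) (- 1) x)"
    and R_energy: "energy (\<lambda>z. R n (pt (of_nat n) z)) \<le> ennreal (4 / 2 ^ n)"
begin

text \<open>The density at time \<open>n + s\<close>: values are carried along trajectories, hence
  the backward flow.\<close>

definition block :: "nat \<Rightarrow> real \<Rightarrow> real ^ 2 \<Rightarrow> real" where
  "block n s x = R n (shear (of_nat n) (w n) (- s) x)"

definition dens :: "real \<Rightarrow> real ^ 2 \<Rightarrow> real" where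
  "dens t = block (nat \<lfloor>t\<rfloor>) (t - real (nat \<lfloor>t\<rfloor>))"

definition vel :: "real \<Rightarrow> real ^ 2 \<Rightarrow> real ^ 2" where
  "vel t = velocity (of_nat (nat \<lfloor>t\<rfloor>)) (w (nat \<lfloor>t\<rfloor>))"

lemma torus_function_R: "torus_function (R n)"
proof -
  have "\<bar>R n x\<bar> \<le> 1" for x using R_values[of n x] by auto
  then show ?thesis by (simp add: torus_function_def R_periodic)
qed

lemma torus_function_block: "torus_function (block n s)"
  unfolding block_def[abs_def] by (rule torus_function_shear[OF torus_function_R])

lemma torus_function_dens: "torus_function (dens t)"
  by (simp add: dens_def torus_function_block)

lemma dens_values: "dens t x \<in> {1, -1}"
  unfolding dens_def block_def by (rule R_values)

lemma dens_measurable_pair [measurable]: "(\<lambda>z. dens (fst z) (snd z)) \<in> borel_measurable (borel \<Otimes>\<^sub>M borel)"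
proof -
  have [measurable]: "(\<lambda>t :: real. nat \<lfloor>t\<rfloor>) \<in> borel \<rightarrow>\<^sub>M count_space UNIV" by measurable
  show ?thesis unfolding dens_def block_def by measurable
qed

lemma nat_floor_block: "t \<in> {real n..<real n + 1} \<Longrightarrow> nat \<lfloor>t\<rfloor> = n"
  by (simp add: floor_eq_iff nat_eq_iff)

text \<open>At the right endpoint \<open>dens\<close> already belongs to the next block, and
  \<open>R_Suc\<close> identifies the two formulas. This makes the density weakly continuous across
  integer times.\<close>

lemma dens_block:
  assumes "t \<in> {real n..real n + 1}"
  shows "dens t = block n (t - real n)"
proof (cases "t = real n + 1")
  case True
  have "nat \<lfloor>t\<rfloor> = Suc n" using nat_floor_block[of t "Suc n"] True by simp
  then show ?thesis using True by (simp add: dens_def block_def[abs_def] R_Suc)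
next
  case False
  then show ?thesis using nat_floor_block[of t n] assms by (simp add: dens_def)
qed

lemma block_integral:
  assumes "\<phi> \<in> borel_measurable borel" "periodic \<phi>" "\<And>x. \<bar>\<phi> x\<bar> \<le> B"
  shows "(LINT x|torus. block n s x * \<phi> x) = (LINT x|torus. R n x * \<phi> (shear (of_nat n) (w n) s x))"
  unfolding block_def by (rule torus_integral_shear_move[OF torus_function_R assms])

lemma dens_mean: "(LINT x|torus. dens t x) = 0"
  using block_integral[of "\<lambda>_. 1" 1 "nat \<lfloor>t\<rfloor>"] R_mean by (simp add: dens_def periodic_def)

lemma R_pairing:
  assumes \<phi>: "torus_function \<phi>" and lip: "\<And>x y. \<bar>\<phi> x - \<phi> y\<bar> \<le> L * norm (x - y)"
  shows "\<bar>LINT x|torus. R n x * \<phi> x\<bar> \<le> 18 * (1 + L) * (1 / sqrt 2) ^ (n div 16)"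
proof -
  note [measurable] = torus_functionD(1)[OF \<phi>]
  let ?i = "of_nat n :: 2" and ?m = "n div 16"
  have norm1: "norm (pt ?i (x, y) - pt ?i (x', y)) = \<bar>x - x'\<bar>" for x x' y
    by (subst (1 2) pt_eq_add(1)) (simp flip: scaleR_left_diff_distrib)
  have norm2: "norm (pt ?i (x, y) - pt ?i (x, y')) = \<bar>y - y'\<bar>" for x y y'
    by (subst (1 2) pt_eq_add(2)) (simp flip: scaleR_left_diff_distrib)
  have "energy (\<lambda>z. R n (pt ?i z)) \<le> ennreal (4 / 2 ^ (16 * ?m))"
  proof (rule order_trans[OF R_energy ennreal_leI])
    show "4 / 2 ^ n \<le> 4 / (2 :: real) ^ (16 * ?m)"
      by (intro divide_left_mono power_increasing) auto
  qed
  moreover have "fc (\<lambda>z. R n (pt ?i z)) 0 0 = 0"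
    using R_mean[of n] by (simp add: fc_def torus_integral_pt[of _ ?i])
  ultimately have "\<bar>LINT z|circle2. R n (pt ?i z) * \<phi> (pt ?i z)\<bar> \<le> 18 * (1 + L) * (1 / sqrt 2) ^ ?m"
    by (intro pairing_decay cell_function_pt torus_function_R \<phi> lip[THEN order_trans])
       (auto simp: norm1 norm2)
  then show ?thesis by (subst torus_integral_pt[of _ ?i]) auto
qed

text \<open>Chosen such that \<open>exp (- rate * t)\<close> is \<open>1 / sqrt 2\<close> to the
  power \<open>t / 16\<close>.\<close>

definition rate :: real where "rate = ln 2 / 32"

text \<open>The 18 is that of \<open>pairing_decay\<close>, 10001 the Lipschitz constant of a
  partial shear, and \<open>sqrt 2\<close> the price of rounding time down to a multiple of
  16.\<close>

definition const :: real where "const = 18 * 10001 * sqrt 2"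

text \<open>The shear performed since the last integer time is moved onto the test function, whose
  Lipschitz constant grows by a factor of at most 10001; \<open>R_pairing\<close> does the
  rest.\<close>

lemma dens_decay:
  assumes "0 \<le> t"
  shows "lipschitz_decay (dens t) (const * exp (- rate * t))"
  unfolding lipschitz_decay_def
proof (intro allI impI)
  fix \<phi> L assume "torus_function \<phi> \<and> (\<forall>x y. \<bar>\<phi> x - \<phi> y\<bar> \<le> L * norm (x - y))"
  then have \<phi>: "torus_function \<phi>" and lip: "\<And>x y. \<bar>\<phi> x - \<phi> y\<bar> \<le> L * norm (x - y)" by auto
  have L: "0 \<le> L" by (rule lipschitz_constant_nonneg[OF lip])
  define n where "n = nat \<lfloor>t\<rfloor>"
  have n: "real n \<le> t" "t < real n + 1" unfolding n_def using assms by linarith+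
  define s where "s = t - real n"
  have s: "\<bar>s\<bar> \<le> 1" using n by (simp add: s_def)
  let ?S = "shear (of_nat n) (w n) s"
  have "(LINT x|torus. dens t x * \<phi> x) = (LINT x|torus. R n x * \<phi> (?S x))"
    using block_integral[OF torus_functionD(1,3,2)[OF \<phi>], of n s] by (simp add: dens_def n_def[symmetric] s_def)
  also have "\<bar>\<dots>\<bar> \<le> 18 * (1 + 10001 * L) * (1 / sqrt 2) ^ (n div 16)"
  proof (rule R_pairing)
    show "torus_function (\<lambda>x. \<phi> (?S x))" by (rule torus_function_shear[OF \<phi>])
    show "\<bar>\<phi> (?S x) - \<phi> (?S y)\<bar> \<le> 10001 * L * norm (x - y)" for x y
      using order_trans[OF lip mult_left_mono[OF norm_shear_diff_le[OF s] L]] by (simp add: mult_ac)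
  qed
  also have "\<dots> \<le> (18 * 10001 * (1 + L)) * (sqrt 2 * exp (- rate * t))"
  proof (rule mult_mono)
    show "18 * (1 + 10001 * L) \<le> 18 * 10001 * (1 + L)" using L by simp
    have e: "1 / sqrt 2 = exp (- (ln 2 / 2))" "sqrt 2 = exp (ln 2 / 2)"
      by (simp_all add: exp_minus powr_half_sqrt[symmetric] powr_def inverse_eq_divide)
    have "n div 16 * 16 + 15 \<ge> n" by presburger
    then have "real n \<le> 16 * real (n div 16) + 15" by linarith
    then have "t / 16 - 1 \<le> real (n div 16)" using n by linarith
    then have "- (ln 2 / 2) * real (n div 16) \<le> - (ln 2 / 2) * (t / 16 - 1)"
      by (intro mult_left_mono_neg) auto
    also have "\<dots> = ln 2 / 2 + - rate * t" by (simp add: rate_def algebra_simps)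
    finally have "exp (- (ln 2 / 2) * real (n div 16)) \<le> sqrt 2 * exp (- rate * t)"
      unfolding e(2) exp_add[symmetric] by (simp only: exp_le_cancel_iff)
    moreover have "(1 / sqrt 2) ^ (n div 16) = exp (- (ln 2 / 2) * real (n div 16))"
      unfolding e(1) by (simp only: exp_of_nat_mult[symmetric] mult.commute)
    ultimately show "(1 / sqrt 2) ^ (n div 16) \<le> sqrt 2 * exp (- rate * t)" by (simp only:)
  qed (use L in auto)
  finally show "\<bar>LINT x|torus. dens t x * \<phi> x\<bar> \<le> (1 + L) * (const * exp (- rate * t))"
    by (simp add: const_def algebra_simps)
qed

lemma rate_pos: "rate > 0" and const_pos: "const > 0"
  by (simp_all add: rate_def const_def)

text \<open>The two scales are of order \<open>sqrt \<delta>\<close> and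
  \<open>\<delta> powr (1 / 3)\<close> with \<open>\<delta>\<close> decaying at \<open>rate\<close>,
  so the slower \<open>rate / 3\<close> serves both.\<close>

lemma mixing_scales:
  assumes "0 < \<kappa>" "\<kappa> < 1 / 2"
  shows "\<exists>C c :: real. C > 0 \<and> c > 0 \<and> (\<forall>t\<ge>0. functional_mixing_scale (dens t) \<le> ennreal (C * exp (- c * t)) \<and>
             geometric_mixing_scale \<kappa> (dens t) \<le> ennreal (C * exp (- c * t)))"
proof -
  define K where "K = 4 * (16 / (pi * (1 - 2 * \<kappa>)\<^sup>2)) powr (1 / 3)"
  have K: "0 \<le> K" by (simp add: K_def)
  define C where "C = 19 * sqrt const + K * const powr (1 / 3)"
  have C: "C > 0" using const_pos K by (auto simp: C_def intro!: add_pos_nonneg)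
  have C1: "19 * sqrt const \<le> C" and C2: "K * const powr (1 / 3) \<le> C"
    using const_pos K by (auto simp: C_def)
  have "functional_mixing_scale (dens t) \<le> ennreal (C * exp (- (rate / 3) * t)) \<and>
      geometric_mixing_scale \<kappa> (dens t) \<le> ennreal (C * exp (- (rate / 3) * t))" if t: "0 \<le> t" for t
  proof
    define D where "D = const * exp (- rate * t)"
    have D: "0 < D" using const_pos by (simp add: D_def)
    have dec: "lipschitz_decay (dens t) (min D 1)"
      unfolding D_def by (intro lipschitz_decay_min dens_decay[OF t] lipschitz_decay_1 torus_function_dens)
    have "functional_mixing_scale (dens t) \<le> ennreal (19 * sqrt (min D 1))"
      by (rule functional_mixing_scale_le[OF torus_function_dens dec]) (use D in auto)
    also have "\<dots> \<le> ennreal (C * exp (- (rate / 3) * t))"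
    proof (rule ennreal_leI)
      have "exp (- rate * t) \<le> (exp (- (rate / 3) * t))\<^sup>2"
        using rate_pos t by (simp flip: exp_double)
      then have "sqrt (exp (- rate * t)) \<le> exp (- (rate / 3) * t)"
        by (intro real_le_lsqrt) auto
      then have "19 * sqrt const * sqrt (exp (- rate * t)) \<le> C * exp (- (rate / 3) * t)"
        using C1 C by (intro mult_mono) auto
      moreover have "sqrt (min D 1) \<le> sqrt D" by simp
      ultimately show "19 * sqrt (min D 1) \<le> C * exp (- (rate / 3) * t)"
        by (simp add: D_def real_sqrt_mult)
    qed
    finally show "functional_mixing_scale (dens t) \<le> ennreal (C * exp (- (rate / 3) * t))" .
    have "geometric_mixing_scale \<kappa> (dens t) \<le> ennreal (K * (min D 1) powr (1 / 3))"
      unfolding K_def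
      by (rule geometric_mixing_scale_le[OF torus_function_dens dens_values dens_mean dec]) (use D assms in auto)
    also have "\<dots> \<le> ennreal (C * exp (- (rate / 3) * t))"
    proof (rule ennreal_leI)
      have "(min D 1) powr (1 / 3) \<le> D powr (1 / 3)" using D by (intro powr_mono2) auto
      also have "\<dots> = const powr (1 / 3) * exp (- (rate / 3) * t)"
        unfolding D_def using const_pos by (simp add: powr_mult) (simp add: powr_def)
      finally have "K * (min D 1) powr (1 / 3) \<le> K * (const powr (1 / 3) * exp (- (rate / 3) * t))"
        by (rule mult_left_mono[OF _ K])
      also have "\<dots> \<le> C * exp (- (rate / 3) * t)"
        using mult_right_mono[OF C2, of "exp (- (rate / 3) * t)"] by (simp add: mult_ac)
      finally show "K * (min D 1) powr (1 / 3) \<le> C * exp (- (rate / 3) * t)" .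
    qed
    finally show "geometric_mixing_scale \<kappa> (dens t) \<le> ennreal (C * exp (- (rate / 3) * t))" .
  qed
  then show ?thesis using C rate_pos by (intro exI[of _ C] exI[of _ "rate / 3"]) auto
qed
end

context mixer
begin

subsection \<open>The velocity field\<close>

lemma vel_measurable_pair [measurable]: "(\<lambda>z. vel (fst z) (snd z)) \<in> borel_measurable (borel \<Otimes>\<^sub>M borel)"
proof -
  have [measurable]: "(\<lambda>t :: real. nat \<lfloor>t\<rfloor>) \<in> borel \<rightarrow>\<^sub>M count_space UNIV" by measurable
  show ?thesis unfolding vel_def velocity_def by measurable
qed

lemma velocity_field_vel: "velocity_field vel"
  unfolding velocity_field_def
proof (intro conjI allI impI)
  show "periodic (vel t)" for t by (simp add: vel_def periodic_velocity)
  fix T :: real assume "0 < T"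
  have [measurable]: "(\<lambda>(t, x). vel t x) \<in> borel_measurable borel"
    using vel_measurable_pair unfolding borel_prod by (simp add: case_prod_beta')
  have S [measurable]: "{0..T} \<times> unit_cell \<in> sets borel"
    unfolding borel_prod[symmetric] by (intro pair_measureI) auto
  have "unit_cell \<subseteq> cbox 0 (\<chi> i. 1)" by (auto simp: unit_cell_def mem_box_cart less_imp_le)
  then have "bounded unit_cell" using bounded_cbox bounded_subset by blast
  then have "bounded ({0..T} \<times> unit_cell)" by (intro bounded_Times) auto
  then have "emeasure lborel ({0..T} \<times> unit_cell) < \<infinity>" by (rule emeasure_bounded_finite)
  then have fin: "finite_measure (lebesgue_on ({0..T} \<times> unit_cell))"
    by (intro finite_measureI)
       (simp add: space_restrict_space emeasure_restrict_space emeasure_completion main_part_sets)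
  show "integrable (lebesgue_on ({0..T} \<times> unit_cell)) (\<lambda>(t, x). vel t x)"
  proof (rule finite_measure.integrable_const_bound[OF fin])
    show "AE z in lebesgue_on ({0..T} \<times> unit_cell). norm (case z of (t, x) \<Rightarrow> vel t x) \<le> 10000"
      by (auto simp: vel_def norm_velocity_le)
  qed (rule borel_measurable_lebesgue_on, simp)
qed

lemma W1p_vel: "1 \<le> p \<Longrightarrow> (SUP t\<in>{0..}. W1p_seminorm p (vel t)) < \<infinity>"
proof -
  assume "1 \<le> p"
  then have "(SUP t\<in>{0..}. W1p_seminorm p (vel t)) \<le> ennreal 10000"
    unfolding vel_def by (intro SUP_least W1p_seminorm_velocity_le)
  then show ?thesis using le_less_trans ennreal_less_top by (metis infinity_ennreal_def)
qed

subsection \<open>Weak continuity in time\<close>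

text \<open>On a closed block the shear acts on the continuous, bounded \<open>\<psi>\<close>
  instead of the density, and dominated convergence applies. Consecutive closed blocks share an
  endpoint, which glues them.\<close>

lemma dens_weakly_continuous:
  assumes \<psi>: "test_function \<psi>"
  shows "continuous_on {0..} (\<lambda>t. LINT x|torus. dens t x * \<psi> x)"
proof -
  define g where "g t = (LINT x|torus. dens t x * \<psi> x)" for t
  note [measurable] = test_function_bounded(1)[OF \<psi>]
  obtain B where B: "\<And>x. \<bar>\<psi> x\<bar> \<le> B" using test_function_bounded(2)[OF \<psi>] by blast
  have block: "continuous_on {real n..real n + 1} g" for n
  proof (rule continuous_on_sequentiallyI)
    fix u :: "nat \<Rightarrow> real" and a :: real
    assume u: "\<forall>k. u k \<in> {real n..real n + 1}" and a: "a \<in> {real n..real n + 1}" and lim: "u \<longlonglongrightarrow> a"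
    have g: "g t = (LINT x|torus. R n x * \<psi> (shear (of_nat n) (w n) (t - real n) x))" if "t \<in> {real n..real n + 1}" for t
      unfolding g_def dens_block[OF that]
      by (rule block_integral[OF _ test_function_bounded(4)[OF \<psi>] B]) simp
    have "(\<lambda>k. LINT x|torus. R n x * \<psi> (shear (of_nat n) (w n) (u k - real n) x)) \<longlonglongrightarrow>
        (LINT x|torus. R n x * \<psi> (shear (of_nat n) (w n) (a - real n) x))"
    proof (rule integral_dominated_convergence[where w="\<lambda>_. B"])
      show "AE x in torus. (\<lambda>k. R n x * \<psi> (shear (of_nat n) (w n) (u k - real n) x)) \<longlonglongrightarrow>
          R n x * \<psi> (shear (of_nat n) (w n) (a - real n) x)"
      proof (rule AE_I2)
        fix x
        have "(\<lambda>k. shear (of_nat n) (w n) (u k - real n) x) \<longlonglongrightarrow> shear (of_nat n) (w n) (a - real n) x"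
          unfolding shear_def by (intro tendsto_intros lim)
        then have "(\<lambda>k. \<psi> (shear (of_nat n) (w n) (u k - real n) x)) \<longlonglongrightarrow> \<psi> (shear (of_nat n) (w n) (a - real n) x)"
          by (rule continuous_on_tendsto_compose[OF test_function_bounded(3)[OF \<psi>]]) auto
        then show "(\<lambda>k. R n x * \<psi> (shear (of_nat n) (w n) (u k - real n) x)) \<longlonglongrightarrow>
          R n x * \<psi> (shear (of_nat n) (w n) (a - real n) x)"
          by (intro tendsto_intros)
      qed
      show "AE x in torus. norm (R n x * \<psi> (shear (of_nat n) (w n) (u k - real n) x)) \<le> B" for k
      proof (rule AE_I2)
        fix x
        show "norm (R n x * \<psi> (shear (of_nat n) (w n) (u k - real n) x)) \<le> B"
          using R_values[of n x] B by (auto simp: abs_mult)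
      qed
    qed auto
    then show "(\<lambda>k. g (u k)) \<longlonglongrightarrow> g a" using u a g by simp
  qed
  have prefix: "continuous_on {0..real n} g" for n
  proof (induction n)
    case (Suc n)
    have "{0..real (Suc n)} = {0..real n} \<union> {real n..real n + 1}" by auto
    then show ?case using Suc block[of n] by (simp add: continuous_on_closed_Un)
  qed simp
  have "continuous_on {0..} g"
    unfolding continuous_on_eq_continuous_within
  proof
    fix t :: real assume t: "t \<in> {0..}"
    obtain n where n: "t < real n" using reals_Archimedean2 by blast
    have "continuous (at t within {0..real n}) g"
      using prefix[of n] t n by (auto simp: continuous_on_eq_continuous_within)
    moreover have "at t within {0..real n} = at t within {0..}"
      by (rule at_within_nhd[of _ "{..<real n}"]) (use n in auto)
    ultimately show "continuous (at t within {0..}) g" by (simp add: continuous_within)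
  qed
  then show ?thesis by (simp add: g_def)
qed

subsection \<open>The continuity equation\<close>

definition transport :: "(real \<times> (real ^ 2) \<Rightarrow> real) \<Rightarrow> real \<Rightarrow> real ^ 2 \<Rightarrow> real" where
  "transport \<phi> t x = frechet_derivative \<phi> (at (t, x)) (1, 0) + frechet_derivative \<phi> (at (t, x)) (0, vel t x)"

text \<open>\<open>transport\<close> may jump at integer times together with the velocity. On a
  block it agrees with this function, whose velocity is frozen and which is continuous on all of
  space-time.\<close>

definition block_transport :: "(real \<times> (real ^ 2) \<Rightarrow> real) \<Rightarrow> nat \<Rightarrow> real \<times> (real ^ 2) \<Rightarrow> real" where
  "block_transport \<phi> n z = frechet_derivative \<phi> (at z) (1, 0) +
     profile (snd z $ (of_nat n + 1) + w n) * frechet_derivative \<phi> (at z) (0, axis (of_nat n) 1)"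

lemma transport_block:
  assumes "C_infinity \<phi>" "nat \<lfloor>t\<rfloor> = n"
  shows "transport \<phi> t x = block_transport \<phi> n (t, x)"
proof -
  have "(0, velocity (of_nat n) (w n) x) = profile (x $ (of_nat n + 1) + w n) *\<^sub>R (0 :: real, axis (of_nat n) 1 :: real ^ 2)"
    by (simp add: velocity_def)
  then show ?thesis
    unfolding transport_def block_transport_def vel_def assms(2)
    by (simp only: frechet_derivative_scaleR[OF assms(1)] snd_conv)
qed

lemma Basis_spacetime [simp]: "(1, 0) \<in> (Basis :: (real \<times> (real ^ 2)) set)" "(0, axis i 1) \<in> (Basis :: (real \<times> (real ^ 2)) set)"
  by (auto simp: Basis_prod_def)

lemma block_transport_facts:
  assumes "C_infinity \<phi>" "\<And>t. periodic (\<lambda>x. \<phi> (t, x))"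
  shows "continuous_on UNIV (block_transport \<phi> n)" "periodic (\<lambda>x. block_transport \<phi> n (t, x))"
proof -
  show "continuous_on UNIV (block_transport \<phi> n)"
    unfolding block_transport_def
    by (intro continuous_intros C_infinity_continuous_partial[OF assms(1)]) auto
  have "frechet_derivative \<phi> (at (t, x + lattice_point k)) = frechet_derivative \<phi> (at (t, x))" for x k
    using frechet_derivative_translate[OF assms(1), of "(0, lattice_point k)" "(t, x)"] assms(2)
    by (simp add: periodic_def split_paired_all)
  moreover have "profile ((x + lattice_point k) $ j + w n) = profile (x $ j + w n)" for x k j
    using int_periodicD[OF int_periodic_profile, of "x $ j + w n" "k $ j"] by (simp add: lattice_point_def add_ac)
  ultimately show "periodic (\<lambda>x. block_transport \<phi> n (t, x))"
    by (simp add: periodic_def block_transport_def del: vector_add_component)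
qed

text \<open>Along the trajectories \<open>s \<mapsto> shear i w s x\<close> the integrand is a total derivative.\<close>

lemma block_transport_integral:
  assumes C: "C_infinity \<phi>" and P: "\<And>t. periodic (\<lambda>x. \<phi> (t, x))"
  shows "(LINT s|circle. LINT x|torus. block n s x * block_transport \<phi> n (real n + s, x)) =
     (LINT x|torus. R (Suc n) x * \<phi> (real (Suc n), x)) - (LINT x|torus. R n x * \<phi> (real n, x))"
proof -
  let ?i = "of_nat n :: 2"
  let ?S = "\<lambda>s x. shear ?i (w n) s x"
  let ?b = "block_transport \<phi> n"
  note bt = block_transport_facts[OF C P, of n]
  have b_meas [measurable]: "?b \<in> borel_measurable (borel \<Otimes>\<^sub>M borel)"
    unfolding borel_prod by (rule borel_measurable_continuous_onI[OF bt(1)])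
  have \<phi>_cont: "continuous_on UNIV \<phi>" by (rule C_infinity_continuous[OF C])
  have \<phi>_meas [measurable]: "\<phi> \<in> borel_measurable (borel \<Otimes>\<^sub>M borel)"
    unfolding borel_prod by (rule borel_measurable_continuous_onI[OF \<phi>_cont])
  obtain B where B: "\<And>t x. t \<in> {real n..real n + 1} \<Longrightarrow> \<bar>?b (t, x)\<bar> \<le> B"
    by (rule periodic_continuous_bounded[OF bt(1) bt(2)]) blast
  obtain B2 where B2: "\<And>t x. t \<in> {real n..real n + 1} \<Longrightarrow> \<bar>\<phi> (t, x)\<bar> \<le> B2"
    by (rule periodic_continuous_bounded[OF \<phi>_cont P]) blast
  \<comment> \<open>Confining time to the unit interval makes the bound \<open>B\<close> valid for
    every real \<open>s\<close>, as the integrability lemmas demand; almost everywhere for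
    \<open>circle\<close> it is the identity.\<close>
  define clamp where "clamp s = max 0 (min 1 (s :: real))" for s
  have cl: "real n + clamp s \<in> {real n..real n + 1}" for s by (simp add: clamp_def)
  have cl_id: "clamp s = s" if "s \<in> {0..1}" for s using that by (simp add: clamp_def)
  have [measurable]: "clamp \<in> borel_measurable borel" unfolding clamp_def by measurable
  have bB: "\<bar>R n x * ?b (real n + clamp s, y)\<bar> \<le> B" for x y s
    using R_values[of n x] B[OF cl, of s y] by (auto simp: abs_mult)
  have "(LINT s|circle. LINT x|torus. block n s x * ?b (real n + s, x)) =
      (LINT s|circle. LINT x|torus. R n x * ?b (real n + clamp s, ?S s x))"
  proof (rule integral_cong_AE)
    show "AE s in circle. (LINT x|torus. block n s x * ?b (real n + s, x)) =
        (LINT x|torus. R n x * ?b (real n + clamp s, ?S s x))"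
      using AE_circle
    proof eventually_elim
      case (elim s)
      then have s: "real n + s \<in> {real n..real n + 1}" "clamp s = s" by (auto simp: clamp_def)
      show ?case
        unfolding s(2)
        by (rule block_integral[where B=B]) (use bt(2) B[OF s(1)] in auto)
    qed
  qed (simp_all add: block_def)
  also have "\<dots> = (LINT x|torus. LINT s|circle. R n x * ?b (real n + clamp s, ?S s x))"
  proof -
    interpret pair_prob_space circle torus ..
    have st: "sets (circle \<Otimes>\<^sub>M torus) = sets (borel \<Otimes>\<^sub>M borel)"
      by (intro sets_pair_measure_cong) auto
    have "integrable (circle \<Otimes>\<^sub>M torus) (\<lambda>(s, x). R n x * ?b (real n + clamp s, ?S s x))"
      by (rule P.integrable_const_bound[where B=B])
         (use bB in \<open>auto simp: measurable_cong_sets[OF st refl] case_prod_beta'\<close>)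
    then show ?thesis by (rule Fubini_integral[symmetric])
  qed
  also have "\<dots> = (LINT x|torus. R n x * \<phi> (real (Suc n), ?S 1 x) - R n x * \<phi> (real n, x))"
  proof (rule Bochner_Integration.integral_cong)
    fix x
    have der: "((\<lambda>s. \<phi> (real n + s, ?S s x)) has_real_derivative ?b (real n + s, ?S s x)) (at s)" for s
    proof -
      let ?v = "(1 :: real, profile (x $ (?i + 1) + w n) *\<^sub>R axis ?i 1 :: real ^ 2)"
      have "((\<lambda>s. (real n + s, ?S s x)) has_vector_derivative ?v) (at s)"
        unfolding shear_def
        by (auto intro!: derivative_eq_intros has_vector_derivative_Pair)
      from DERIV_along_line[OF C this]
      have "((\<lambda>s. \<phi> (real n + s, ?S s x)) has_real_derivative frechet_derivative \<phi> (at (real n + s, ?S s x)) ?v) (at s)" .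
      moreover have "?v = (1, 0) + profile (x $ (?i + 1) + w n) *\<^sub>R (0, axis ?i 1)" by simp
      then have "frechet_derivative \<phi> (at (real n + s, ?S s x)) ?v = ?b (real n + s, ?S s x)"
        unfolding block_transport_def
        by (simp only: linear_add[OF has_derivative_linear[OF C_infinity_has_derivative[OF C]]]
            frechet_derivative_scaleR[OF C] snd_conv shear_nth)
      ultimately show ?thesis by simp
    qed
    have "(LINT s|circle. ?b (real n + clamp s, ?S s x)) = \<phi> (real n + 1, ?S 1 x) - \<phi> (real n + 0, ?S 0 x)"
    proof (rule circle_integral_derivative_endpoints[where S="{}" and B=B])
      show "continuous_on {0..1} (\<lambda>s. \<phi> (real n + s, ?S s x))"
        using der by (intro DERIV_continuous_on) (auto intro: DERIV_subset)
      show "((\<lambda>s. \<phi> (real n + s, ?S s x)) has_real_derivative ?b (real n + clamp s, ?S s x)) (at s)"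
        if "s \<in> {0<..<1} - {}" for s
        using der[of s] cl_id[of s] that by simp
    qed (use B[OF cl] in auto)
    then show "(LINT s|circle. R n x * ?b (real n + clamp s, ?S s x)) =
        R n x * \<phi> (real (Suc n), ?S 1 x) - R n x * \<phi> (real n, x)"
      by (simp add: right_diff_distrib add.commute)
  qed simp
  also have "\<dots> = (LINT x|torus. R n x * \<phi> (real (Suc n), ?S 1 x)) - (LINT x|torus. R n x * \<phi> (real n, x))"
  proof (rule Bochner_Integration.integral_diff)
    have le: "\<bar>R n x * \<phi> (t, y)\<bar> \<le> B2" if "t \<in> {real n..real n + 1}" for t x y
      using R_values[of n x] B2[OF that, of y] by (auto simp: abs_mult)
    show "integrable torus (\<lambda>x. R n x * \<phi> (real (Suc n), ?S 1 x))"
      by (rule torus_integrable_bounded[where B=B2]) (use le in auto)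
    show "integrable torus (\<lambda>x. R n x * \<phi> (real n, x))"
      by (rule torus_integrable_bounded[where B=B2]) (use le in auto)
  qed
  also have "(LINT x|torus. R n x * \<phi> (real (Suc n), ?S 1 x)) = (LINT x|torus. block n 1 x * \<phi> (real (Suc n), x))"
    by (rule block_integral[where B=B2, symmetric]) (use P B2 in auto)
  also have "\<dots> = (LINT x|torus. R (Suc n) x * \<phi> (real (Suc n), x))"
    by (simp add: block_def R_Suc)
  finally show ?thesis .
qed

text \<open>Each block contributes the increment of the pairing of \<open>R n\<close> with
  \<open>\<phi>\<close>, and the sum telescopes. The ends vanish: at time 0 because
  \<open>a > 0\<close>, at time \<open>N\<close> because \<open>b < N\<close>.\<close>

lemma weak_formulation:
  assumes \<phi>: "spacetime_test_function \<phi>"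
  shows "(LINT (t, x)|lebesgue_on ({0..} \<times> unit_cell). dens t x * transport \<phi> t x) = 0"
proof -
  obtain a b where C: "C_infinity \<phi>" and P: "\<And>t. periodic (\<lambda>x. \<phi> (t, x))" and a: "0 < a"
    and supp: "\<And>t x. t \<notin> {a..b} \<Longrightarrow> \<phi> (t, x) = 0"
    using \<phi> unfolding spacetime_test_function_def by blast
  obtain N where N: "b < real N" using reals_Archimedean2 by blast
  define g where "g z = dens (fst z) (snd z) * transport \<phi> (fst z) (snd z)" for z
  have [measurable]: "g \<in> borel_measurable (borel \<Otimes>\<^sub>M borel)"
  proof -
    have [measurable]: "block_transport \<phi> n \<in> borel_measurable (borel \<Otimes>\<^sub>M borel)" for n
      unfolding borel_prod by (rule borel_measurable_continuous_onI[OF block_transport_facts(1)[OF C P]])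
    have [measurable]: "(\<lambda>z :: real \<times> (real ^ 2). nat \<lfloor>fst z\<rfloor>) \<in> borel \<Otimes>\<^sub>M borel \<rightarrow>\<^sub>M count_space UNIV" by measurable
    have "(\<lambda>z. transport \<phi> (fst z) (snd z)) = (\<lambda>z. block_transport \<phi> (nat \<lfloor>fst z\<rfloor>) z)"
      using transport_block[OF C refl] by simp
    moreover have "(\<lambda>z. block_transport \<phi> (nat \<lfloor>fst z\<rfloor>) z) \<in> borel_measurable (borel \<Otimes>\<^sub>M borel)"
      by (rule measurable_compose_countable) auto
    ultimately show ?thesis
      unfolding g_def by (intro borel_measurable_times dens_measurable_pair) (simp only:)
  qed
  then have g_borel: "g \<in> borel_measurable borel" by (simp add: borel_prod)
  have [measurable]: "{0 :: real..} \<times> unit_cell \<in> sets borel"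
    unfolding borel_prod[symmetric] by (intro pair_measureI) auto
  \<comment> \<open>Beyond \<open>b\<close> the test function vanishes on an open set, hence so do
    its derivatives, and finitely many blocks remain.\<close>
  have zero: "g (t, x) = 0" if "t > b" for t x
  proof -
    have "(\<phi> has_derivative (\<lambda>_. 0)) (at (t, x))"
    proof (rule has_derivative_transform_within_open[OF has_derivative_const])
      show "open ({b<..} \<times> (UNIV :: (real ^ 2) set))" by (intro open_Times) auto
      show "(t, x) \<in> {b<..} \<times> UNIV" using that by simp
      show "0 = \<phi> z" if "z \<in> {b<..} \<times> UNIV" for z
        using supp[of "fst z" "snd z"] that by auto
    qed
    then have "frechet_derivative \<phi> (at (t, x)) = (\<lambda>_. 0)" by (simp add: frechet_derivative_at[symmetric])
    then show ?thesis by (simp add: g_def transport_def)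
  qed
  have blk: "g (t, x) = block n (t - real n) x * block_transport \<phi> n (t, x)" if "t \<in> {real n..<real n + 1}" for n t x
    using dens_block[of t n] transport_block[OF C nat_floor_block[OF that]] that by (simp add: g_def)
  have J: "(LINT z|lborel. indicator ({real n..<real n + 1} \<times> unit_cell) z * g z) =
       (LINT x|torus. R (Suc n) x * \<phi> (real (Suc n), x)) - (LINT x|torus. R n x * \<phi> (real n, x))"
    and I: "integrable lborel (\<lambda>z. indicator ({real n..<real n + 1} \<times> unit_cell) z * g z)" for n
  proof -
    note bt = block_transport_facts[OF C P, of n]
    obtain B where B: "\<And>t x. t \<in> {real n..real n + 1} \<Longrightarrow> \<bar>block_transport \<phi> n (t, x)\<bar> \<le> B"
      by (rule periodic_continuous_bounded[OF bt(1) bt(2)]) blast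
    have gB: "\<bar>g (t, x)\<bar> \<le> B" if "t \<in> {real n..<real n + 1}" for t x
    proof -
      have "block n (t - real n) x \<in> {1, -1}" unfolding block_def by (rule R_values)
      then show ?thesis using B[of t x] that unfolding blk[OF that] by (auto simp: abs_mult)
    qed
    show "integrable lborel (\<lambda>z. indicator ({real n..<real n + 1} \<times> unit_cell) z * g z)"
      by (rule lborel_block_integral(2)[OF g_borel gB])
    have "(LINT z|lborel. indicator ({real n..<real n + 1} \<times> unit_cell) z * g z) =
        (LINT s|circle. LINT x|torus. g (real n + s, x))"
      by (rule lborel_block_integral(1)[OF g_borel gB])
    also have "\<dots> = (LINT s|circle. LINT x|torus. block n s x * block_transport \<phi> n (real n + s, x))"
    proof (rule integral_cong_AE)
      have [measurable]: "block_transport \<phi> n \<in> borel_measurable (borel \<Otimes>\<^sub>M borel)"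
        unfolding borel_prod by (rule borel_measurable_continuous_onI[OF bt(1)])
      show "(\<lambda>s. LINT x|torus. block n s x * block_transport \<phi> n (real n + s, x)) \<in> borel_measurable circle"
        unfolding block_def by measurable
      show "AE s in circle. (LINT x|torus. g (real n + s, x)) =
          (LINT x|torus. block n s x * block_transport \<phi> n (real n + s, x))"
        using AE_circle
      proof eventually_elim
        case (elim s)
        then show ?case using blk[of "real n + s" n] by simp
      qed
    qed measurable
    also note block_transport_integral[OF C P]
    finally show "(LINT z|lborel. indicator ({real n..<real n + 1} \<times> unit_cell) z * g z) =
       (LINT x|torus. R (Suc n) x * \<phi> (real (Suc n), x)) - (LINT x|torus. R n x * \<phi> (real n, x))" .
  qed
  have split: "indicator ({0..} \<times> unit_cell) z * g z =
      (\<Sum>n<N. indicator ({real n..<real n + 1} \<times> unit_cell) z * g z)" for z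
  proof (cases "fst z \<in> {0..<real N}")
    case True
    define m where "m = nat \<lfloor>fst z\<rfloor>"
    have m: "m < N" using True by (simp add: m_def) linarith
    have iff: "fst z \<in> {real n..<real n + 1} \<longleftrightarrow> n = m" for n
      using nat_floor_block[of "fst z" n] True unfolding m_def by (auto; linarith)
    have "(\<Sum>n<N. indicator ({real n..<real n + 1} \<times> unit_cell) z * g z) =
        (\<Sum>n<N. if n = m then indicator unit_cell (snd z) * g z else 0)"
      by (intro sum.cong refl) (use iff in \<open>cases z; auto simp: indicator_def\<close>)
    also have "\<dots> = indicator unit_cell (snd z) * g z" using m by simp
    finally show ?thesis using True by (cases z) (auto simp: indicator_def)
  next
    case False
    then consider "fst z < 0" | "fst z > b" using N by fastforce
    then show ?thesis
    proof cases
      case 1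
      then show ?thesis by (cases z) (auto simp: indicator_def intro!: sum.neutral[symmetric])
    next
      case 2
      then show ?thesis using zero[of "fst z" "snd z"] by simp
    qed
  qed
  have "(LINT (t, x)|lebesgue_on ({0..} \<times> unit_cell). dens t x * transport \<phi> t x) = (LINT z|lebesgue_on ({0..} \<times> unit_cell). g z)"
    by (simp add: g_def case_prod_beta')
  also have "\<dots> = (LINT z|lborel. indicator ({0..} \<times> unit_cell) z *\<^sub>R g z)"
    by (rule lebesgue_on_integral) (use g_borel in auto)
  also have "\<dots> = (\<Sum>n<N. (LINT z|lborel. indicator ({real n..<real n + 1} \<times> unit_cell) z * g z))"
    unfolding real_scaleR_def split by (rule Bochner_Integration.integral_sum) (rule I)
  also have "\<dots> = (\<Sum>n<N. (LINT x|torus. R (Suc n) x * \<phi> (real (Suc n), x)) - (LINT x|torus. R n x * \<phi> (real n, x)))"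
    by (simp only: J)
  also have "\<dots> = (LINT x|torus. R N x * \<phi> (real N, x)) - (LINT x|torus. R 0 x * \<phi> (real 0, x))"
    by (rule sum_lessThan_telescope)
  also have "\<dots> = 0" using supp N a by simp
  finally show ?thesis .
qed

lemma continuity_equation: "continuity_equation_solution vel dens"
  unfolding continuity_equation_solution_def
proof (intro conjI allI impI)
  fix t :: real
  show "periodic (dens t)" "dens t \<in> borel_measurable torus_measure"
    using torus_functionD(3)[OF torus_function_dens]
      borel_measurable_lebesgue_on[OF torus_functionD(1)[OF torus_function_dens]] .
next
  show "\<exists>B. \<forall>t\<ge>0. \<forall>x. \<bar>dens t x\<bar> \<le> B"
    using torus_functionD(2)[OF torus_function_dens] by blast
  show "(\<lambda>(t, x). dens t x) \<in> borel_measurable (lebesgue_on ({0..} \<times> unit_cell))"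
    using dens_measurable_pair unfolding borel_prod
    by (intro borel_measurable_lebesgue_on) (simp add: case_prod_beta')
next
  fix \<psi> assume \<psi>: "test_function \<psi>"
  have "(LINT x|torus_measure. dens t x * \<psi> x) = (LINT x|torus. dens t x * \<psi> x)" for t
    by (intro torus_measure_integral borel_measurable_times torus_functionD(1)[OF torus_function_dens] test_function_bounded(1)[OF \<psi>])
  then show "continuous_on {0..} (\<lambda>t. LINT x|torus_measure. dens t x * \<psi> x)"
    using dens_weakly_continuous[OF \<psi>] by simp
next
  fix \<phi> assume "spacetime_test_function \<phi>"
  from weak_formulation[OF this]
  show "(LINT (t, x)|lebesgue_on ({0..} \<times> unit_cell). dens t x * (frechet_derivative \<phi> (at (t, x)) (1, 0) +
      frechet_derivative \<phi> (at (t, x)) (0, vel t x))) = 0"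
    by (simp only: transport_def)
qed

end

subsection \<open>Choosing the phases\<close>

text \<open>The starting density: \<open>energy_le_4\<close> covers any admissible function, so a
  simple one with values 1 and -1 and mean zero is taken.\<close>

definition stripes :: "real ^ 2 \<Rightarrow> real" where
  "stripes x = (if frac (x $ 1) < 1 / 2 then 1 else - 1)"

lemma torus_function_stripes: "torus_function stripes"
proof -
  have "stripes \<in> borel_measurable borel" unfolding stripes_def[abs_def] by measurable
  moreover have "periodic stripes"
    by (simp add: periodic_def stripes_def lattice_point_def frac_add_int)
  ultimately show ?thesis by (simp add: torus_function_def stripes_def)
qed

text \<open>Translation by half a period along the first axis changes the sign.\<close>

lemma integral_stripes: "(LINT x|torus. stripes x) = 0"
proof -
  note [measurable] = torus_functionD(1)[OF torus_function_stripes]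
  define v :: "real ^ 2" where "v = axis 1 (1 / 2)"
  have half: "frac (a + 1 / 2) < 1 / 2 \<longleftrightarrow> \<not> frac a < 1 / 2" for a :: real
  proof -
    have "frac (a + 1 / 2) = (if frac a < 1 / 2 then frac a + 1 / 2 else frac a - 1 / 2)"
      by (auto simp: frac_add frac_eq)
    then show ?thesis using frac_ge_0[of a] frac_lt_1[of a] by (auto split: if_splits; linarith)
  qed
  have "stripes (x + v) = - stripes x" for x
    using half[of "x $ 1"] unfolding stripes_def v_def by (simp add: axis_def)
  moreover have "(LINT x|torus. stripes (x + v)) = (LINT x|torus. stripes x)"
    by (rule torus_integral_translate[where B=1])
       (use torus_functionD[OF torus_function_stripes] in auto)
  ultimately show ?thesis by simp
qed

text \<open>Dependent choice over \<open>good\<close>, each phase coming from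
  \<open>exists_good_phase\<close>. Listing the next axis first exchanges the coordinates of the
  sheared function, which is how \<open>swapped\<close> matches the alternation of the axes.\<close>

lemma exists_mixer: "\<exists>R w. mixer R w"
proof -
  define good where "good n f \<longleftrightarrow> torus_function f \<and> (\<forall>x. f x \<in> {1, -1}) \<and> (LINT x|torus. f x) = 0 \<and>
     energy (\<lambda>z. f (pt (of_nat n) z)) \<le> ennreal (4 / 2 ^ n)" for n :: nat and f
  have "\<exists>R. \<forall>n. good n (R n) \<and> (\<exists>w. R (Suc n) = (\<lambda>x. R n (shear (of_nat n) w (- 1) x)))"
  proof (rule dependent_nat_choice)
    have "energy (\<lambda>z. stripes (pt (of_nat 0) z)) \<le> 4"
      by (rule energy_le_4[OF cell_function_pt[OF torus_function_stripes]])
    then show "\<exists>f. good 0 f"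
      using torus_function_stripes integral_stripes
      by (intro exI[of _ stripes]) (auto simp: good_def stripes_def)
  next
    fix f n assume f: "good n f"
    let ?i = "of_nat n :: 2" and ?r = "\<lambda>z. f (pt (of_nat n) z)"
    have tf: "torus_function f" using f by (simp add: good_def)
    have "\<exists>w. energy (swapped (sheared w ?r)) \<le> ennreal (4 / 2 ^ n / 2)"
      by (rule exists_good_phase[OF cell_function_pt[OF tf]]) (use f in \<open>auto simp: good_def\<close>)
    then obtain w where w: "energy (swapped (sheared w ?r)) \<le> ennreal (4 / 2 ^ Suc n)" by auto
    define f' where "f' x = f (shear ?i w (- 1) x)" for x
    have "(\<lambda>z. f' (pt (of_nat (Suc n)) z)) = swapped (sheared w ?r)"
    proof
      fix z :: "real \<times> real"
      have "pt (of_nat (Suc n)) z = pt ?i (snd z, fst z)"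
        using pt_swap[of ?i "fst z" "snd z"] by (simp add: add.commute)
      then show "f' (pt (of_nat (Suc n)) z) = swapped (sheared w ?r) z"
        by (simp add: f'_def shear_pt swapped_def sheared_def case_prod_beta)
    qed
    moreover have "(LINT x|torus. f' x) = 0"
      using torus_integral_shear_move[OF tf, of "\<lambda>_. 1" 1 ?i w 1] f
      by (simp add: f'_def good_def periodic_def)
    moreover have "torus_function f'" unfolding f'_def by (rule torus_function_shear[OF tf])
    moreover have "\<forall>x. f' x \<in> {1, -1}" using f by (simp add: f'_def good_def)
    ultimately have "good (Suc n) f'" using w by (simp add: good_def)
    then show "\<exists>g. good (Suc n) g \<and> (\<exists>w. g = (\<lambda>x. f (shear ?i w (- 1) x)))"
      by (intro exI[of _ f']) (auto simp: f'_def[abs_def])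
  qed
  then obtain R where R: "\<And>n. good n (R n)" "\<And>n. \<exists>w. R (Suc n) = (\<lambda>x. R n (shear (of_nat n) w (- 1) x))" by blast
  then obtain w where w: "\<And>n. R (Suc n) = (\<lambda>x. R n (shear (of_nat n) (w n) (- 1) x))" by metis
  have "mixer R w"
    by standard (use R(1) w in \<open>auto simp: good_def torus_function_def\<close>)
  then show ?thesis by blast
qed

theorem mainTheorem1:
  fixes \<kappa> :: real
  assumes "0 < \<kappa>" and "\<kappa> < 1 / 2"
  shows "\<exists>(u :: real \<Rightarrow> real ^ 2 \<Rightarrow> real ^ 2) (\<rho> :: real \<Rightarrow> real ^ 2 \<Rightarrow> real).
    velocity_field u \<and>
    (\<forall>t\<ge>0. divergence_free (u t)) \<and>
    (\<forall>p::ennreal. 1 \<le> p \<longrightarrow> (SUP t\<in>{0..}. W1p_seminorm p (u t)) < \<infinity>) \<and>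
    continuity_equation_solution u \<rho> \<and>
    (\<forall>t\<ge>0. \<forall>x. \<rho> t x \<in> {1, -1}) \<and>
    (LINT x|torus_measure. \<rho> 0 x) = 0 \<and>
    (\<exists>C c :: real. C > 0 \<and> c > 0 \<and>
      (\<forall>t\<ge>0. functional_mixing_scale (\<rho> t) \<le> ennreal (C * exp (- c * t)) \<and>
             geometric_mixing_scale \<kappa> (\<rho> t) \<le> ennreal (C * exp (- c * t))))"
proof -
  obtain R w where "mixer R w" using exists_mixer by blast
  then interpret mixer R w .
  show ?thesis
  proof (intro exI[of _ vel] exI[of _ dens] conjI allI impI)
    show "velocity_field vel" by (rule velocity_field_vel)
    show "divergence_free (vel t)" for t by (simp add: vel_def divergence_free_velocity)
    show "(SUP t\<in>{0..}. W1p_seminorm p (vel t)) < \<infinity>" if "1 \<le> p" for p by (rule W1p_vel[OF that])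
    show "continuity_equation_solution vel dens" by (rule continuity_equation)
    show "dens t x \<in> {1, -1}" for t x by (rule dens_values)
    show "(LINT x|torus_measure. dens 0 x) = 0"
      using dens_mean[of 0] by (simp add: torus_measure_integral torus_functionD(1)[OF torus_function_dens])
    show "\<exists>C c. 0 < C \<and> 0 < c \<and> (\<forall>t\<ge>0. functional_mixing_scale (dens t) \<le> ennreal (C * exp (- c * t)) \<and>
        geometric_mixing_scale \<kappa> (dens t) \<le> ennreal (C * exp (- c * t)))"
      by (rule mixing_scales[OF assms])
  qed
qed

end
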